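(* For every integer $d\geq 1$, every bipartite graph that contains none of the armchair, the stirrer, the tripod and $K_{d+1,d+1}$ as an induced subgraph has pathwidth at most $4d-1$.
   Context: The armchair is a 4-cycle $abcd$ with one pendant vertex attached to each of $a,b,c$ (7 vertices); the stirrer is the domino (two 4-cycles sharing an edge, i.e. the $2\times3$ grid) with one pendant vertex attached to one of its two degree-3 vertices; the tripod is $K_{1,3}$ with each edge subdivided once. A path decomposition of $G=(V,E)$ is a sequence $(B_1,\dots,B_r)$ of subsets of $V$ such that every vertex lies in some $B_i$, every edge is contained in some $B_i$, and for each vertex $v$ the set $\{i: v\in B_i\}$ is an interval; its width is $\max_i|B_i|-1$, and the pathwidth is the minimum width. *)

theory Defs
  imports "Graph_Theory.Graph_Theory"
begin

text \<open>
  Finite simple undirected graphs are the finite, symmetric, loop-free digraphs without parallel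
  arcs, i.e. the locale \<^locale>\<open>pair_graph\<close>: an edge \<open>uv\<close> is the pair of arcs \<open>(u, v)\<close>, \<open>(v, u)\<close>.
\<close>

definition bipartite :: "'a pair_pre_digraph \<Rightarrow> bool" where
  "bipartite G \<longleftrightarrow> (\<exists>X Y. pverts G = X \<union> Y \<and> X \<inter> Y = {} \<and> parcs G \<subseteq> X \<times> Y \<union> Y \<times> X)"

definition contains_induced :: "'a pair_pre_digraph \<Rightarrow> 'b pair_pre_digraph \<Rightarrow> bool" where
  "contains_induced G H \<longleftrightarrow>
    (\<exists>H'. induced_subgraph (with_proj H') (with_proj G) \<and> digraph_iso (with_proj H) (with_proj H'))"

text \<open>The graph without isolated vertices whose edges are listed, each in one orientation.\<close>

definition graph_of_edges :: "'a rel \<Rightarrow> 'a pair_pre_digraph" where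
  "graph_of_edges es = \<lparr> pverts = Field es, parcs = es \<union> es\<inverse> \<rparr>"

text \<open>The 4-cycle \<open>abcd\<close> is \<open>0, 1, 2, 3\<close>; the pendants \<open>4, 5, 6\<close> hang at \<open>a, b, c\<close>.\<close>

definition armchair :: "nat pair_pre_digraph" where
  "armchair = graph_of_edges {(0,1), (1,2), (2,3), (3,0), (0,4), (1,5), (2,6)}"

text \<open>The rows of the grid are \<open>0, 1, 2\<close> and \<open>3, 4, 5\<close>; the pendant \<open>6\<close> hangs at \<open>1\<close>.\<close>

definition stirrer :: "nat pair_pre_digraph" where
  "stirrer = graph_of_edges {(0,1), (1,2), (3,4), (4,5), (0,3), (1,4), (2,5), (1,6)}"

definition tripod :: "nat pair_pre_digraph" where
  "tripod = graph_of_edges {(0,1), (0,2), (0,3), (1,4), (2,5), (3,6)}"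

text \<open>
  At least one bag is required, so that the width is well defined even for the graph without
  vertices (which then has pathwidth \<open>-1\<close>).
\<close>

definition path_decomposition :: "'a pair_pre_digraph \<Rightarrow> 'a set list \<Rightarrow> bool" where
  "path_decomposition G Bs \<longleftrightarrow>
    Bs \<noteq> [] \<and>
    (\<forall>B\<in>set Bs. B \<subseteq> pverts G) \<and>
    (\<forall>v\<in>pverts G. \<exists>B\<in>set Bs. v \<in> B) \<and>
    (\<forall>(u, v)\<in>parcs G. \<exists>B\<in>set Bs. {u, v} \<subseteq> B) \<and>
    (\<forall>v\<in>pverts G. \<forall>i j k. i \<le> j \<and> j \<le> k \<and> k < length Bs \<and> v \<in> Bs ! i \<and> v \<in> Bs ! k \<longrightarrow> v \<in> Bs ! j)"

definition width :: "'a set list \<Rightarrow> int" where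
  "width Bs = int (Max (card ` set Bs)) - 1"

text \<open>
  The infimum is a minimum: the widths are integers bounded below by \<open>-1\<close>, and the one-bag
  sequence \<open>[pverts G]\<close> is always a path decomposition of a graph.
\<close>

definition pathwidth :: "'a pair_pre_digraph \<Rightarrow> int" where
  "pathwidth G = Inf {width Bs | Bs. path_decomposition G Bs}"

lemma pair_graph_graph_of_edges:
  assumes "finite es" "irrefl es"
  shows "pair_graph (graph_of_edges es)"
proof unfold_locales
  show "symmetric (with_proj (graph_of_edges es))"
    by (simp add: graph_of_edges_def symmetric_def sym_Un_converse)
qed (use assms in \<open>auto simp: graph_of_edges_def Field_def irrefl_def finite_Domain finite_Range\<close>)

lemma pair_graph_armchair: "pair_graph armchair"
  and pair_graph_stirrer: "pair_graph stirrer"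
  and pair_graph_tripod: "pair_graph tripod"
  unfolding armchair_def stirrer_def tripod_def
  by (auto intro!: pair_graph_graph_of_edges simp: irrefl_def)

lemma contains_induced_iff:
  assumes G: "pair_graph G" and H: "pair_graph H"
  shows "contains_induced G H \<longleftrightarrow>
    (\<exists>f. inj_on f (pverts H) \<and> f ` pverts H \<subseteq> pverts G \<and>
      (\<forall>u\<in>pverts H. \<forall>v\<in>pverts H. (u, v) \<in> parcs H \<longleftrightarrow> (f u, f v) \<in> parcs G))"
    (is "_ \<longleftrightarrow> (\<exists>f. ?emb f)")
proof
  interpret G: pair_graph G by fact
  interpret H: pair_graph H by fact
  {
    assume "contains_induced G H"
    then obtain H' h where ind: "induced_subgraph (with_proj H') (with_proj G)"
      and iso: "H.digraph_isomorphism h" and eq: "with_proj H' = app_iso h (with_proj H)"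
      unfolding contains_induced_def digraph_iso_def by blast
    let ?f = "iso_verts h"
    have V: "pverts H' = ?f ` pverts H" and A: "parcs H' = iso_arcs h ` parcs H"
      and t: "iso_tail h = fst" and hd: "iso_head h = snd"
      using eq by (simp_all add: with_proj_def app_iso_def)
    have arc: "iso_arcs h (u, v) = (?f u, ?f v)" if "(u, v) \<in> parcs H" for u v
      using iso that t hd by (force simp: H.digraph_isomorphism_def prod_eq_iff)
    have inj: "inj_on ?f (pverts H)" using iso by (simp add: H.digraph_isomorphism_def)
    have sub: "pverts H' \<subseteq> pverts G"
      and par: "parcs H' = {e \<in> parcs G. fst e \<in> pverts H' \<and> snd e \<in> pverts H'}"
      using ind by (auto simp: induced_subgraph_def subgraph_def)
    have "(u, v) \<in> parcs H \<longleftrightarrow> (?f u, ?f v) \<in> parcs G"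
      if uv: "u \<in> pverts H" "v \<in> pverts H" for u v
    proof
      assume "(u, v) \<in> parcs H"
      then have "(?f u, ?f v) \<in> parcs H'" using arc A by force
      then show "(?f u, ?f v) \<in> parcs G" using par by auto
    next
      assume "(?f u, ?f v) \<in> parcs G"
      then have "(?f u, ?f v) \<in> parcs H'" using par V uv by auto
      then obtain x y where xy: "(x, y) \<in> parcs H" "(?f u, ?f v) = iso_arcs h (x, y)"
        unfolding A by auto
      then have "?f u = ?f x" "?f v = ?f y" using arc by auto
      then have "u = x" "v = y" using inj uv xy(1) H.wellformed' by (auto dest: inj_onD)
      then show "(u, v) \<in> parcs H" using xy by simp
    qed
    then show "\<exists>f. ?emb f" using inj sub V by auto
  }
  {
    assume "\<exists>f. ?emb f"
    then obtain f where f: "?emb f" by blast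
    let ?h = "\<lparr> iso_verts = f, iso_arcs = map_prod f f, iso_head = snd, iso_tail = fst \<rparr>"
    let ?H' = "\<lparr> pverts = f ` pverts H, parcs = map_prod f f ` parcs H \<rparr>"
    have "inj_on (map_prod f f) (parcs H)"
      by (rule inj_on_subset[OF map_prod_inj_on[OF conjunct1[OF f] conjunct1[OF f]]])
        (auto dest: H.wellformed')
    then have "H.digraph_isomorphism ?h"
      using f H.wf_digraph_axioms by (auto simp: H.digraph_isomorphism_def)
    moreover have "with_proj ?H' = app_iso ?h (with_proj H)"
      by (simp add: with_proj_def app_iso_def)
    ultimately have "digraph_iso (with_proj H) (with_proj ?H')"
      unfolding digraph_iso_def by blast
    moreover have "induced_subgraph (with_proj ?H') (with_proj G)"
    proof (rule induced_subgraphI)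
      have "wf_digraph (with_proj ?H')"
        by unfold_locales (auto dest: H.wellformed')
      then show "subgraph (with_proj ?H') (with_proj G)"
        using f G.wf_digraph_axioms
        by (auto simp: subgraph_def compatible_def dest: H.wellformed')
      have "parcs ?H' = {(x, y) \<in> parcs G. x \<in> f ` pverts H \<and> y \<in> f ` pverts H}"
      proof (intro set_eqI iffI)
        fix e assume "e \<in> parcs ?H'"
        then show "e \<in> {(x, y) \<in> parcs G. x \<in> f ` pverts H \<and> y \<in> f ` pverts H}"
          using f by (auto dest: H.wellformed')
      next
        fix e assume "e \<in> {(x, y) \<in> parcs G. x \<in> f ` pverts H \<and> y \<in> f ` pverts H}"
        then obtain u v where "u \<in> pverts H" "v \<in> pverts H" "e = (f u, f v)" "e \<in> parcs G"
          by auto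
        then have "(u, v) \<in> parcs H" "e = map_prod f f (u, v)" using f by auto
        then show "e \<in> parcs ?H'" by auto
      qed
      then show "arcs (with_proj ?H') = {e \<in> arcs (with_proj G).
          tail (with_proj G) e \<in> verts (with_proj ?H') \<and> head (with_proj G) e \<in> verts (with_proj ?H')}"
        by auto
    qed
    ultimately show "contains_induced G H" unfolding contains_induced_def by blast
  }
qed

lemma pathwidth_le_iff:
  assumes "pair_graph G"
  shows "pathwidth G \<le> k \<longleftrightarrow> (\<exists>Bs. path_decomposition G Bs \<and> width Bs \<le> k)"
proof -
  interpret pair_graph G by fact
  let ?W = "{width Bs | Bs. path_decomposition G Bs}"
  have "path_decomposition G [pverts G]"
    by (auto simp: path_decomposition_def dest: wellformed')
  then have ne: "?W \<noteq> {}" by blast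
  have bdd: "bdd_below ?W"
    by (rule bdd_belowI[of _ "-1"]) (auto simp: width_def)
  show ?thesis
  proof
    assume "pathwidth G \<le> k"
    then have "Inf ?W < k + 1" by (simp add: pathwidth_def)
    from cInf_lessD[OF ne this] show "\<exists>Bs. path_decomposition G Bs \<and> width Bs \<le> k" by force
  next
    assume "\<exists>Bs. path_decomposition G Bs \<and> width Bs \<le> k"
    then obtain Bs where "path_decomposition G Bs" "width Bs \<le> k" by blast
    then have "width Bs \<in> ?W" "width Bs \<le> k" by auto
    then show "pathwidth G \<le> k"
      unfolding pathwidth_def using cInf_lower[OF _ bdd] by (meson order_trans)
  qed
qed

end

theory Submission
  imports Defs
begin

text \<open>
  Sweeping a pair of windows of \<open>d\<close> consecutive vertices along a strong ordering of the two
  sides gives bags of size \<open>2 d\<close>, because an edge missed by every bag would span a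
  \<open>K\<^bsub>d+1,d+1\<^esub>\<close>. A connected graph without holes of length at least 6 has such an ordering: a vertex
  \<open>r\<close> of the last breadth-first level from any start, with inclusion-minimal neighbourhood, is an end
  of the graph, and the breadth-first levels from \<open>r\<close>, suitably ordered inside, form the ordering.

  If there are holes, then all of them dominate the graph. Let \<open>A\<close> be a largest set with more than
  \<open>d\<close> common neighbours, \<open>S\<close> the set of these, and \<open>B\<close> a largest trace on \<open>S\<close> of a vertex outside
  \<open>A\<close>; if no vertex has more than \<open>d\<close> neighbours, any maximal biclique serves as \<open>A\<close> and \<open>S\<close>.
  Then \<open>A \<union> B\<close> has at most \<open>2 d\<close> vertices and meets every hole, so adding it to all
  bags yields \<open>4 d\<close>. The only obstruction is the cube minus a vertex; when it occurs, the bipartite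
  complement has at least three nontrivial components, all of them chain graphs, and the graph has a
  vertex cover with fewer than \<open>4 d\<close> vertices.
\<close>

section \<open>Interval models\<close>

text \<open>In a strong ordering every crossing is filled: if \<open>x\<close> precedes
  \<open>x'\<close> and their neighbours \<open>y\<close>, \<open>y'\<close> come in the opposite
  order, then \<open>adj x y'\<close> and \<open>adj x' y\<close>. So an edge joining positions too
  far apart spans a whole biclique. Such an ordering grows in one direction, hence the search for an
  end. Far from the start the tripod keeps the levels in order, since two steps back supply its
  third leg; only the levels next to \<open>r\<close> need conditions of their own.

  Holes spoil this and are hit by few vertices. As a hole dominates its component, a biclique off
  the hole has a side with a common neighbour on the hole: a Helly property, valid once the cube
  minus a vertex is excluded. Closedness of \<open>A\<close> and \<open>S\<close> puts that
  neighbour into \<open>S\<close>, and the maximality of \<open>B\<close> does the rest. In the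
  exceptional case three components matter because a large one leaves two others outside, and an
  edge between those two completes an induced pair of edges inside to a stirrer.

  Bags are the points of a family of intervals; for a symmetric \<open>adj\<close>, the condition
  \<open>l u \<le> r v\<close> in both orders says that the two intervals meet.\<close>

definition interval_model :: "'a set \<Rightarrow> ('a \<Rightarrow> 'a \<Rightarrow> bool) \<Rightarrow> nat \<Rightarrow> bool" where
  "interval_model V adj k \<longleftrightarrow> (\<exists>l r :: 'a \<Rightarrow> nat.
     (\<forall>v\<in>V. l v \<le> r v) \<and> (\<forall>u v. adj u v \<longrightarrow> l u \<le> r v) \<and>
     (\<forall>t. card {v \<in> V. l v \<le> t \<and> t \<le> r v} \<le> k))"

text \<open>In a bipartite graph, complete adjacency between nonempty sets already puts them on
  opposite sides, so the bicliques excluded here are induced subgraphs.\<close>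

definition biclique_free :: "nat \<Rightarrow> ('a \<Rightarrow> 'a \<Rightarrow> bool) \<Rightarrow> bool" where
  "biclique_free d adj \<longleftrightarrow>
    (\<forall>A B. finite A \<and> finite B \<and>
        (\<forall>a\<in>A. \<forall>b\<in>B. adj a b) \<longrightarrow> card A \<le> d \<or> card B \<le> d)"

abbreviation induced :: "('a \<Rightarrow> 'a \<Rightarrow> bool) \<Rightarrow> 'a set \<Rightarrow> 'a \<Rightarrow> 'a \<Rightarrow> bool" where
  "induced adj W \<equiv> \<lambda>u v. adj u v \<and> u \<in> W \<and> v \<in> W"

lemma biclique_freeD:
  assumes "biclique_free d adj" "finite A" "finite B" "\<And>a b. a \<in> A \<Longrightarrow>
      b \<in> B \<Longrightarrow> adj a b"
  shows "card A \<le> d \<or> card B \<le> d"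
  using assms unfolding biclique_free_def by blast

lemma biclique_free_induced: "biclique_free d adj \<Longrightarrow> biclique_free d (induced adj W)"
  unfolding biclique_free_def by blast

lemma interval_model_mono:
  assumes "interval_model V adj k" "k \<le> k'"
  shows "interval_model V adj k'"
proof -
  obtain l r :: "'a \<Rightarrow> nat" where "\<forall>v\<in>V. l v \<le> r v" "\<forall>u v. adj u v \<longrightarrow> l u \<le> r v"
    "\<forall>t. card {v \<in> V. l v \<le> t \<and> t \<le> r v} \<le> k"
    using assms(1) unfolding interval_model_def by blast
  then show ?thesis
    unfolding interval_model_def
    by (intro exI[of _ l] exI[of _ r] conjI) (auto intro: le_trans[OF _ assms(2)])
qed

text \<open>The vertices of \<open>S\<close> are put into every relevant bag, at the price of
  \<open>s\<close> places.\<close>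

lemma interval_model_add_set:
  assumes V: "finite V" and S: "S \<subseteq> V"
    and "interval_model (V - S) (induced adj (V - S)) k" "card S \<le> s"
    and adj: "\<And>u v. adj u v \<Longrightarrow> u \<in> V \<and> v \<in> V"
  shows "interval_model V adj (s + k)"
proof -
  obtain l r :: "'a \<Rightarrow> nat" where lr: "\<And>v. v \<in> V - S \<Longrightarrow> l v \<le> r v"
    "\<And>u v. adj u v \<Longrightarrow> u \<in> V - S \<Longrightarrow>
        v \<in> V - S \<Longrightarrow> l u \<le> r v"
    "\<And>t. card {v \<in> V - S. l v \<le> t \<and> t \<le> r v} \<le> k"
    using assms(3) unfolding interval_model_def by blast
  \<comment> \<open>A bound on the left ends is enough: an edge between \<open>S\<close> and an old
    interval asks for \<open>l u \<le> N\<close> and \<open>0 \<le> r u\<close>.\<close>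
  define N where "N = Max (insert 0 (l ` V))"
  have N: "l v \<le> N" if "v \<in> V" for v
    unfolding N_def using V that by (intro Max_ge) auto
  let ?l = "\<lambda>v. if v \<in> S then 0 else l v" and ?r = "\<lambda>v. if v \<in> S then N else r v"
  have "card {v \<in> V. ?l v \<le> t \<and> t \<le> ?r v} \<le> s + k" for t
  proof -
    have "{v \<in> V. ?l v \<le> t \<and>
        t \<le> ?r v} \<subseteq> S \<union> {v \<in> V - S. l v \<le> t \<and> t \<le> r v}" by auto
    then have "card {v \<in> V. ?l v \<le> t \<and>
        t \<le> ?r v} \<le> card (S \<union> {v \<in> V - S. l v \<le> t \<and> t \<le> r v})"
      using V S by (intro card_mono) (auto intro: finite_subset)
    also have "\<dots> \<le> card S + card {v \<in> V - S. l v \<le> t \<and>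
        t \<le> r v}" by (rule card_Un_le)
    finally show ?thesis using lr(3)[of t] assms(4) by linarith
  qed
  moreover have "adj u v \<Longrightarrow> ?l u \<le> ?r v" for u v
    using lr(2)[of u v] N[of u] adj[of u v] by auto
  ultimately show ?thesis
    unfolding interval_model_def using lr(1) S
    by (intro exI[of _ ?l] exI[of _ ?r]) auto
qed

lemma interval_model_disjoint_union:
  assumes V: "finite V" and W: "W \<subseteq> V"
    and "interval_model W (induced adj W) k" "interval_model (V - W) (induced adj (V - W)) k"
    and adj: "\<And>u v. adj u v \<Longrightarrow>
        u \<in> V \<and> v \<in> V \<and> (u \<in> W \<longleftrightarrow> v \<in> W)"
  shows "interval_model V adj k"
proof -
  obtain l r :: "'a \<Rightarrow> nat" where lr: "\<And>v. v \<in> W \<Longrightarrow> l v \<le> r v"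
    "\<And>u v. adj u v \<Longrightarrow> u \<in> W \<Longrightarrow>
        v \<in> W \<Longrightarrow> l u \<le> r v"
    "\<And>t. card {v \<in> W. l v \<le> t \<and> t \<le> r v} \<le> k"
    using assms(3) unfolding interval_model_def by blast
  obtain l' r' :: "'a \<Rightarrow> nat" where lr': "\<And>v. v \<in> V - W \<Longrightarrow> l' v \<le> r' v"
    "\<And>u v. adj u v \<Longrightarrow> u \<in> V - W \<Longrightarrow>
        v \<in> V - W \<Longrightarrow> l' u \<le> r' v"
    "\<And>t. card {v \<in> V - W. l' v \<le> t \<and> t \<le> r' v} \<le> k"
    using assms(4) unfolding interval_model_def by blast
  \<comment> \<open>The intervals of \<open>V - W\<close> are shifted past the last right end used
    by \<open>W\<close>, so that no point meets both families.\<close>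
  define N where "N = Suc (Max (insert 0 (r ` W)))"
  have fin: "finite W" using V W finite_subset by blast
  have N: "r v < N" if "v \<in> W" for v
    unfolding N_def using fin that by (auto simp: less_Suc_eq_le intro: Max_ge)
  let ?l = "\<lambda>v. if v \<in> W then l v else N + l' v" and ?r = "\<lambda>v.
      if v \<in> W then r v else N + r' v"
  have "card {v \<in> V. ?l v \<le> t \<and> t \<le> ?r v} \<le> k" for t
  proof (cases "t < N")
    case True
    then have "{v \<in> V. ?l v \<le> t \<and> t \<le> ?r v} = {v \<in> W. l v \<le> t \<and> t \<le> r v}"
      using W by auto
    then show ?thesis using lr(3) by simp
  next
    case False
    then have "\<not> t \<le> r v" if "v \<in> W" for v using N[OF that] by simp
    with False have "{v \<in> V. ?l v \<le> t \<and>
        t \<le> ?r v} = {v \<in> V - W. l' v \<le> t - N \<and> t - N \<le> r' v}"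
      by auto
    then show ?thesis using lr'(3) by simp
  qed
  moreover have "adj u v \<Longrightarrow> ?l u \<le> ?r v" for u v
    using lr(2)[of u v] lr'(2)[of u v] adj[of u v] by auto
  ultimately show ?thesis
    unfolding interval_model_def using lr(1) lr'(1)
    by (intro exI[of _ ?l] exI[of _ ?r]) auto
qed

lemma interval_model_independent:
  assumes V: "finite V" and "\<And>u v. \<not> adj u v"
  shows "interval_model V adj 1"
proof -
  obtain f :: "'a \<Rightarrow> nat" where f: "inj_on f V"
    using finite_imp_inj_to_nat_seg[OF V] by blast
  have "card {v \<in> V. f v \<le> t \<and> t \<le> f v} \<le> 1" for t
  proof -
    have "{v \<in> V. f v \<le> t \<and> t \<le> f v} \<subseteq> V \<inter> f -` {t}" by auto
    also have "card (V \<inter> f -` {t}) \<le> 1"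
      using card_vimage_inj_on_le[OF f, of "{t}"] by (simp add: Int_commute)
    finally show ?thesis using V card_mono
      by (metis (no_types, lifting) finite_Int le_trans
          \<open>card (V \<inter> f -` {t}) \<le> 1\<close> \<open>{v \<in> V. f v \<le> t \<and>
              t \<le> f v} \<subseteq> V \<inter> f -` {t}\<close>)
  qed
  then show ?thesis unfolding interval_model_def using assms(2) by blast
qed

text \<open>Outside a vertex cover the graph is edgeless, so beside \<open>S\<close> each bag needs
  room for a single vertex.\<close>

lemma interval_model_vertex_cover:
  assumes "finite V" "S \<subseteq> V" "card S \<le> s"
    and "\<And>u v. adj u v \<Longrightarrow> u \<in> V \<and> v \<in> V" "\<And>u v. adj u v \<Longrightarrow>
        u \<in> S \<or> v \<in> S"
  shows "interval_model V adj (s + 1)"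
  using assms by (intro interval_model_add_set interval_model_independent) auto

section \<open>Sliding windows along a strong ordering\<close>

lemma card_le_if_narrow:
  fixes S :: "nat set"
  assumes "\<And>i j. i \<in> S \<Longrightarrow> j \<in> S \<Longrightarrow> j < i + d"
  shows "card S \<le> d"
proof (cases "S = {}")
  case False
  then have "S \<subseteq> {Inf S..<Inf S + d}"
    using assms Inf_nat_def1[OF False] by (auto intro: wellorder_Inf_le1)
  from card_mono[OF _ this] show ?thesis by simp
qed simp

text \<open>Two kinds of events are merged into one time line: row \<open>i\<close> arrives when its
  first column \<open>l i\<close> is next to depart, and column \<open>j\<close> departs when all
  \<open>k j\<close> rows whose first column is at most \<open>j\<close> have arrived. Their
  positions in the merged order are \<open>i + l i\<close> and \<open>j + k j\<close>. A bag holds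
  the last \<open>d\<close> rows to arrive and the next \<open>d\<close> columns to depart: a row
  stays until row \<open>i + d\<close> arrives, a column enters after column \<open>j - d\<close>
  departs.\<close>

lemma index_interval_model:
  fixes E :: "nat \<Rightarrow> nat \<Rightarrow> bool"
  assumes strong: "\<And>i j i' j'. E i j \<Longrightarrow>
      E i' j' \<Longrightarrow> i < i' \<Longrightarrow> j' < j \<Longrightarrow> E i j' \<and> E i' j"
    and dom: "\<And>i j. E i j \<Longrightarrow> i < m \<and> j < n"
    and row: "\<And>i. i < m \<Longrightarrow> \<exists>j. E i j" and col: "\<And>j. j < n \<Longrightarrow>
        \<exists>i. E i j"
    and free: "\<And>i j. \<exists>a\<le>d. \<exists>b\<le>d. \<not> E (i + a) (j + b)"
  shows "\<exists>lx rx ly ry :: nat \<Rightarrow> nat. (\<forall>i<m. lx i \<le> rx i) \<and>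
      (\<forall>j<n. ly j \<le> ry j) \<and>
    (\<forall>i j. E i j \<longrightarrow> lx i \<le> ry j \<and> ly j \<le> rx i) \<and>
    (\<forall>t. card {i. i < m \<and> lx i \<le> t \<and> t \<le> rx i} \<le> d) \<and>
    (\<forall>t. card {j. j < n \<and> ly j \<le> t \<and> t \<le> ry j} \<le> d)"
proof -
  \<comment> \<open>Rows past the last one get first column \<open>n\<close>, so that
    \<open>l (i + d)\<close> is a sensible departure time near the end as well.\<close>
  define l where "l i = (if i < m then LEAST j. E i j else n)" for i
  define k where "k j = card {i. i < m \<and> l i \<le> j}" for j
  have l_E: "E i (l i)" if "i < m" for i
    unfolding l_def using row[OF that] that by (auto intro: LeastI)
  have l_le: "l i \<le> j" if "E i j" for i j
    unfolding l_def using that dom[OF that] by (auto intro: Least_le)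
  have l_n: "l i \<le> n" for i using l_E[of i] dom[of i "l i"] by (cases "i < m") (auto simp: l_def)
  have l_mono: "l i \<le> l i'" if "i \<le> i'" for i i'
  proof (cases "i = i' \<or> \<not> i' < m")
    case True then show ?thesis using l_n by (auto simp: l_def)
  next
    case False
    show ?thesis
    proof (rule ccontr)
      assume *: "\<not> l i \<le> l i'"
      have "E i (l i)" "E i' (l i')" "i < i'" using False that l_E by auto
      from strong[OF this] * l_le[of i "l i'"] show False by auto
    qed
  qed
  have k_mono: "k j \<le> k j'" if "j \<le> j'" for j j'
    unfolding k_def using that by (intro card_mono) auto
  \<comment> \<open>The column \<open>j\<close> has some neighbour \<open>h\<close>. If
    \<open>h\<close> is not \<open>i\<close>, its edge crosses one of the two given edges of row
    \<open>i\<close> or ends in the same column, and \<open>E i j\<close> follows.\<close>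
  have convex: "E i j" if "E i j1" "E i j2" "j1 \<le> j" "j \<le> j2" for i j j1 j2
  proof -
    have "j < n" using dom[OF that(2)] that(4) by simp
    then obtain h where h: "E h j" using col by blast
    show ?thesis
      using strong[OF h that(1)] strong[OF that(2) h] h that
      by (cases "h < i"; cases "h = i"; cases "j1 = j"; cases "j2 = j") auto
  qed
  \<comment> \<open>If row \<open>i + d\<close> had its first column \<open>c\<close> at or before
    \<open>j - d\<close>, its edge to \<open>c\<close> would cross the edge from \<open>i\<close> to
    \<open>j\<close>, and filling crossings would join all rows from \<open>i\<close> to
    \<open>i + d\<close> to all columns from \<open>j - d\<close> to \<open>j\<close>.\<close>
  have far: "d \<le> j \<Longrightarrow> j - d < l (i + d)" if "E i j" for i j
  proof (rule ccontr)
    assume "d \<le> j" and *: "\<not> j - d < l (i + d)"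
    have m: "i + d < m"
    proof (rule ccontr)
      assume "\<not> i + d < m"
      then have "l (i + d) = n" by (simp add: l_def)
      then show False using * dom[OF that] by linarith
    qed
    define c where "c = l (i + d)"
    have c: "E (i + d) c" "c \<le> j - d" using l_E[OF m] * by (auto simp: c_def)
    have "E (i + a) (j - d + b)" if "a \<le> d" "b \<le> d" for a b
    proof -
      obtain h where h: "E (i + a) h" using row[of "i + a"] m \<open>a \<le> d\<close> by auto
      have cj: "c < j \<or> (c = j \<and> d = 0)" using c(2) \<open>d \<le> j\<close> by auto
      have "E i j" by fact
      have 1: "E i c" if "0 < d" using strong[OF \<open>E i j\<close> c(1)] cj that by auto
      have A: "E (i + a) c \<and> E (i + a) j" if "0 < d"
      proof -
        have X: "E (i + d) j" using strong[OF \<open>E i j\<close> c(1)] cj that by auto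
        consider "a = 0" | "a = d" | "0 < a" "a < d" using \<open>a \<le> d\<close> by linarith
        then show ?thesis
        proof cases
          case 3
          have "E (i + a) c"
          proof (cases "c < h")
            case True then show ?thesis using strong[OF h c(1)] 3 by auto
          next
            case False
            have "c < j" using cj that by auto
            then have "E (i + a) j" using strong[OF \<open>E i j\<close> h] 3 False by auto
            then show ?thesis using strong[OF _ c(1), of "i + a" j] 3 \<open>c < j\<close> by auto
          qed
          moreover have "E (i + a) j" using strong[OF \<open>E i j\<close> calculation] 3 cj that by auto
          ultimately show ?thesis by simp
        qed (use 1 X c \<open>E i j\<close> that in auto)
      qed
      show ?thesis
      proof (cases "d = 0")
        case True then show ?thesis using \<open>E i j\<close> that by auto
      next
        case False
        then have "E (i + a) c" "E (i + a) j" using A by simp_all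
        then show ?thesis using c(2) \<open>d \<le> j\<close> that by (auto intro: convex[of "i + a" c j])
      qed
    qed
    then show False using free[of i "j - d"] by blast
  qed
  have k_le: "k j \<le> p" if "j < l p" for j p
  proof -
    have "{i. i < m \<and> l i \<le> j} \<subseteq> {..<p}"
      using that l_mono by (auto simp: not_le[symmetric]) (meson le_trans not_le)
    from card_mono[OF _ this] show ?thesis by (simp add: k_def)
  qed
  have k_ge: "Suc i \<le> k j" if "l i \<le> j" "i < m" for i j
  proof -
    have "{..i} \<subseteq> {i. i < m \<and> l i \<le> j}" using that l_mono le_trans by fastforce
    from card_mono[OF _ this] show ?thesis by (simp add: k_def)
  qed
  \<comment> \<open>The first \<open>d\<close> columns are present from time 0; any later one enters
    one step after column \<open>j - d\<close> departs.\<close>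
  define ly where "ly j = (if j < d then 0 else Suc (j - d + k (j - d)))" for j
  have d: "0 < d" if "i < m" for i
    using free[of i "l i"] l_E[OF that] by (cases d) auto
  have ly_le: "ly j \<le> i + d + l (i + d)" if "E i j" for i j
  proof (cases "j < d")
    case False
    then have "j - d < l (i + d)" using far[OF that] by simp
    with k_le[OF this] False show ?thesis by (simp add: ly_def)
  qed (simp add: ly_def)
  show ?thesis
  proof (intro exI conjI allI impI)
    fix i assume "i < m"
    then show "Suc (i + l i) \<le> i + d + l (i + d)" using d l_mono[of i "i + d"] by fastforce
  next
    fix j assume "j < n"
    then obtain i where "E i j" using col by blast
    then have "0 < d" using d dom by blast
    then show "ly j \<le> j + k j" using k_mono[of "j - d" j] by (auto simp: ly_def)
  next
    fix i j assume E: "E i j"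
    then show "Suc (i + l i) \<le> j + k j" using k_ge[OF l_le[OF E]] l_le[OF E] dom[OF E] by linarith
    show "ly j \<le> i + d + l (i + d)" using ly_le[OF E] .
  next
    fix t show "card {i. i < m \<and> Suc (i + l i) \<le> t \<and> t \<le> i + d + l (i + d)} \<le> d"
    proof (rule card_le_if_narrow)
      fix i i' assume "i \<in> {i. i < m \<and> Suc (i + l i) \<le> t \<and> t \<le> i + d + l (i + d)}"
        and "i' \<in> {i. i < m \<and> Suc (i + l i) \<le> t \<and> t \<le> i + d + l (i + d)}"
      then show "i' < i + d" using l_mono[of "i + d" i'] by (cases "i' < i + d") auto
    qed
  next
    fix t show "card {j. j < n \<and> ly j \<le> t \<and> t \<le> j + k j} \<le> d"
    proof (rule card_le_if_narrow)
      fix j j' assume "j \<in> {j. j < n \<and> ly j \<le> t \<and> t \<le> j + k j}"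
        and "j' \<in> {j. j < n \<and> ly j \<le> t \<and> t \<le> j + k j}"
      then have t: "ly j' \<le> t" "t \<le> j + k j" by simp_all
      show "j' < j + d"
      proof (rule ccontr)
        assume "\<not> j' < j + d"
        then have "j \<le> j' - d" "\<not> j' < d" by auto
        then show False using t k_mono[of j "j' - d"] unfolding ly_def by simp
      qed
    qed
  qed
qed

lemma enumerate_by_rank:
  fixes \<rho> :: "'a \<Rightarrow> nat"
  assumes "finite X" "inj_on \<rho> X"
  obtains e where "bij_betw e {..<card X} X" "\<And>i j. i < j \<Longrightarrow>
      j < card X \<Longrightarrow> \<rho> (e i) < \<rho> (e j)"
proof -
  define xs where "xs = sorted_list_of_set (\<rho> ` X)"
  have xs: "set xs = \<rho> ` X" "distinct xs" "sorted_wrt (<) xs" "length xs = card X"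
    using assms by (auto simp: xs_def card_image)
  let ?e = "\<lambda>i. inv_into X \<rho> (xs ! i)"
  have 1: "bij_betw (\<lambda>i. xs ! i) {..<card X} (\<rho> ` X)"
    using bij_betw_nth[OF xs(2), of "{..<card X}" "\<rho> ` X"] xs by simp
  have 2: "bij_betw (inv_into X \<rho>) (\<rho> ` X) X"
    using assms(2) by (simp add: bij_betw_inv_into inj_on_imp_bij_betw)
  have "bij_betw ?e {..<card X} X" using bij_betw_trans[OF 1 2] by (simp add: o_def)
  moreover have "\<rho> (?e i) = xs ! i" if "i < card X" for i
    using that xs by (intro f_inv_into_f) (metis nth_mem)
  ultimately show thesis
    using xs sorted_wrt_nth_less[OF xs(3)] by (intro that[of ?e]) auto
qed

text \<open>Predicates on a type rather than digraphs: an induced subgraph is then another instance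
  with the same colouring, and the arguments can pass freely to components and to complements of
  hitting sets.\<close>

locale bip_graph =
  fixes V :: "'a set" and adj :: "'a \<Rightarrow> 'a \<Rightarrow> bool" and col :: "'a \<Rightarrow> bool"
  assumes finite_V: "finite V"
    and adj_sym: "adj u v \<Longrightarrow> adj v u"
    and adj_in: "adj u v \<Longrightarrow> u \<in> V"
    and adj_col: "adj u v \<Longrightarrow> col u \<noteq> col v"
begin

lemma adj_commute: "adj u v \<longleftrightarrow> adj v u"
  using adj_sym by blast

lemma adj_in2: "adj u v \<Longrightarrow> v \<in> V"
  using adj_sym adj_in by blast

text \<open>Only the order inside each colour class matters, so the two sides are numbered
  separately; a window of \<open>d\<close> vertices on either side gives bags of size
  \<open>2 * d\<close>.\<close>

lemma strong_ordering_interval_model: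
  fixes \<rho> :: "'a \<Rightarrow> nat"
  assumes inj: "inj_on \<rho> V"
    and strong: "\<And>x x' y y'. adj x y \<Longrightarrow>
        adj x' y' \<Longrightarrow> col x = col x' \<Longrightarrow>
      \<rho> x < \<rho> x' \<Longrightarrow> \<rho> y' < \<rho> y \<Longrightarrow> adj x y' \<and> adj x' y"
    and iso: "\<And>v. v \<in> V \<Longrightarrow> \<exists>w. adj v w"
    and free: "biclique_free d adj"
  shows "interval_model V adj (2 * d)"
proof -
  define X where "X = {v \<in> V. col v}"
  define Y where "Y = {v \<in> V. \<not> col v}"
  have fin: "finite X" "finite Y" using finite_V by (auto simp: X_def Y_def)
  have injs: "inj_on \<rho> X" "inj_on \<rho> Y" using inj by (auto simp: X_def Y_def inj_on_def)
  obtain ex where ex: "bij_betw ex {..<card X} X"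
    and ex_less: "\<And>i j. i < j \<Longrightarrow>
        j < card X \<Longrightarrow> \<rho> (ex i) < \<rho> (ex j)"
    using enumerate_by_rank[OF fin(1) injs(1)] by blast
  obtain ey where ey: "bij_betw ey {..<card Y} Y"
    and ey_less: "\<And>i j. i < j \<Longrightarrow>
        j < card Y \<Longrightarrow> \<rho> (ey i) < \<rho> (ey j)"
    using enumerate_by_rank[OF fin(2) injs(2)] by blast
  define E where "E i j \<longleftrightarrow> i < card X \<and> j < card Y \<and> adj (ex i) (ey j)" for i j
  have exX: "ex i \<in> X" if "i < card X" for i using ex that by (auto simp: bij_betw_def)
  have eyY: "ey i \<in> Y" if "i < card Y" for i using ey that by (auto simp: bij_betw_def)
  have X_ex: "\<exists>i<card X. x = ex i" if "x \<in> X" for x using ex that by (auto simp: bij_betw_def)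
  have Y_ey: "\<exists>i<card Y. x = ey i" if "x \<in> Y" for x using ey that by (auto simp: bij_betw_def)
  have "\<exists>lx rx ly ry :: nat \<Rightarrow> nat. (\<forall>i<card X. lx i \<le> rx i) \<and>
      (\<forall>j<card Y. ly j \<le> ry j) \<and>
    (\<forall>i j. E i j \<longrightarrow> lx i \<le> ry j \<and> ly j \<le> rx i) \<and>
    (\<forall>t. card {i. i < card X \<and> lx i \<le> t \<and> t \<le> rx i} \<le> d) \<and>
    (\<forall>t. card {j. j < card Y \<and> ly j \<le> t \<and> t \<le> ry j} \<le> d)"
  proof (rule index_interval_model)
    fix i j i' j' assume "E i j" "E i' j'" "i < i'" "j' < j"
    then show "E i j' \<and> E i' j"
      using strong[of "ex i" "ey j" "ex i'" "ey j'"] ex_less[of i i'] ey_less[of j' j]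
        exX[of i] exX[of i'] by (auto simp: E_def X_def)
  next
    fix i assume "i < card X"
    then obtain w where "adj (ex i) w" using iso exX[of i] by (auto simp: X_def)
    moreover from this have "w \<in> Y"
      using adj_in2 adj_col exX[OF \<open>i < card X\<close>] by (fastforce simp: X_def Y_def)
    ultimately show "\<exists>j. E i j" using Y_ey \<open>i < card X\<close> by (auto simp: E_def)
  next
    fix j assume "j < card Y"
    then obtain w where "adj (ey j) w" using iso eyY[of j] by (auto simp: Y_def)
    moreover from this have "w \<in> X"
      using adj_in2 adj_col eyY[OF \<open>j < card Y\<close>] by (fastforce simp: X_def Y_def)
    ultimately show "\<exists>i. E i j"
        using X_ex \<open>j < card Y\<close> adj_sym by (fastforce simp: E_def)
  next
    fix i j
    show "\<exists>a\<le>d. \<exists>b\<le>d. \<not> E (i + a) (j + b)"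
    proof (rule ccontr)
      assume "\<not> ?thesis"
      then have *: "E (i + a) (j + b)" if "a \<le> d" "b \<le> d" for a b using that by blast
      have lt: "i + d < card X" "j + d < card Y" using *[of d d] by (auto simp: E_def)
      have "card (ex ` {i..i + d}) = Suc d" "card (ey ` {j..j + d}) = Suc d"
        using lt ex ey by (subst card_image; force simp: bij_betw_def inj_on_def)+
      moreover have "adj u v" if uv: "u \<in> ex ` {i..i + d}" "v \<in> ey ` {j..j + d}" for u v
      proof -
        obtain p q where pq: "u = ex p" "v = ey q" "i \<le> p" "p \<le> i + d" "j \<le> q" "q \<le> j + d"
          using uv by auto
        then show ?thesis using *[of "p - i" "q - j"] by (auto simp: E_def)
      qed
      ultimately show False
        using biclique_freeD[OF free, of "ex ` {i..i + d}" "ey ` {j..j + d}"] by auto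
    qed
  qed (auto simp: E_def)
  then obtain lx rx ly ry :: "nat \<Rightarrow> nat" where
    le: "\<And>i. i < card X \<Longrightarrow> lx i \<le> rx i" "\<And>i. i < card Y \<Longrightarrow>
        ly i \<le> ry i"
    and E: "\<And>i j. E i j \<Longrightarrow> lx i \<le> ry j \<and> ly j \<le> rx i"
    and cx: "\<And>t. card {i. i < card X \<and> lx i \<le> t \<and> t \<le> rx i} \<le> d"
    and cy: "\<And>t. card {i. i < card Y \<and> ly i \<le> t \<and> t \<le> ry i} \<le> d"
    by blast
  define px where "px = inv_into {..<card X} ex"
  define py where "py = inv_into {..<card Y} ey"
  have px: "px (ex i) = i" if "i < card X" for i
    using that ex by (simp add: px_def bij_betw_inv_into_left)
  have py: "py (ey i) = i" if "i < card Y" for i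
    using that ey by (simp add: py_def bij_betw_inv_into_left)
  define l where "l v = (if col v then lx (px v) else ly (py v))" for v
  define r where "r v = (if col v then rx (px v) else ry (py v))" for v
  have "card {v \<in> V. l v \<le> t \<and> t \<le> r v} \<le> 2 * d" for t
  proof -
    let ?I = "{i. i < card X \<and> lx i \<le> t \<and> t \<le> rx i}"
    let ?J = "{i. i < card Y \<and> ly i \<le> t \<and> t \<le> ry i}"
    have "{v \<in> V. l v \<le> t \<and> t \<le> r v} \<subseteq> ex ` ?I \<union> ey ` ?J"
    proof
      fix v assume v: "v \<in> {v \<in> V. l v \<le> t \<and> t \<le> r v}"
      show "v \<in> ex ` ?I \<union> ey ` ?J"
      proof (cases "col v")
        case True
        then obtain i where "i < card X" "v = ex i" using X_ex v by (auto simp: X_def)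
        then show ?thesis using v True px by (auto simp: l_def r_def)
      next
        case False
        then obtain i where "i < card Y" "v = ey i" using Y_ey v by (auto simp: Y_def)
        then show ?thesis using v False py by (auto simp: l_def r_def)
      qed
    qed
    then have "card {v \<in> V. l v \<le> t \<and> t \<le> r v} \<le> card (ex ` ?I \<union> ey ` ?J)"
      by (intro card_mono) auto
    also have "\<dots> \<le> card (ex ` ?I) + card (ey ` ?J)" by (rule card_Un_le)
    also have "\<dots> \<le> card ?I + card ?J" by (intro add_mono card_image_le) auto
    finally show ?thesis using cx[of t] cy[of t] by linarith
  qed
  moreover have "l v \<le> r v" if "v \<in> V" for v
    using that X_ex[of v] Y_ey[of v] px py le by (cases "col v") (auto simp: X_def Y_def l_def r_def)
  moreover have "l u \<le> r v" if uv: "adj u v" for u v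
  proof -
    have *: "lx (px x) \<le> ry (py y) \<and> ly (py y) \<le> rx (px x)" if xy: "adj x y" "col x" for x y
    proof -
      have "x \<in> X" "y \<in> Y" using xy adj_in adj_in2 adj_col by (auto simp: X_def Y_def)
      then obtain i j where "i < card X" "x = ex i" "j < card Y" "y = ey j"
        using X_ex Y_ey by blast
      then show ?thesis using E[of i j] xy px py by (simp add: E_def)
    qed
    show ?thesis using *[of u v] *[of v u] uv adj_sym[OF uv] adj_col[OF uv] by (auto simp: l_def r_def)
  qed
  ultimately show ?thesis
    unfolding interval_model_def by (intro exI[of _ l] exI[of _ r] conjI ballI allI impI)
qed

end

section \<open>Breadth-first levels\<close>

context bip_graph
begin

definition conn :: bool where
  "conn \<longleftrightarrow> V \<noteq> {} \<and>
      (\<forall>W\<subseteq>V. W \<noteq> {} \<and> (\<forall>u v. adj u v \<and> u \<in> W \<longrightarrow> v \<in> W) \<longrightarrow> W = V)"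

text \<open>The distance from \<open>s\<close>, described by the local facts that later arguments
  use. In a bipartite graph no edge stays inside a level, so every edge changes the level by exactly
  one.\<close>

definition levels :: "'a \<Rightarrow> ('a \<Rightarrow> nat) \<Rightarrow> bool" where
  "levels s L \<longleftrightarrow> s \<in> V \<and> (\<forall>v\<in>V. L v = 0 \<longleftrightarrow>
      v = s) \<and>
    (\<forall>u v. adj u v \<longrightarrow> L u = Suc (L v) \<or> L v = Suc (L u)) \<and>
    (\<forall>v\<in>V. L v \<noteq> 0 \<longrightarrow> (\<exists>w. adj v w \<and> L v = Suc (L w)))"

lemma connD: "conn \<Longrightarrow> W \<subseteq> V \<Longrightarrow>
    W \<noteq> {} \<Longrightarrow> (\<And>u v. adj u v \<Longrightarrow> u \<in> W \<Longrightarrow> v \<in> W) \<Longrightarrow> W = V"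
  unfolding conn_def by blast

lemma levels_exist:
  assumes conn "s \<in> V"
  shows "\<exists>L. levels s L"
proof -
  define L where "L v = (LEAST n. (adj ^^ n) s v)" for v
  have "{v \<in> V. \<exists>n. (adj ^^ n) s v} = V"
  proof (rule connD[OF assms(1)])
    have "(adj ^^ 0) s s" by simp
    then show "{v \<in> V. \<exists>n. (adj ^^ n) s v} \<noteq> {}" using assms(2) by blast
  next
    fix u v assume "adj u v" "u \<in> {v \<in> V. \<exists>n. (adj ^^ n) s v}"
    then obtain n where "(adj ^^ Suc n) s v" by (auto intro: relpowp_Suc_I)
    then show "v \<in> {v \<in> V. \<exists>n. (adj ^^ n) s v}"
        using adj_in2[OF \<open>adj u v\<close>] by blast
  qed auto
  then have ex: "\<exists>n. (adj ^^ n) s v" if "v \<in> V" for v using that by blast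
  have L: "(adj ^^ L v) s v" if "v \<in> V" for v
    unfolding L_def using ex[OF that] by (rule LeastI_ex)
  have L_le: "L v \<le> n" if "(adj ^^ n) s v" for v n
    unfolding L_def using that by (rule Least_le)
  have parity: "even n \<longleftrightarrow> (col v \<longleftrightarrow> col s)" if "(adj ^^ n) s v" for n v
    using that
  proof (induction n arbitrary: v)
    case (Suc n)
    from Suc.prems obtain u where "(adj ^^ n) s u" "adj u v" by (rule relpowp_Suc_E)
    then show ?case using Suc.IH[of u] adj_col[of u v] by auto
  qed simp
  have step: "L v \<le> Suc (L u)" if "adj u v" for u v
    using relpowp_Suc_I[OF L[OF adj_in[OF that]] that] by (rule L_le)
  have ne: "L u \<noteq> L v" if "adj u v" for u v
    using parity[OF L[OF adj_in[OF that]]] parity[OF L[OF adj_in2[OF that]]] adj_col[OF that] by auto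
  show ?thesis unfolding levels_def
  proof (intro exI[of _ L] conjI ballI allI impI)
    fix v assume v: "v \<in> V"
    have "L s \<le> 0" by (rule L_le) simp
    moreover have "v = s" if "L v = 0" using L[OF v] that by simp
    ultimately show "L v = 0 \<longleftrightarrow> v = s" by auto
  next
    fix u v assume uv: "adj u v"
    show "L u = Suc (L v) \<or> L v = Suc (L u)"
      using step[OF uv] step[OF adj_sym[OF uv]] ne[OF uv] by linarith
  next
    fix v assume v: "v \<in> V" "L v \<noteq> 0"
    then obtain n where n: "L v = Suc n" using not0_implies_Suc by blast
    then obtain u where u: "(adj ^^ n) s u" "adj u v" using L[OF v(1)] by (auto elim: relpowp_Suc_E)
    then have "L v = Suc (L u)" using n L_le[OF u(1)] step[OF u(2)] by linarith
    then show "\<exists>w. adj v w \<and> L v = Suc (L w)" using adj_sym[OF u(2)] by blast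
  qed (rule assms(2))
qed

end

text \<open>Each condition lists the edges of the pattern and its nonedges between opposite colours;
  the remaining nonedges follow from the colouring. Distinctness follows too, since no two vertices
  of a pattern have the same neighbours in it.\<close>

locale ats_free = bip_graph +
  assumes tripod_free: "\<lbrakk>adj p a; adj p b; adj p c; adj a a'; adj b b'; adj c c';
      \<not> adj a b'; \<not> adj a c'; \<not> adj b a'; \<not> adj b c'; \<not> adj c a'; \<not> adj c b'\<rbrakk> \<Longrightarrow>
          False"
    and armchair_free: "\<lbrakk>adj a b; adj b c; adj c d; adj d a; adj a a'; adj b b'; adj c c';
      \<not> adj b' d; \<not> adj b' a'; \<not> adj b' c'; \<not> adj a c'; \<not> adj c a'\<rbrakk> \<Longrightarrow>
          False"
    and stirrer_free: "\<lbrakk>adj u0 u1; adj u1 u2; adj u3 u4; adj u4 u5; adj u0 u3; adj u1 u4; adj u2 u5;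
      adj u1 u6; \<not> adj u0 u5; \<not> adj u2 u3; \<not> adj u6 u3; \<not> adj u6 u5\<rbrakk> \<Longrightarrow>
          False"

text \<open>
  Under these three conditions on a vertex \<open>r\<close>, the breadth-first levels from \<open>r\<close> extend in one
  direction only: consecutive levels span chain graphs whose nested orders are compatible.
\<close>

locale end_vertex = ats_free +
  fixes r :: 'a
  assumes chain1: "\<lbrakk>adj r p; adj r p'; adj p u; adj p' u'; \<not> adj p' u; \<not> adj p u'\<rbrakk> \<Longrightarrow>
      False"
    and chain2: "\<lbrakk>adj r q; adj q u; adj q u'; adj u w; adj u' w'; \<not> adj u w'; \<not> adj u' w;
      \<not> adj r w; \<not> adj r w'\<rbrakk> \<Longrightarrow> False"
    and compat2: "\<lbrakk>adj r p; adj r p0; adj u p; adj u p0; adj u' p0; \<not> adj u' p; adj u w;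
      \<not> adj u' w; \<not> adj r w\<rbrakk> \<Longrightarrow> False"
begin

context
  fixes L assumes L: "levels r L"
begin

lemma level_adj: "adj u v \<Longrightarrow> L u = Suc (L v) \<or> L v = Suc (L u)"
  using L by (auto simp: levels_def)

lemma level_down:
  assumes "v \<in> V" "L v = Suc i"
  obtains w where "adj v w" "adj w v" "L w = i"
  using L assms adj_sym unfolding levels_def by (metis nat.distinct(1) nat.inject)

lemma level_0: "v \<in> V \<Longrightarrow> L v = 0 \<Longrightarrow> v = r"
  using L by (auto simp: levels_def)

lemma level_1: "v \<in> V \<Longrightarrow> L v = 1 \<Longrightarrow> adj r v"
  by (metis One_nat_def adj_in2 level_0 level_down)

lemma far_not_adj: "Suc (L u) < L v \<Longrightarrow>
    \<not> adj u v" "Suc (L u) < L v \<Longrightarrow> \<not> adj v u"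
  using level_adj by fastforce+

text \<open>The claim one level lower gives \<open>u\<close> and \<open>u'\<close> a common lower
  neighbour \<open>q\<close>. From level 3 on, two further steps down from \<open>q\<close> supply
  the third leg of a tripod centred at \<open>q\<close>. Levels 1 and 2 are \<open>chain1\<close>
  and \<open>chain2\<close>, and level 0 is a single vertex.\<close>

lemma chain:
  assumes "L u = i" "L u' = i" "L w = Suc i" "L w' = Suc i" "adj u w" "adj u' w'"
    "\<not> adj u w'" "\<not> adj u' w"
  shows False
  using assms
proof (induction i arbitrary: u u' w w')
  case 0
  then have "u = u'" using level_0 adj_in by metis
  then show ?case using 0 by blast
next
  case (Suc i)
  have V: "u \<in> V" "u' \<in> V" using Suc.prems adj_in by blast+
  show ?case
  proof (cases i)
    case 0
    then have "adj r u" "adj r u'" using level_1 V Suc.prems by auto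
    then show ?thesis using chain1[of u u' w w'] Suc.prems by blast
  next
    case (Suc j)
    obtain p where p: "adj p u" "L p = i" using level_down[OF V(1)] Suc.prems(1) by metis
    obtain p' where p': "adj p' u'" "L p' = i" using level_down[OF V(2)] Suc.prems(2) by metis
    have "adj p u' \<or> adj p' u"
      using Suc.IH[OF p(2) p'(2) Suc.prems(1,2) p(1) p'(1)] by blast
    then obtain q where q: "adj q u" "adj q u'" "L q = Suc j" using p p' Suc by metis
    show ?thesis
    proof (cases j)
      case 0
      then have "adj r q" using level_1 q adj_in by auto
      moreover have "\<not> adj r w" "\<not> adj r w'"
        using far_not_adj[of r] L Suc.prems by (auto simp: levels_def)
      ultimately show ?thesis using chain2[OF _ q(1,2)] Suc.prems(5-8) by blast
    next
      case (Suc k)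
      obtain q1 where q1: "adj q q1" "L q1 = Suc k"
        using level_down[of q] q adj_in Suc by metis
      then obtain q2 where q2: "adj q1 q2" "L q2 = k"
        using level_down[of q1] adj_in2 by metis
      have "\<not> adj u q2" "\<not> adj u' q2" "\<not> adj q1 w" "\<not> adj q1 w'"
        using far_not_adj q1 q2 Suc.prems \<open>i = Suc j\<close> Suc by auto
      then show ?thesis
        using tripod_free[of q u u' q1 w w' q2] q q1 q2 Suc.prems by blast
    qed
  qed
qed

text \<open>This ties together the two nested orders on a level: seeing more below means seeing less
  above. In a violation let \<open>q\<close> be a common lower neighbour of \<open>p\<close> and
  \<open>p0\<close>; the square \<open>u p0 q p\<close> with pendants \<open>w\<close>,
  \<open>u'\<close> and a vertex below \<open>q\<close> is an armchair. Where nothing lies below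
  \<open>q\<close>, \<open>compat2\<close> takes over.\<close>

lemma compat:
  assumes "L u = Suc i" "L u' = Suc i" "L p = i" "L p0 = i" "adj u p" "adj u p0" "adj u' p0"
    "\<not> adj u' p" "adj u w" "\<not> adj u' w" "L w = Suc (Suc i)"
  shows False
proof -
  have V: "u \<in> V" "u' \<in> V" "p \<in> V" "p0 \<in> V" using assms adj_in adj_in2 by blast+
  consider "i = 0" | "i = 1" | j where "i = Suc (Suc j)"
    by (metis One_nat_def old.nat.exhaust)
  then show False
  proof cases
    case 1
    then show False using assms V level_0 by metis
  next
    case 2
    then have "adj r p" "adj r p0" using level_1 V assms by auto
    moreover have "\<not> adj r w"
      using far_not_adj[of r] L assms 2 by (auto simp: levels_def)
    ultimately show False using compat2[of p p0 u u' w] assms by blast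
  next
    case 3
    obtain q1 where q1: "adj q1 p" "L q1 = Suc j" using level_down[OF V(3)] assms(3) 3 by metis
    obtain q2 where q2: "adj q2 p0" "L q2 = Suc j" using level_down[OF V(4)] assms(4) 3 by metis
    have "adj q1 p0 \<or> adj q2 p"
      using chain[OF q1(2) q2(2) _ _ q1(1) q2(1)] assms(3,4) 3 by auto
    then obtain q where q: "adj q p" "adj q p0" "L q = Suc j" using q1 q2 by blast
    then obtain q' where q': "adj q q'" "L q' = j" using level_down[of q] adj_in by metis
    have "\<not> adj u' q'" "\<not> adj u q'" "\<not> adj q w"
      using far_not_adj q q' assms 3 by auto
    moreover have "\<not> adj u' w" "\<not> adj u' q"
      using assms q adj_col by metis+
    ultimately show False
      by - (rule armchair_free[of u p0 q p w u' q'];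
          use q q' assms(5-9) in \<open>simp add: adj_commute\<close>)
  qed
qed

end

lemma interval_model_2d:
  assumes conn "biclique_free d adj" "r \<in> V" and iso: "\<And>v. v \<in> V \<Longrightarrow>
      \<exists>w. adj v w"
  shows "interval_model V adj (2 * d)"
proof -
  obtain L where L: "levels r L" using levels_exist assms by blast
  define down where "down v = {w. adj v w \<and> L v = Suc (L w)}" for v
  define up where "up v = {w. adj v w \<and> L w = Suc (L v)}" for v
  define N where "N = card V"
  have sub: "down v \<subseteq> V" "up v \<subseteq> V" for v using adj_in2 by (auto simp: down_def up_def)
  have fin: "finite (down v)" "finite (up v)" for v
    by (rule finite_subset[OF sub(1) finite_V], rule finite_subset[OF sub(2) finite_V])
  have card: "card (down v) \<le> N" "card (up v) \<le> N" for v
    unfolding N_def by (intro card_mono finite_V sub)+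
  \<comment> \<open>The rank will be a number in mixed radix: a last digit below its base makes
    comparison of numbers lexicographic.\<close>
  have lex: "a < a' \<or> a = a' \<and> b \<le> b'"
      if "a * S + b \<le> a' * S + b'" "b' < S" for a a' b b' S :: nat
  proof -
    have "a \<le> a'"
    proof (rule ccontr)
      assume "\<not> a \<le> a'"
      then have "Suc a' * S \<le> a * S" by (intro mult_right_mono) auto
      then show False using that by simp
    qed
    then show ?thesis using that by (cases "a = a'") auto
  qed
  obtain f :: "'a \<Rightarrow> nat" and M where f: "inj_on f V" "f ` V = {i. i < M}"
    using finite_imp_inj_to_nat_seg[OF finite_V] by metis
  \<comment> \<open>Rank by level, then by decreasing size of \<open>down\<close>, then by
    increasing size of \<open>up\<close>; the injection \<open>f\<close> breaks the remaining
    ties.\<close>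
  define a where "a v = L v * Suc N + (N - card (down v))" for v
  define key where "key v = a v * Suc N + card (up v)" for v
  define \<rho> where "\<rho> v = key v * M + f v" for v
  have f_less: "f v < M" if "v \<in> V" for v using f(2) that by blast
  have key_le: "key u \<le> key v" if "\<rho> u \<le> \<rho> v" "v \<in> V" for u v
    using lex[of "key u" M "f u" "key v" "f v"] that f_less by (auto simp: \<rho>_def)
  have inj: "inj_on \<rho> V"
  proof (rule inj_onI)
    fix u v assume uv: "u \<in> V" "v \<in> V" "\<rho> u = \<rho> v"
    then have "key u = key v" using key_le[of u v] key_le[of v u] by auto
    then show "u = v" using uv f(1) by (auto simp: \<rho>_def inj_on_def)
  qed
  have key: "L u < L v \<or> L u = L v \<and> (card (down v) < card (down u) \<or>
      card (down v) = card (down u) \<and> card (up u) \<le> card (up v))"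
    if "\<rho> u < \<rho> v" "v \<in> V" for u v
  proof -
    have up: "a u < a v \<or> a u = a v \<and> card (up u) \<le> card (up v)"
      using key_le[of u v] that card(2)[of v] unfolding key_def by (intro lex[of _ "Suc N"]) auto
    then have "a u \<le> a v" by auto
    then have "L u < L v \<or> L u = L v \<and> N - card (down u) \<le> N - card (down v)"
      unfolding a_def by (intro lex[of _ "Suc N"]) auto
    then consider "L u < L v" | "L u = L v" "N - card (down u) < N - card (down v)"
      | "L u = L v" "N - card (down u) = N - card (down v)" by linarith
    then show ?thesis
    proof cases
      case 3
      then have "a u = a v" by (simp add: a_def)
      with 3 up show ?thesis using card(1)[of u] card(1)[of v] by auto
    qed auto
  qed
  have nested_down: "down u \<subseteq> down v \<or> down v \<subseteq> down u" if "L u = L v" for u v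
  proof (rule ccontr)
    assume "\<not> ?thesis"
    then obtain p q where "p \<in> down u" "p \<notin> down v" "q \<in> down v" "q \<notin> down u" by blast
    then have "adj u p" "L u = Suc (L p)" "adj v q" "L v = Suc (L q)" "\<not> adj v p" "\<not> adj u q"
      using that by (auto simp: down_def)
    then show False using chain[OF L, of p "L p" q u v] that adj_sym by fastforce
  qed
  have nested_up: "up u \<subseteq> up v \<or> up v \<subseteq> up u" if "L u = L v" for u v
  proof (rule ccontr)
    assume "\<not> ?thesis"
    then obtain p q where "p \<in> up u" "p \<notin> up v" "q \<in> up v" "q \<notin> up u" by blast
    then have "adj u p" "L p = Suc (L u)" "adj v q" "L q = Suc (L v)" "\<not> adj v p" "\<not> adj u q"
      using that by (auto simp: up_def)
    then show False using chain[OF L, of u "L u" v p q] that by fastforce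
  qed
  \<comment> \<open>If \<open>up u\<close> were strictly larger than \<open>up v\<close>, the rank
    would force \<open>down u\<close> to be strictly larger too; \<open>u\<close> would see more
    than \<open>v\<close> on both sides, against \<open>compat\<close>.\<close>
  have order: "down v \<subseteq> down u \<and> up u \<subseteq> up v"
      if uv: "\<rho> u < \<rho> v" "u \<in> V" "v \<in> V" "L u = L v" for u v
  proof
    have le: "card (down v) \<le> card (down u)" using key[OF uv(1,3)] uv(4) by auto
    then show down: "down v \<subseteq> down u"
      using nested_down[OF uv(4)] card_seteq[OF fin(1) _ le] by auto
    show "up u \<subseteq> up v"
    proof (rule ccontr)
      assume "\<not> up u \<subseteq> up v"
      then have "up v \<subset> up u" using nested_up[OF uv(4)] by blast
      then have "card (up v) < card (up u)" using psubset_card_mono[OF fin(2)] by blast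
      then have "card (down v) < card (down u)" using key[OF uv(1,3)] uv(4) by auto
      then obtain p where p: "p \<in> down u" "p \<notin> down v"
        by (metis card_mono fin(1) not_le subsetI)
      obtain w where w: "w \<in> up u" "w \<notin> up v" using \<open>up v \<subset> up u\<close> by blast
      have "L v \<noteq> 0" using p(1) uv(4) by (auto simp: down_def)
      then obtain p0 where p0: "p0 \<in> down v"
        using L uv(3) by (auto simp: levels_def down_def)
      then have "p0 \<in> down u" using down by blast
      then show False using compat[OF L, of u "L p" v p p0 w] p p0 w uv(4)
        by (auto simp: down_def up_def)
    qed
  qed
  show ?thesis
  proof (rule strong_ordering_interval_model[OF inj _ iso assms(2)])
    fix x x' y y'
    assume e: "adj x y" "adj x' y'" and c: "col x = col x'" and less: "\<rho> x < \<rho> x'" "\<rho> y' < \<rho> y"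
    have V: "x \<in> V" "x' \<in> V" "y \<in> V" "y' \<in> V" using e adj_in adj_in2 by blast+
    have lx: "L x \<le> L x'" using key[OF less(1) V(2)] by auto
    have ly: "L y' \<le> L y" using key[OF less(2) V(3)] by auto
    have par: "even (L v) \<longleftrightarrow> (col v \<longleftrightarrow> col r)" if "v \<in> V" for v
      using that
    proof (induction "L v" arbitrary: v)
      case 0
      then have "v = r" using level_0[OF L, of v] by simp
      then show ?case using 0 by simp
    next
      case (Suc i)
      then obtain w where w: "adj w v" "L w = i" using level_down[OF L] by metis
      then have "even (L v) \<longleftrightarrow> odd (L w)" using Suc.hyps(2) by (metis even_Suc)
      then show ?case using Suc.hyps(1)[of w] w adj_in[OF w(1)] adj_col[OF w(1)] by auto
    qed
    have "even (L x) = even (L x')" using par V c by simp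
    have L1: "L x = Suc (L y) \<or> L y = Suc (L x)" "L x' = Suc (L y') \<or> L y' = Suc (L x')"
      using level_adj[OF L] e by blast+
    \<comment> \<open>The ranks order the levels, and equal colours keep \<open>L x\<close> and
      \<open>L x'\<close> from differing by one. So the crossing lies in two consecutive levels, or
      in three with \<open>x\<close>, \<open>x'\<close> or \<open>y\<close>, \<open>y'\<close> both
      in the middle one.\<close>
    have "L x = L x' \<and> L y = L y' \<and>
        L y = Suc (L x) \<or> L x = L x' \<and> L y = L y' \<and> L x = Suc (L y) \<or>
      L y = L y' \<and> L y = Suc (L x) \<and> L x' = Suc (L y) \<or>
      L x = L x' \<and> L x = Suc (L y') \<and> L y = Suc (L x)"
    proof -
      have "L x' \<noteq> Suc (L x)" using \<open>even (L x) = even (L x')\<close> by auto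
      then show ?thesis using L1 lx ly by (elim disjE) auto
    qed
    then consider "L x = L x'" "L y = L y'" "L y = Suc (L x)" | "L x = L x'" "L y = L y'" "L x = Suc (L y)"
      | "L y = L y'" "L y = Suc (L x)" "L x' = Suc (L y)"
      | "L x = L x'" "L x = Suc (L y')" "L y = Suc (L x)"
      by blast
    then show "adj x y' \<and> adj x' y"
    proof cases
      case 1
      then have "up x \<subseteq> up x'" "down y \<subseteq> down y'" using order V less by auto
      moreover have "y \<in> up x" "x \<in> down y" using e e[THEN adj_sym] 1 by (auto simp: up_def down_def)
      ultimately show ?thesis using adj_sym unfolding up_def down_def by blast
    next
      case 2
      then have "down x' \<subseteq> down x" "up y' \<subseteq> up y" using order V less by auto
      moreover have "y' \<in> down x'" "x' \<in> up y'"
          using e e[THEN adj_sym] 2 by (auto simp: up_def down_def)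
      ultimately show ?thesis using adj_sym unfolding up_def down_def by blast
    next
      case 3
      then have "down y \<subseteq> down y'" "up y' \<subseteq> up y" using order V less by auto
      moreover have "x \<in> down y" "x' \<in> up y'"
          using e e[THEN adj_sym] 3 by (auto simp: up_def down_def)
      ultimately show ?thesis using adj_sym unfolding up_def down_def by blast
    next
      case 4
      then have "down x' \<subseteq> down x" "up x \<subseteq> up x'" using order V less by auto
      moreover have "y' \<in> down x'" "y \<in> up x"
          using e e[THEN adj_sym] 4 by (auto simp: up_def down_def)
      ultimately show ?thesis using adj_sym unfolding up_def down_def by blast
    qed
  qed
qed

end

section \<open>Graphs without rings\<close>

context bip_graph
begin

text \<open>
  A ring is a set inducing a disjoint union of cycles of length at least 6. Only this local
  structure of a hole is ever used.
\<close>

definition square_free :: "'a set \<Rightarrow> bool" where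
  "square_free C \<longleftrightarrow> (\<forall>u\<in>C. \<forall>v\<in>C. \<forall>a\<in>C. \<forall>b\<in>C.
    u \<noteq> v \<longrightarrow> adj u a \<longrightarrow> adj u b \<longrightarrow> adj v a \<longrightarrow> adj v b \<longrightarrow> a = b)"

definition ring :: "'a set \<Rightarrow> bool" where
  "ring C \<longleftrightarrow> C \<noteq> {} \<and> C \<subseteq> V \<and>
    (\<forall>u\<in>C. \<exists>a b. a \<noteq> b \<and> {w \<in> C. adj u w} = {a, b}) \<and>
    square_free C"

text \<open>An induced path from \<open>x\<close> to \<open>y\<close>, possibly with disjoint
  cycles, described by degrees inside \<open>P\<close> as for rings. The neighbours of the two ends
  must differ: otherwise joining the ends by a new vertex would create a 4-cycle.\<close>

definition arch :: "'a set \<Rightarrow> 'a \<Rightarrow> 'a \<Rightarrow> bool" where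
  "arch P x y \<longleftrightarrow> P \<subseteq> V \<and>
      x \<in> P \<and> y \<in> P \<and> x \<noteq> y \<and> \<not> adj x y \<and>
    (\<forall>u\<in>P - {x, y}. \<exists>a b. a \<noteq> b \<and> {w \<in> P. adj u w} = {a, b}) \<and>
    (\<exists>a b. a \<noteq> b \<and> {w \<in> P. adj x w} = {a} \<and> {w \<in> P. adj y w} = {b}) \<and>
    square_free P"

lemma square_freeI:
  assumes "\<And>u v a b. \<lbrakk>u \<in> C; v \<in> C; a \<in> C; b \<in> C; u \<noteq> v; adj u a; adj u b; adj v a; adj v b\<rbrakk> \<Longrightarrow> a = b"
  shows "square_free C"
  unfolding square_free_def using assms by (intro ballI impI)

lemma square_freeD:
  assumes "square_free C" "u \<in> C" "v \<in> C" "a \<in> C" "b \<in> C" "u \<noteq> v" "adj u a" "adj u b" "adj v a" "adj v b"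
  shows "a = b"
  using assms(1)[unfolded square_free_def, rule_format, OF assms(2-10)] .

lemma not_adj_same: "col u = col v \<Longrightarrow> \<not> adj u v"
  using adj_col by blast

lemma arch_close:
  assumes P: "arch P x y" and z: "z \<in> V" "z \<notin> P" "\<And>w. w \<in> P \<Longrightarrow>
      adj z w \<longleftrightarrow> w = x \<or> w = y"
  shows "ring (insert z P)"
proof -
  obtain x' y' where x': "x' \<noteq> y'" "{w \<in> P. adj x w} = {x'}" "{w \<in> P. adj y w} = {y'}"
    using P unfolding arch_def by blast
  have xy: "x \<in> P" "y \<in> P" "x \<noteq> y" "\<not> adj x y" "P \<subseteq> V"
      using P by (auto simp: arch_def)
  have deg: "\<exists>a b. a \<noteq> b \<and> {w \<in> P. adj u w} = {a, b}"
      if "u \<in> P" "u \<noteq> x" "u \<noteq> y" for u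
    using P that unfolding arch_def by blast
  have c4: "a = b" if "u \<in> P" "v \<in> P" "a \<in> P" "b \<in> P" "u \<noteq> v" "adj u a" "adj u b" "adj v a" "adj v b"
    for u v a b
  proof -
    have "square_free P" using P unfolding arch_def by (elim conjE)
    then show ?thesis using that by (rule square_freeD)
  qed
  have zz: "\<not> adj z z" using not_adj_same by blast
  have zP: "adj w z \<longleftrightarrow> w = x \<or> w = y"
      if "w \<in> P" for w using z(3)[OF that] adj_commute by blast
  have nx: "adj x w \<longleftrightarrow> w = x'" if "w \<in> P" for w using x'(2) that by blast
  have ny: "adj y w \<longleftrightarrow> w = y'" if "w \<in> P" for w using x'(3) that by blast
  have x'P: "x' \<in> P" "y' \<in> P" using x' by blast+
  have deg': "\<exists>a b. a \<noteq> b \<and> {w \<in> insert z P. adj u w} = {a, b}"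
      if u: "u \<in> insert z P" for u
  proof -
    consider "u = z" | "u = x" | "u = y" | "u \<in> P" "u \<noteq> x" "u \<noteq> y" using u by blast
    then show ?thesis
    proof cases
      case 1
      then have "{w \<in> insert z P. adj u w} = {x, y}" using z(3) zz xy by auto
      then show ?thesis using xy by blast
    next
      case 2
      then have "{w \<in> insert z P. adj u w} = {z, x'}" using x'(2) zP[OF xy(1)] by auto
      moreover have "z \<noteq> x'" using x'P z by blast
      ultimately show ?thesis by blast
    next
      case 3
      then have "{w \<in> insert z P. adj u w} = {z, y'}" using x'(3) zP[OF xy(2)] by auto
      moreover have "z \<noteq> y'" using x'P z by blast
      ultimately show ?thesis by blast
    next
      case 4
      then have "{w \<in> insert z P. adj u w} = {w \<in> P. adj u w}" using zP by auto
      then show ?thesis using deg 4 by metis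
    qed
  qed
  have "a = b" if uv: "u \<in> insert z P" "v \<in> insert z P" "a \<in> insert z P" "b \<in> insert z P"
    "u \<noteq> v" "adj u a" "adj u b" "adj v a" "adj v b" for u v a b
  proof -
    have one: "a = b" if h: "v \<in> insert z P" "a \<in> insert z P" "b \<in> insert z P"
      "z \<noteq> v" "adj z a" "adj z b" "adj v a" "adj v b" for v a b
    proof -
      have "v \<in> P" "a \<in> P" "b \<in> P" using h zz by auto
      then have ab: "a = x \<or> a = y" "b = x \<or> b = y" using h z(3) by blast+
      have "adj a v" "adj b v" using h adj_sym by blast+
      then show ?thesis
          using ab nx[OF \<open>v \<in> P\<close>] ny[OF \<open>v \<in> P\<close>] x'(1) by blast
    qed
    show ?thesis
    proof (cases "u = z \<or> v = z")
      case True then show ?thesis using one[of v a b] one[of u a b] uv by blast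
    next
      case False
      then have P: "u \<in> P" "v \<in> P" using uv by auto
      show ?thesis
      proof (cases "a = z \<or> b = z")
        case True
        then show ?thesis using one[of b u v] one[of a u v] uv adj_sym by metis
      next
        case False
        then show ?thesis using c4[of u v a b] P uv by blast
      qed
    qed
  qed
  then have "square_free (insert z P)" by (rule square_freeI)
  with deg' show ?thesis
    unfolding ring_def using z(1) xy(5) by (intro conjI ballI) auto
qed

lemma arch_extend:
  assumes P: "arch P x y" and z: "z \<in> V" "z \<notin> P" "\<And>w. w \<in> P \<Longrightarrow>
      adj z w \<longleftrightarrow> w = x"
    and t: "t \<in> V" "t \<notin> P" "\<And>w. w \<in> P \<Longrightarrow>
        adj t w \<longleftrightarrow> w = y" and zt: "z \<noteq> t" "\<not> adj z t"
  shows "arch (insert z (insert t P)) z t"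
proof -
  let ?Q = "insert z (insert t P)"
  obtain x' y' where x': "x' \<noteq> y'" "{w \<in> P. adj x w} = {x'}" "{w \<in> P. adj y w} = {y'}"
    using P unfolding arch_def by blast
  have xy: "x \<in> P" "y \<in> P" "x \<noteq> y" "\<not> adj x y" "P \<subseteq> V"
      using P by (auto simp: arch_def)
  have deg: "\<exists>a b. a \<noteq> b \<and> {w \<in> P. adj u w} = {a, b}"
      if "u \<in> P" "u \<noteq> x" "u \<noteq> y" for u
    using P that unfolding arch_def by blast
  have c4: "a = b" if "u \<in> P" "v \<in> P" "a \<in> P" "b \<in> P" "u \<noteq> v" "adj u a" "adj u b" "adj v a" "adj v b"
    for u v a b
  proof -
    have "square_free P" using P unfolding arch_def by (elim conjE)
    then show ?thesis using that by (rule square_freeD)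
  qed
  have irr: "\<not> adj z z" "\<not> adj t t" "\<not> adj t z" using not_adj_same zt adj_sym by blast+
  have zP: "adj w z \<longleftrightarrow> w = x" if "w \<in> P" for w using z(3)[OF that] adj_commute by blast
  have tP: "adj w t \<longleftrightarrow> w = y" if "w \<in> P" for w using t(3)[OF that] adj_commute by blast
  have x'P: "x' \<in> P" "y' \<in> P" using x' by blast+
  have nz: "{w \<in> ?Q. adj z w} = {x}" using z(3) irr zt xy by auto
  have nt: "{w \<in> ?Q. adj t w} = {y}" using t(3) irr zt xy by auto
  have deg': "\<exists>a b. a \<noteq> b \<and> {w \<in> ?Q. adj u w} = {a, b}"
      if u: "u \<in> ?Q - {z, t}" for u
  proof -
    consider "u = x" | "u = y" | "u \<in> P" "u \<noteq> x" "u \<noteq> y" using u by blast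
    then show ?thesis
    proof cases
      case 1
      then have "{w \<in> ?Q. adj u w} = {z, x'}" using x'(2) zP[OF xy(1)] tP[OF xy(1)] xy by auto
      moreover have "z \<noteq> x'" using x'P z by blast
      ultimately show ?thesis by blast
    next
      case 2
      then have "{w \<in> ?Q. adj u w} = {t, y'}" using x'(3) zP[OF xy(2)] tP[OF xy(2)] xy by auto
      moreover have "t \<noteq> y'" using x'P t by blast
      ultimately show ?thesis by blast
    next
      case 3
      then have "{w \<in> ?Q. adj u w} = {w \<in> P. adj u w}" using zP tP by auto
      then show ?thesis using deg 3 by metis
    qed
  qed
  have c4': "a = b" if uv: "u \<in> ?Q" "v \<in> ?Q" "a \<in> ?Q" "b \<in> ?Q"
    "u \<noteq> v" "adj u a" "adj u b" "adj v a" "adj v b" for u v a b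
  proof -
    have z1: "w = x" if "w \<in> ?Q" "adj z w" for w
      using that z(3) irr zt by blast
    have t1: "w = y" if "w \<in> ?Q" "adj t w" for w
      using that t(3) irr zt by blast
    consider "u \<in> {z, t} \<or> v \<in> {z, t}" | "a \<in> {z, t} \<or> b \<in> {z, t}"
      | "u \<in> P" "v \<in> P" "a \<in> P" "b \<in> P" using uv by blast
    then show ?thesis
    proof cases
      case 1
      then show ?thesis using uv z1[of a] z1[of b] t1[of a] t1[of b] by blast
    next
      case 2
      then show ?thesis
        using uv(1,2,5) uv(6-9)[THEN adj_sym] z1[of u] z1[of v] t1[of u] t1[of v] by blast
    next
      case 3 then show ?thesis using c4 uv by blast
    qed
  qed
  show ?thesis unfolding arch_def
  proof (intro conjI ballI)
    show "\<exists>a b. a \<noteq> b \<and> {w \<in> ?Q. adj z w} = {a} \<and> {w \<in> ?Q. adj t w} = {b}"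
      using nz nt xy(3) by (intro exI[of _ x] exI[of _ y]) simp
    show "square_free ?Q" using c4' by (rule square_freeI)
  qed (use z(1) t(1) xy zt deg' in auto)
qed

text \<open>Both ends are pulled down one level at a time. A vertex just below the ends sees nothing
  else of \<open>P\<close>, so either one lower neighbour serves both ends and closes a ring, or two
  of them extend the arch. At level 0 the ends would coincide.\<close>

lemma ring_if_arch:
  assumes L: "levels s L"
  shows "arch P x y \<Longrightarrow> L x = k \<Longrightarrow>
      L y = k \<Longrightarrow> (\<And>w. w \<in> P - {x, y} \<Longrightarrow> k < L w) \<Longrightarrow> \<exists>C. ring C"
proof (induction k arbitrary: P x y)
  case 0
  then have "x = s" "y = s" "x \<noteq> y" using L by (auto simp: levels_def arch_def)
  then show ?case by blast
next
  case (Suc k)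
  have P: "x \<in> P" "y \<in> P" "P \<subseteq> V" "x \<noteq> y" using Suc.prems(1) by (auto simp: arch_def)
  have adjL: "L u = Suc (L v) \<or> L v = Suc (L u)" if "adj u v" for u v
    using L that by (auto simp: levels_def)
  have down: "\<exists>w. adj w v \<and> L w = k" if "v \<in> V" "L v = Suc k" for v
    using L that adj_sym unfolding levels_def by (metis nat.distinct(1) nat.inject)
  have low: "w = x \<or> w = y" if "adj u w" "L u = k" "w \<in> P" for u w
  proof (rule ccontr)
    assume "\<not> (w = x \<or> w = y)"
    then have "Suc k < L w" using Suc.prems(4)[of w] that(3) by blast
    then show False using adjL[OF that(1)] that(2) by auto
  qed
  have notin: "u \<notin> P" if "L u = k" for u
    using Suc.prems(2,3) Suc.prems(4)[of u] that by (cases "u = x \<or> u = y") auto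
  obtain z where z: "adj z x" "L z = k" using down P Suc.prems by blast
  obtain t where t: "adj t y" "L t = k" using down P Suc.prems by blast
  have V: "z \<in> V" "t \<in> V" using z t adj_in by blast+
  show ?case
  proof (cases "adj z y \<or> adj t x")
    case True
    then obtain u where u: "adj u x" "adj u y" "L u = k" using z t by blast
    then have "ring (insert u P)"
      using low notin adj_in by (intro arch_close[OF Suc.prems(1)]) blast+
    then show ?thesis by blast
  next
    case False
    have zt: "\<not> adj z t" using adjL[of z t] z t by auto
    have "arch (insert z (insert t P)) z t"
      using low notin z t V False zt by (intro arch_extend[OF Suc.prems(1)]) blast+
    then show ?thesis
    proof (rule Suc.IH[OF _ z(2) t(2)])
      fix w assume "w \<in> insert z (insert t P) - {z, t}"
      then have "w \<in> P" by blast
      then show "k < L w" using Suc.prems(2,3) Suc.prems(4)[of w] by (cases "w = x \<or> w = y") auto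
    qed
  qed
qed

text \<open>The path \<open>u p t p' u'\<close> is an arch whose inner vertices lie above its
  ends.\<close>

lemma ring_if_not_nested:
  assumes L: "levels s L" and "adj t p" "adj t p'" "L t = Suc (L p)" "L p = L p'"
    and "adj p u" "\<not> adj p' u" "adj p' u'" "\<not> adj p u'" "L p = Suc (L u)" "L p' = Suc (L u')"
  shows "\<exists>C. ring C"
proof -
  have adjL: "L u = Suc (L v) \<or> L v = Suc (L u)" if "adj u v" for u v
    using L that by (auto simp: levels_def)
  have col: "col t = col u" "col t = col u'" "col p = col p'" "col t \<noteq> col p"
    using assms(2-9) adj_col by metis+
  have V: "{u, p, t, p', u'} \<subseteq> V" using assms adj_in adj_in2 by blast
  have ne: "u \<noteq> u'" "p \<noteq> p'" "t \<noteq> u" "t \<noteq> u'" "u \<noteq> p" "u \<noteq> p'" "u' \<noteq> p" "u' \<noteq> p'" "t \<noteq> p" "t \<noteq> p'"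
    using assms by auto
  have na: "\<not> adj t u" "\<not> adj t u'" "\<not> adj u u'" "\<not> adj p p'" "\<not> adj u t" "\<not> adj u' t" "\<not> adj u' u"
    "\<not> adj p' p" "\<And>w. \<not> adj w w" using not_adj_same col by auto
  have s: "adj p t" "adj p' t" "adj u p" "\<not> adj u p'" "adj u' p'" "\<not> adj u' p"
    using assms adj_sym by blast+
  let ?P = "{u, p, t, p', u'}"
  have n: "{w \<in> ?P. adj u w} = {p}" "{w \<in> ?P. adj u' w} = {p'}" "{w \<in> ?P. adj p w} = {u, t}"
    "{w \<in> ?P. adj p' w} = {t, u'}" "{w \<in> ?P. adj t w} = {p, p'}"
    using assms(2,3,6-9) s na ne by auto
  have mem: "w \<in> {p}" if "w \<in> ?P" "adj u w" for w using n(1) that by blast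
  have mem': "w \<in> {p'}" if "w \<in> ?P" "adj u' w" for w using n(2) that by blast
  have c4: "a = b" if h: "v \<in> ?P" "v' \<in> ?P" "a \<in> ?P" "b \<in> ?P" "v \<noteq> v'"
    "adj v a" "adj v b" "adj v' a" "adj v' b" for v v' a b
  proof (cases "{v, v', a, b} \<inter> {u, u'} = {}")
    case True
    then have "v \<in> {p, t, p'}" "v' \<in> {p, t, p'}" "a \<in> {p, t, p'}" "b \<in> {p, t, p'}"
        using h(1-4) by auto
    then show ?thesis using h(5-9) na by auto
  next
    case False
    then have "v \<in> {u, u'} \<or> v' \<in> {u, u'} \<or> a \<in> {u, u'} \<or> b \<in> {u, u'}" by auto
    then show ?thesis
      using h(5) mem[OF h(3)] mem[OF h(4)] mem'[OF h(3)] mem'[OF h(4)] h(6-9)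
        mem[OF h(1)] mem[OF h(2)] mem'[OF h(1)] mem'[OF h(2)] h(6-9)[THEN adj_sym]
      by (elim disjE) auto
  qed
  have "arch ?P u u'"
    unfolding arch_def
  proof (intro conjI ballI allI impI)
    fix w assume "w \<in> ?P - {u, u'}"
    then consider "w = p" | "w = t" | "w = p'" by blast
    then show "\<exists>a b. a \<noteq> b \<and> {z \<in> ?P. adj w z} = {a, b}"
    proof cases
      case 1 then show ?thesis using n(3) ne by metis
    next
      case 2 then show ?thesis using n(5) ne by metis
    next
      case 3 then show ?thesis using n(4) ne by metis
    qed
  next
    show "\<exists>a b. a \<noteq> b \<and> {w \<in> ?P. adj u w} = {a} \<and> {w \<in> ?P. adj u' w} = {b}"
      using n(1,2) ne by metis
  next
    show "square_free ?P" using c4 by (rule square_freeI)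
  qed (use V ne na in auto)
  then show ?thesis
    by (rule ring_if_arch[OF L, of _ _ _ "L u"]) (use assms in auto)
qed

end

section \<open>Ends in the last breadth-first level\<close>

context ats_free
begin

text \<open>Without rings, two lower neighbours of one vertex have comparable lower neighbourhoods,
  hence a common lower neighbour. Together with a vertex below it, this completes the violations
  near \<open>r\<close> to armchairs or stirrers; level at least 3 leaves room for these two levels
  below the neighbours of \<open>r\<close>.\<close>

lemma end_vertex_if_no_ring:
  assumes L: "levels s L" and no_ring: "\<And>C. \<not> ring C"
    and r: "L r = Suc (Suc (Suc k))" and last: "\<And>v. v \<in> V \<Longrightarrow> L v \<le> L r"
    and minimal: "\<And>v. \<lbrakk>v \<in> V; L v = L r; \<And>w. adj v w \<Longrightarrow>
        adj r w\<rbrakk> \<Longrightarrow> (\<And>w. adj r w \<Longrightarrow> adj v w)"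
  shows "end_vertex V adj col r"
proof -
  have lv: "L u = Suc (L v) \<or> L v = Suc (L u)" if "adj u v" for u v
    using L that by (auto simp: levels_def)
  have far: "\<not> adj u v" if "Suc (L u) < L v \<or> Suc (L v) < L u \<or> L u = L v" for u v
    using lv[of u v] that by auto
  have down: "\<exists>w. adj v w \<and> L v = Suc (L w)" if "adj u v" "L v \<noteq> 0" for u v
    using L adj_in2[OF that(1)] that(2) unfolding levels_def by blast
  have top_nbr: "L w = Suc (Suc k)" if "adj v w" "L v = L r" for v w
    using lv[OF that(1)] last[OF adj_in2[OF that(1)]] that(2) r by auto
  have two: "L w = Suc k \<or> L w = L r" if "adj v w" "L v = Suc (Suc k)" for v w
    using lv[OF that(1)] that(2) r by auto
  have nested: "False" if "adj t p" "adj t p'" "L t = Suc (L p)" "L p = L p'" "adj p u" "\<not> adj p' u"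
    "adj p' u'" "\<not> adj p u'" "L p = Suc (L u)" "L p' = Suc (L u')" for t p p' u u'
    using ring_if_not_nested[OF L that] no_ring by blast
  have common: "\<exists>u. adj p u \<and> adj p' u \<and> L p = Suc (L u)"
    if h: "adj t p" "adj t p'" "L t = Suc (L p)" "L p = L p'" "L p \<noteq> 0" for t p p'
  proof -
    obtain u where u: "adj p u" "L p = Suc (L u)" using down[OF h(1,5)] by blast
    obtain u' where u': "adj p' u'" "L p' = Suc (L u')" using down[OF h(2)] h(4,5) by auto
    show ?thesis using nested[OF h(1-4) u(1) _ u'(1) _ u(2) u'(2)] u u' h(4) by metis
  qed
  have chain1_top: False
    if h: "adj r p" "adj r p'" "adj p u" "adj p' u'" "\<not> adj p' u" "\<not> adj p u'" and u: "L u = L r"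
    for p p' u u'
  proof -
    have Lp: "L p = Suc (Suc k)" "L p' = Suc (Suc k)" using top_nbr h by blast+
    obtain v where v: "adj p v" "adj p' v" "L v = Suc k"
      using common[OF h(1,2)] Lp r by auto
    obtain v' where v': "adj v v'" "L v' = k" using down[OF v(1)] v(3) by auto
    have nv: "\<not> adj r v'" "\<not> adj u v'" "\<not> adj p u'" using far v' r u h by auto
    show False
    proof (cases "L u' = L r")
      case True
      then have "\<not> adj v' r" "\<not> adj v' u" "\<not> adj v' u'" "\<not> adj r u"
        using far v' r u by auto
      moreover have "\<not> adj p v'" "\<not> adj p' v'" using far v' Lp by auto
      ultimately show False
        by - (rule armchair_free[of p v p' r u v' u']; use h v v' in \<open>simp add: adj_commute\<close>)
    next
      case False
      then have Lu': "L u' = Suc k" using two[OF h(4) Lp(2)] by blast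
      have lower: "adj p' w" if "adj p w" "L w = Suc k" for w
        using nested[OF h(1,2) _ _ that(1) _ h(4)] h that Lp Lu' r by auto
      \<comment> \<open>\<open>u\<close> is in the last level and misses the neighbour
        \<open>p'\<close> of \<open>r\<close>, so by minimality its neighbourhood is not inside that
        of \<open>r\<close>.\<close>
      have "\<exists>p3. adj u p3 \<and> \<not> adj r p3"
        using minimal[OF adj_in2[OF h(3)] u] h adj_sym by metis
      then obtain p3 where p3: "adj u p3" "\<not> adj r p3" by blast
      have Lp3: "L p3 = Suc (Suc k)" using top_nbr[OF p3(1) u] .
      obtain z where z: "adj p z" "adj p3 z" "L z = Suc k"
        using common[of u p p3] adj_sym[OF h(3)] p3 Lp3 Lp u r by auto
      obtain z' where z': "adj z z'" "L z' = k" using down[OF z(1)] z(3) by auto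
      have "\<not> adj z' r" "\<not> adj z' u" using far z' r u by auto
      then show False
        by - (rule stirrer_free[of p' z p3 r p u z'];
            use lower[OF z(1,3)] h z z' p3 in \<open>simp add: adj_commute\<close>)
    qed
  qed
  have chain2: False if h: "adj r q" "adj q u" "adj q u'" "adj u w" "adj u' w'" "\<not> adj u w'" "\<not> adj u' w"
      "\<not> adj r w" "\<not> adj r w'"
    for q u u' w w'
  proof -
    have Lq: "L q = Suc (Suc k)" using top_nbr h by blast
    have dom: False if z: "adj z q" "adj z w" "adj z w'" for z
      by - (rule stirrer_free[of u q u' w z w' r]; use h z in \<open>simp add: adj_commute\<close>)
    have c4: False if z: "adj z q" "adj z w" "L z = Suc k" "\<not> adj z w'"
      and z': "adj z' q" "adj z' w'" "L z' = Suc k" "\<not> adj z' w" for z z'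
    proof -
      obtain y where y: "adj z y" "adj z' y" "L y = k"
        using common[of q z z'] z z' Lq by (auto simp: adj_commute)
      have "\<not> adj r y" using far y r by auto
      then show False by - (rule armchair_free[of z q z' y w r w'];
          use h z z' y in \<open>simp add: adj_commute\<close>)
    qed
    \<comment> \<open>With only \<open>u\<close> in the last level, the low vertex \<open>u'\<close>
      itself sees \<open>w'\<close> and not \<open>w\<close>, while a common lower neighbour of
      \<open>q\<close> and \<open>w\<close> does the opposite; this is the situation of
      \<open>c4\<close>.\<close>
    have mixed: False if h: "adj q u" "adj q u'" "adj u w" "adj u' w'" "\<not> adj u w'" "\<not> adj u' w"
      "\<not> adj r w" "\<not> adj r w'" and Lu: "L u = L r" "L u' = Suc k"
      and dom: "\<And>z. \<lbrakk>adj z q; adj z w; adj z w'\<rbrakk> \<Longrightarrow> False"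
      and c4: "\<And>z z'. \<lbrakk>adj z q; adj z w; L z = Suc k; \<not> adj z w'; adj z' q; adj z' w';
        L z' = Suc k; \<not> adj z' w\<rbrakk> \<Longrightarrow> False" for u u' w w'
    proof -
      have Lw: "L w = Suc (Suc k)" using top_nbr h(3) Lu(1) by blast
      obtain z where z: "adj q z" "adj w z" "L z = Suc k"
        using common[of u q w] h(1,3) Lw Lq Lu r adj_sym[OF h(1)] by auto
      show False using c4[of z u'] dom[of z] z h Lu adj_sym by blast
    qed
    consider "L u = L r" "L u' = L r" | "L u = L r" "L u' = Suc k" | "L u = Suc k" "L u' = L r"
      | "L u = Suc k" "L u' = Suc k"
      using two[OF h(2) Lq] two[OF h(3) Lq] by blast
    then show False
    proof cases
      case 1
      have Lw: "L w = Suc (Suc k)" "L w' = Suc (Suc k)" using top_nbr h 1 by blast+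
      obtain z where z: "adj q z" "adj w z" "L z = Suc k"
        using common[of u q w] adj_sym[OF h(2)] h(4) Lw Lq 1 r by auto
      obtain z' where z': "adj q z'" "adj w' z'" "L z' = Suc k"
        using common[of u' q w'] adj_sym[OF h(3)] h(5) Lw Lq 1 r by auto
      show False using c4[of z z'] dom[of z] dom[of z'] z z' adj_sym by blast
    next
      case 2
      show False by (rule mixed[OF h(2-9) 2]) (use dom c4 in blast)+
    next
      case 3
      show False by (rule mixed[OF h(3,2,5,4,7,6,9,8) 3(2,1)]) (use dom c4 in blast)+
    next
      case 4
      show False using c4[of u u'] 4 h adj_sym by blast
    qed
  qed
  show ?thesis
  proof unfold_locales
    fix p p' u u'
    assume h: "adj r p" "adj r p'" "adj p u" "adj p' u'" "\<not> adj p' u" "\<not> adj p u'"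
    have Lp: "L p = Suc (Suc k)" "L p' = Suc (Suc k)" using top_nbr h by blast+
    consider "L u = L r" | "L u' = L r" | "L u = Suc k" "L u' = Suc k"
      using two[OF h(3) Lp(1)] two[OF h(4) Lp(2)] by blast
    then show False
    proof cases
      case 1 then show False using chain1_top h by blast
    next
      case 2 then show False using chain1_top[of p' p u' u] h by blast
    next
      case 3 then show False using nested[OF h(1,2) _ _ h(3,5,4,6)] Lp r by auto
    qed
  next
    fix p p0 u u' w
    assume h: "adj r p" "adj r p0" "adj u p" "adj u p0" "adj u' p0" "\<not> adj u' p" "adj u w"
      "\<not> adj u' w" "\<not> adj r w"
    \<comment> \<open>Once all neighbours of \<open>u'\<close> are neighbours of \<open>r\<close>,
      minimality fails at \<open>p\<close> if \<open>u'\<close> is in the last level; otherwise a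
      vertex below \<open>u'\<close> is too far from \<open>r\<close>.\<close>
    have sub: "adj r w'" if "adj u' w'" for w'
    proof (rule ccontr)
      assume n: "\<not> adj r w'"
      then have "adj u w'"
        using chain2[OF h(2) adj_sym[OF h(4)] adj_sym[OF h(5)] h(7) that _ h(8,9)] by blast
      then show False by - (rule stirrer_free[of p u w' r p0 u' w];
          use h n that in \<open>simp add: adj_commute\<close>)
    qed
    have Lp: "L p0 = Suc (Suc k)" using top_nbr h(2) by blast
    show False
    proof (cases "L u' = L r")
      case True
      then show False using minimal[OF adj_in[OF h(5)] True sub h(1)] h(6) by blast
    next
      case False
      then have Lu': "L u' = Suc k" using two[OF adj_sym[OF h(5)] Lp] by blast
      then obtain w' where "adj u' w'" "L w' = k" using down[OF adj_sym[OF h(5)]] by auto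
      then show False using sub[of w'] far[of r w'] r by auto
    qed
  qed (use chain2 in blast)
qed

end

section \<open>Reduction to connected graphs\<close>

lemma interval_model_subgraph:
  assumes "interval_model V adj k" "\<And>u v. adj' u v \<Longrightarrow> adj u v"
  shows "interval_model V adj' k"
proof -
  obtain l r :: "'a \<Rightarrow> nat" where "\<forall>v\<in>V. l v \<le> r v" "\<forall>u v. adj u v \<longrightarrow> l u \<le> r v"
    "\<forall>t. card {v \<in> V. l v \<le> t \<and> t \<le> r v} \<le> k"
    using assms(1) unfolding interval_model_def by blast
  then show ?thesis
    unfolding interval_model_def using assms(2) by (intro exI[of _ l] exI[of _ r] conjI) blast+
qed

context bip_graph
begin

lemma bip_graph_induced: "W \<subseteq> V \<Longrightarrow> bip_graph W (induced adj W) col"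
proof
  assume W: "W \<subseteq> V"
  show "finite W" by (rule finite_subset[OF W finite_V])
qed (simp_all add: adj_sym adj_col)

text \<open>A proper nonempty set closed under adjacency splits the graph into two smaller ones,
  whose models are placed one after the other.\<close>

lemma interval_model_if_components:
  assumes comp: "\<And>W. W \<subseteq> V \<Longrightarrow>
      bip_graph.conn W (induced adj W) \<Longrightarrow> interval_model W (induced adj W) k"
  shows "interval_model V adj k"
proof -
  have "interval_model U (induced adj U) k" if "U \<subseteq> V" for U
    using that
  proof (induction "card U" arbitrary: U rule: less_induct)
    case less
    interpret U: bip_graph U "induced adj U" col using less.prems by (rule bip_graph_induced)
    show ?case
    proof (cases "U = {} \<or> U.conn")
      case True
      then show ?thesis
      proof
        assume "U = {}"
        then show ?thesis unfolding interval_model_def by auto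
      qed (rule comp[OF less.prems])
    next
      case False
      then obtain W where W: "W \<subseteq> U" "W \<noteq> {}" "W \<noteq> U"
        "\<And>u v. adj u v \<Longrightarrow> u \<in> U \<Longrightarrow>
            v \<in> U \<Longrightarrow> u \<in> W \<Longrightarrow> v \<in> W"
        unfolding U.conn_def by auto
      have IH: "interval_model Z (induced (induced adj U) Z) k" if "Z \<subset> U" for Z
      proof (rule interval_model_subgraph)
        show "interval_model Z (induced adj Z) k"
          using less.hyps[of Z] psubset_card_mono[OF U.finite_V that] that less.prems by blast
      qed auto
      show ?thesis
      proof (rule interval_model_disjoint_union[OF U.finite_V W(1)])
        show "interval_model W (induced (induced adj U) W) k"
          using IH[of W] W(1,3) by blast
        show "interval_model (U - W) (induced (induced adj U) (U - W)) k"
          using IH[of "U - W"] W(1,2) by blast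
      next
        fix u v assume "adj u v \<and> u \<in> U \<and> v \<in> U"
        then show "u \<in> U \<and> v \<in> U \<and> (u \<in> W \<longleftrightarrow> v \<in> W)"
          using W(4)[of u v] W(4)[of v u] adj_sym[of u v] by auto
      qed
    qed
  qed
  from this[OF order_refl] show ?thesis
    by (rule interval_model_subgraph) (use adj_in adj_in2 in auto)
qed

lemma ring_induced:
  assumes "W \<subseteq> V" "bip_graph.ring W (induced adj W) C"
  shows "ring C" "C \<subseteq> W"
proof -
  interpret W: bip_graph W "induced adj W" col using assms(1) by (rule bip_graph_induced)
  show CW: "C \<subseteq> W" using assms(2) unfolding W.ring_def by auto
  have eq: "{w \<in> C. induced adj W u w} = {w \<in> C. adj u w}" if "u \<in> C" for u
    using CW that by auto
  have sq: "square_free C"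
  proof (rule square_freeI)
    fix u v a b assume h: "u \<in> C" "v \<in> C" "a \<in> C" "b \<in> C" "u \<noteq> v" "adj u a" "adj u b" "adj v a" "adj v b"
    have "W.square_free C" using assms(2) unfolding W.ring_def by auto
    then show "a = b" by (rule W.square_freeD[of C u v]) (use h CW in auto)
  qed
  show "ring C"
    unfolding ring_def
  proof (intro conjI ballI)
    fix u assume u: "u \<in> C"
    then have "\<exists>a b. a \<noteq> b \<and> {w \<in> C. induced adj W u w} = {a, b}"
      using assms(2) unfolding W.ring_def by blast
    then show "\<exists>a b. a \<noteq> b \<and> {w \<in> C. adj u w} = {a, b}" unfolding eq[OF u] .
  qed (use assms sq CW W.ring_def in auto)
qed

end

context ats_free
begin

lemma ats_free_induced:
  assumes "W \<subseteq> V"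
  shows "ats_free W (induced adj W) col"
proof -
  interpret W: bip_graph W "induced adj W" col using assms by (rule bip_graph_induced)
  show ?thesis
  proof unfold_locales
    fix p a b c a' b' c'
    assume "induced adj W p a" "induced adj W p b" "induced adj W p c" "induced adj W a a'"
      "induced adj W b b'" "induced adj W c c'" "\<not> induced adj W a b'" "\<not> induced adj W a c'"
      "\<not> induced adj W b a'" "\<not> induced adj W b c'" "\<not> induced adj W c a'" "\<not> induced adj W c b'"
    then show False using tripod_free[of p a b c a' b' c'] by blast
  next
    fix a b c d a' b' c'
    assume "induced adj W a b" "induced adj W b c" "induced adj W c d" "induced adj W d a"
      "induced adj W a a'" "induced adj W b b'" "induced adj W c c'" "\<not> induced adj W b' d"
      "\<not> induced adj W b' a'" "\<not> induced adj W b' c'" "\<not> induced adj W a c'" "\<not> induced adj W c a'"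
    then show False using armchair_free[of a b c d a' b' c'] by blast
  next
    fix u0 u1 u2 u3 u4 u5 u6
    assume "induced adj W u0 u1" "induced adj W u1 u2" "induced adj W u3 u4" "induced adj W u4 u5"
      "induced adj W u0 u3" "induced adj W u1 u4" "induced adj W u2 u5" "induced adj W u1 u6"
      "\<not> induced adj W u0 u5" "\<not> induced adj W u2 u3" "\<not> induced adj W u6 u3" "\<not> induced adj W u6 u5"
    then show False using stirrer_free[of u0 u1 u2 u3 u4 u5 u6] by blast
  qed
qed

text \<open>If some search reaches level 3, its last level contains an end. Otherwise vertices of
  opposite colours have odd distance below 3, so the graph is complete bipartite and a side with at
  most \<open>d\<close> vertices is a vertex cover.\<close>

lemma interval_model_if_conn_no_ring:
  assumes conn and no_ring: "\<And>C. \<not> ring C" and free: "biclique_free d adj" and d: "d \<ge> 1"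
  shows "interval_model V adj (2 * d)"
proof (cases "\<exists>v\<in>V. \<forall>w. \<not> adj v w")
  case True
  then obtain v where v: "v \<in> V" "\<And>w. \<not> adj v w" by blast
  have "{v} = V" by (rule connD[OF assms(1)]) (use v in auto)
  then have "\<not> adj u w" for u w using v(2) adj_in[of u w] by auto
  then show ?thesis
    using interval_model_mono[OF interval_model_independent[OF finite_V]] d by simp
next
  case iso: False
  have levels: "\<exists>L. levels s L" if "s \<in> V" for s using levels_exist[OF assms(1) that] .
  show ?thesis
  proof (cases "\<exists>s L. levels s L \<and> (\<exists>v\<in>V. 2 < L v)")
    case True
    then obtain s L v where L: "levels s L" "v \<in> V" "2 < L v" by blast
    define D where "D = Max (L ` V)"
    have D_ge: "L v \<le> D" if "v \<in> V" for v using that finite_V by (simp add: D_def)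
    have "D \<in> L ` V" unfolding D_def using finite_V L by (intro Max_in) auto
    then obtain v0 where "v0 \<in> V \<and> L v0 = D" by blast
    from ex_has_least_nat[of "\<lambda>v. v \<in> V \<and>
        L v = D", OF this, of "\<lambda>v. card {w. adj v w}"]
    obtain r where r: "r \<in> V" "L r = D"
      and r_min: "\<And>v. v \<in> V \<Longrightarrow>
          L v = D \<Longrightarrow> card {w. adj r w} \<le> card {w. adj v w}"
      by blast
    have fin: "finite {w. adj v w}" for v
      by (rule finite_subset[OF _ finite_V]) (use adj_in2 in auto)
    have "3 \<le> L r" using L(3) D_ge[OF L(2)] r(2) by simp
    then obtain k where "L r = 3 + k" using le_Suc_ex by blast
    then have k: "L r = Suc (Suc (Suc k))" by simp
    have "end_vertex V adj col r"
    proof (rule end_vertex_if_no_ring[OF L(1) no_ring k])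
      fix v w assume v: "v \<in> V" "L v = L r" and sub: "\<And>w. adj v w \<Longrightarrow>
          adj r w" and w: "adj r w"
      have "{w. adj v w} = {w. adj r w}"
        using card_seteq[OF fin, of "{w. adj v w}" r] r_min[OF v(1)] v(2) r(2) sub by blast
      then show "adj v w" using w by blast
    qed (use D_ge r(2) in simp)
    then interpret end_vertex V adj col r .
    show ?thesis
      by (rule interval_model_2d[OF assms(1) free r(1)]) (use iso in blast)
  next
    case False
    have complete: "adj u v" if uv: "u \<in> V" "v \<in> V" "col u \<noteq> col v" for u v
    proof -
      obtain L where L: "levels u L" using levels[OF uv(1)] by blast
      have Lu: "L u = 0" using L by (auto simp: levels_def)
      have down: "\<exists>y. adj x y \<and> L x = Suc (L y)" if "x \<in> V" "L x \<noteq> 0" for x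
        using L that by (auto simp: levels_def)
      have zero: "x = u" if "x \<in> V" "L x = 0" for x using L that by (auto simp: levels_def)
      have "\<not> 2 < L v" using False L uv(2) by blast
      moreover have "L v \<noteq> 0" using zero[OF uv(2)] uv(3) by auto
      moreover have "L v \<noteq> 2"
      proof
        assume "L v = 2"
        then obtain y where y: "adj v y" "L y = 1" using down[OF uv(2)] by auto
        then obtain x where x: "adj y x" "L x = 0" using down[of y] adj_in2[OF y(1)] by auto
        then have "x = u" using zero adj_in2 by blast
        then show False using adj_col[OF y(1)] adj_col[OF x(1)] uv(3) by auto
      qed
      ultimately have "L v = 1" by linarith
      then obtain y where y: "adj v y" "L y = 0" using down[OF uv(2)] by auto
      then show ?thesis using zero adj_in2[OF y(1)] adj_sym by blast
    qed
    let ?X = "{v \<in> V. col v}" and ?Y = "{v \<in> V. \<not> col v}"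
    have "card ?X \<le> d \<or> card ?Y \<le> d"
      by (rule biclique_freeD[OF free]) (use finite_V complete in auto)
    then obtain S where S: "S = ?X \<or> S = ?Y" "card S \<le> d" by blast
    have "interval_model V adj (d + 1)"
    proof (rule interval_model_vertex_cover[OF finite_V _ S(2)])
      show "u \<in> S \<or> v \<in> S" if "adj u v" for u v
        using S(1) adj_col[OF that] adj_in[OF that] adj_in2[OF that] by auto
    qed (use S adj_in adj_in2 in auto)
    then show ?thesis using interval_model_mono d by fastforce
  qed
qed

lemma interval_model_if_no_ring:
  assumes no_ring: "\<And>C. \<not> ring C" and free: "biclique_free d adj" and d: "d \<ge> 1"
  shows "interval_model V adj (2 * d)"
proof (rule interval_model_if_components)
  fix W assume W: "W \<subseteq> V" and conn: "bip_graph.conn W (induced adj W)"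
  interpret W: ats_free W "induced adj W" col using W by (rule ats_free_induced)
  show "interval_model W (induced adj W) (2 * d)"
    using W.interval_model_if_conn_no_ring[OF conn _ biclique_free_induced[OF free] d]
      ring_induced(1)[OF W] no_ring by blast
qed

section \<open>Rings dominate; squares off a ring\<close>

lemma ring_neighbours:
  assumes "ring C" "c \<in> C" "x \<in> C" "adj c x"
  obtains y where "y \<in> C" "adj c y" "y \<noteq> x" "\<And>w. w \<in> C \<Longrightarrow>
      adj c w \<Longrightarrow> w = x \<or> w = y"
proof -
  obtain a b where ab: "a \<noteq> b" "{w \<in> C. adj c w} = {a, b}"
    using assms(1,2) unfolding ring_def by blast
  then have "x = a \<or> x = b" using assms(3,4) by auto
  then show thesis
  proof
    assume "x = a" then show thesis using that[of b] ab by blast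
  next
    assume "x = b" then show thesis using that[of a] ab by blast
  qed
qed

lemma ring_two_neighbours:
  assumes "ring C" "c \<in> C"
  obtains x y where "x \<in> C" "y \<in> C" "adj c x" "adj c y" "y \<noteq> x"
    "\<And>w. w \<in> C \<Longrightarrow> adj c w \<Longrightarrow> w = x \<or> w = y"
proof -
  obtain x where "x \<in> C" "adj c x" using assms unfolding ring_def by blast
  then show thesis using ring_neighbours[OF assms, of x] that[of x] by metis
qed

lemma ring_square:
  assumes "ring C" "u \<in> C" "v \<in> C" "a \<in> C" "b \<in> C" "u \<noteq> v" "adj u a" "adj u b" "adj v a" "adj v b"
  shows "a = b"
  using assms by (meson ring_def square_freeD)

text \<open>A tripod centred at \<open>c\<close> makes \<open>u\<close> see \<open>y1\<close> or
  \<open>y2\<close>, a stirrer forbids both, and an armchair on the square \<open>y u c x\<close>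
  makes \<open>v\<close> see the ring vertex after that \<open>y\<close>. So if \<open>v\<close>
  misses both ring neighbours of \<open>c\<close>, the edge \<open>uv\<close> is attached again two
  steps along the ring.\<close>

lemma ring_walk:
  assumes C: "ring C" "c \<in> C" "x1 \<in> C" "x2 \<in> C" "y1 \<in> C" "y2 \<in> C"
    and nb: "adj c x1" "adj c x2" "x1 \<noteq> x2" "adj x1 y1" "y1 \<noteq> c" "adj x2 y2" "y2 \<noteq> c"
    and uv: "adj u c" "adj u v" "\<not> adj v x1" "\<not> adj v x2"
  shows "adj u y1 \<and> \<not> adj u y2 \<and>
      (\<forall>z\<in>C. adj z y1 \<longrightarrow> z \<noteq> x1 \<longrightarrow> adj v z) \<or>
    adj u y2 \<and> \<not> adj u y1 \<and>
        (\<forall>z\<in>C. adj z y2 \<longrightarrow> z \<noteq> x2 \<longrightarrow> adj v z)"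
proof -
  have far: "\<not> adj x1 y2" "\<not> adj x2 y1"
    using ring_square[OF C(1) C(3) C(4) C(2) C(6)] ring_square[OF C(1) C(3) C(4) C(2) C(5)] nb adj_sym
    by blast+
  have cn: "w = x1 \<or> w = x2" if "w \<in> C" "adj c w" for w
    using ring_neighbours[OF C(1-3) nb(1)] C(4) nb(2,3) that by metis
  have one: "adj u y1 \<or> adj u y2"
    using tripod_free[of c u x1 x2 v y1 y2] nb uv far by (auto simp: adj_commute)
  have both: "\<not> (adj u y1 \<and> adj u y2)"
    using stirrer_free[of y1 u y2 x1 c x2 v] nb uv far by (auto simp: adj_commute)
  have arm: "adj v z" if z: "z \<in> C" "adj z y" "z \<noteq> x" and y: "adj u y" "adj x y" "\<not> adj x' y"
    and x: "adj c x" "adj c x'" "\<not> adj v x" "\<not> adj v x'" "\<And>w. w \<in> C \<Longrightarrow>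
        adj c w \<Longrightarrow> w = x \<or> w = x'"
    for x x' y z
  proof (rule ccontr)
    assume "\<not> adj v z"
    moreover have "\<not> adj c z" using x(5)[OF z(1)] z y by auto
    ultimately show False
      by - (rule armchair_free[of y u c x z v x']; use z y x uv in \<open>simp add: adj_commute\<close>)
  qed
  have "adj v z" if "z \<in> C" "adj z y1" "z \<noteq> x1" "adj u y1" for z
    using arm[OF that nb(4) far(2) nb(1,2) uv(3,4) cn] by blast
  moreover have "adj v z" if "z \<in> C" "adj z y2" "z \<noteq> x2" "adj u y2" for z
    using arm[OF that nb(6) far(1) nb(2,1) uv(4,3)] cn by blast
  ultimately show ?thesis using one both by blast
qed

text \<open>Stronger than \<open>v\<close> seeing the ring: the ring neighbours of \<open>u\<close>
  and \<open>v\<close> can be chosen adjacent, as \<open>square_off_ring\<close> requires. If the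
  neighbours of the given \<open>c\<close> fail, \<open>ring_walk\<close> finds such a pair further
  on.\<close>

lemma ring_linked:
  assumes C: "ring C" "c \<in> C" and uv: "adj u c" "adj u v"
  shows "\<exists>c\<in>C. \<exists>x\<in>C. adj u c \<and> adj c x \<and> adj v x"
proof -
  obtain x1 x2 where x: "x1 \<in> C" "x2 \<in> C" "adj c x1" "adj c x2" "x2 \<noteq> x1"
    using ring_two_neighbours[OF C] by metis
  obtain y1 where y1: "y1 \<in> C" "adj x1 y1" "y1 \<noteq> c"
    using ring_neighbours[OF C(1) x(1) C(2) adj_sym[OF x(3)]] by metis
  obtain y2 where y2: "y2 \<in> C" "adj x2 y2" "y2 \<noteq> c"
    using ring_neighbours[OF C(1) x(2) C(2) adj_sym[OF x(4)]] by metis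
  obtain z1 where z1: "z1 \<in> C" "adj y1 z1" "z1 \<noteq> x1"
    using ring_neighbours[OF C(1) y1(1) x(1) adj_sym[OF y1(2)]] by metis
  obtain z2 where z2: "z2 \<in> C" "adj y2 z2" "z2 \<noteq> x2"
    using ring_neighbours[OF C(1) y2(1) x(2) adj_sym[OF y2(2)]] by metis
  show ?thesis
  proof (cases "adj v x1 \<or> adj v x2")
    case True then show ?thesis using C x uv by blast
  next
    case False
    then have "adj u y1 \<and> adj v z1 \<or> adj u y2 \<and> adj v z2"
      using ring_walk[OF C x(1,2) y1(1) y2(1) x(3,4) not_sym[OF x(5)] y1(2,3) y2(2,3) uv]
        z1 z2 adj_sym by blast
    then show ?thesis using y1 y2 z1 z2 by blast
  qed
qed

text \<open>By \<open>ring_linked\<close>, the set of dominated vertices is closed under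
  adjacency.\<close>

lemma ring_dominating:
  assumes conn and C: "ring C" and "v \<in> V"
  shows "v \<in> C \<or> (\<exists>c\<in>C. adj v c)"
proof -
  let ?D = "{v \<in> V. v \<in> C \<or> (\<exists>c\<in>C. adj v c)}"
  have "?D = V"
  proof (rule connD[OF assms(1)])
    show "?D \<noteq> {}" using C unfolding ring_def by blast
    fix u w assume uw: "adj u w" "u \<in> ?D"
    show "w \<in> ?D"
    proof (cases "u \<in> C")
      case True then show ?thesis using uw adj_sym adj_in2 by blast
    next
      case False
      then obtain c where "c \<in> C" "adj u c" using uw by blast
      then show ?thesis using ring_linked[OF C] uw adj_in2 by blast
    qed
  qed auto
  then show ?thesis using assms(3) by blast
qed

text \<open>Take adjacent ring vertices \<open>y\<close>, \<open>x\<close> seen by \<open>a\<close>,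
  \<open>b\<close>. A ring neighbour \<open>z\<close> of \<open>a\<close> that misses
  \<open>x\<close> would be the pendant at \<open>a\<close> of a stirrer on the grid with rows
  \<open>y a b'\<close> and \<open>x b a'\<close>. Exchanging \<open>b\<close> and \<open>b'\<close>
  gives the claim for \<open>x'\<close>.\<close>

lemma square_off_ring:
  assumes C: "ring C" and sq: "adj a b" "adj a b'" "adj a' b" "adj a' b'"
    and dom: "\<exists>c\<in>C. adj a c"
    and da: "\<And>c. c \<in> C \<Longrightarrow>
        adj a c \<Longrightarrow> \<not> adj a' c" and db: "\<And>c. c \<in> C \<Longrightarrow> adj b c \<Longrightarrow> \<not> adj b' c"
  shows "\<exists>x\<in>C. \<exists>x'\<in>C. adj b x \<and>
      adj b' x' \<and> (\<forall>z\<in>C. adj a z \<longrightarrow> adj z x \<and> adj z x')"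
proof -
  have key: "adj z x" if h: "y \<in> C" "x \<in> C" "adj a y" "adj y x" "adj b x" "z \<in> C" "adj a z"
    and s: "adj a b" "adj a b'" "adj a' b" "adj a' b'" "\<not> adj b' x" for x y z b b'
  proof (rule ccontr)
    assume "\<not> adj z x"
    then show False
      by - (rule stirrer_free[of y a b' x b a' z];
          use h s da[of y] da[of z] in \<open>simp add: adj_commute\<close>)
  qed
  obtain c where c: "c \<in> C" "adj a c" using dom by blast
  obtain y x where yx: "y \<in> C" "x \<in> C" "adj a y" "adj y x" "adj b x"
    using ring_linked[OF C c sq(1)] by blast
  obtain y' x' where yx': "y' \<in> C" "x' \<in> C" "adj a y'" "adj y' x'" "adj b' x'"
    using ring_linked[OF C c sq(2)] by blast
  have "adj z x \<and> adj z x'" if "z \<in> C" "adj a z" for z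
    using key[OF yx that sq] key[OF yx' that sq(2,1,4,3)] db yx yx' by blast
  then show ?thesis using yx yx' by blast
qed

text \<open>Applied from all four corners, \<open>square_off_ring\<close> joins ring neighbours
  \<open>y\<close>, \<open>y'\<close> of \<open>a\<close>, \<open>a'\<close> to ring neighbours
  \<open>x\<close>, \<open>x'\<close> of \<open>b\<close>, \<open>b'\<close>. A ring has no 4-cycle,
  so \<open>x = x'\<close>, which \<open>b\<close> and \<open>b'\<close> would share.\<close>

lemma no_square_off_ring:
  assumes C: "ring C" and sq: "adj a b" "adj a b'" "adj a' b" "adj a' b'"
    and dom: "\<exists>c\<in>C. adj a c" "\<exists>c\<in>C. adj a' c" "\<exists>c\<in>C. adj b c" "\<exists>c\<in>C. adj b' c"
    and da: "\<And>c. c \<in> C \<Longrightarrow>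
        adj a c \<Longrightarrow> \<not> adj a' c" and db: "\<And>c. c \<in> C \<Longrightarrow> adj b c \<Longrightarrow> \<not> adj b' c"
  shows False
proof -
  have sq': "adj b a" "adj b a'" "adj b' a" "adj b' a'" using sq adj_sym by blast+
  obtain x x' where x: "x \<in> C" "x' \<in> C" "adj b x" "adj b' x'"
    and ax: "\<And>z. z \<in> C \<Longrightarrow> adj a z \<Longrightarrow> adj z x \<and> adj z x'"
    using square_off_ring[OF C sq dom(1) da db] by blast
  obtain w w' where w: "w \<in> C" "w' \<in> C" "adj b w" "adj b' w'"
    and ax': "\<And>z. z \<in> C \<Longrightarrow> adj a' z \<Longrightarrow> adj z w \<and> adj z w'"
    using square_off_ring[OF C sq(3,4,1,2) dom(2) _ db] da by blast
  obtain y y' where y: "y \<in> C" "y' \<in> C" "adj a y" "adj a' y'"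
    and bx: "\<And>z. z \<in> C \<Longrightarrow> adj b z \<Longrightarrow> adj z y \<and> adj z y'"
    using square_off_ring[OF C sq'(1,2,3,4) dom(3) db da] by blast
  obtain v v' where v: "v \<in> C" "v' \<in> C" "adj a v" "adj a' v'"
    and bx': "\<And>z. z \<in> C \<Longrightarrow> adj b' z \<Longrightarrow> adj z v \<and> adj z v'"
    using square_off_ring[OF C sq'(3,4,1,2) dom(4) _ da] db by blast
  have "y \<noteq> y'" "v \<noteq> v'" using y v da by blast+
  then have "x = w" using ring_square[OF C y(1,2) x(1) w(1)] bx[OF x(1,3)] bx[OF w(1,3)] adj_sym by blast
  moreover have "x' = w'"

        using ring_square[OF C v(1,2) x(2) w(2) \<open>v \<noteq> v'\<close>] bx'[OF x(2,4)] bx'[OF w(2,4)] adj_sym by blast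
  ultimately have "x = x'"
    using ring_square[OF C y(1,2) x(1,2) \<open>y \<noteq> y'\<close>] ax[OF y(1,3)] ax'[OF y(2,4)] by blast
  then show False using db x by blast
qed

end

text \<open>Excludes the cube minus a vertex, i.e. a 6-cycle with a vertex adjacent to every other vertex.\<close>

locale ats_cube_free = ats_free +
  assumes cube_free: "\<lbrakk>adj v a1; adj v a2; adj v a3; adj c1 a2; adj c1 a3; adj c2 a1; adj c2 a3;
    adj c3 a1; adj c3 a2; \<not> adj c1 a1; \<not> adj c2 a2; \<not> adj c3 a3\<rbrakk> \<Longrightarrow>
        False"
begin

text \<open>In a minimal counterexample each side has at most two vertices: three vertices of one
  side would have ring vertices each missing exactly one of them, and any vertex of the other side
  completes the cube minus a vertex. What remains is a square off the ring.\<close>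

lemma helly_on_ring:
  assumes C: "ring C" and dom: "\<And>v. v \<in> V \<Longrightarrow>
      v \<notin> C \<Longrightarrow> \<exists>c\<in>C. adj v c"
  shows "\<lbrakk>finite A; finite B; A \<noteq> {}; B \<noteq> {}; A \<inter> C = {}; B \<inter> C = {}; \<And>a b. a \<in> A \<Longrightarrow> b \<in> B \<Longrightarrow> adj a b\<rbrakk>
    \<Longrightarrow> (\<exists>c\<in>C. \<forall>a\<in>A. adj a c) \<or> (\<exists>c\<in>C. \<forall>b\<in>B. adj b c)"
proof (induction "card A + card B" arbitrary: A B rule: less_induct)
  case less
  note fin = less.prems(1,2) and ne = less.prems(3,4) and off = less.prems(5,6) and adj = less.prems(7)
  have small: "\<exists>a a'. A = {a, a'}"
    if no: "\<not> (\<exists>c\<in>C. \<forall>a\<in>A. adj a c)" "\<not> (\<exists>c\<in>C. \<forall>b\<in>B. adj b c)"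
      and IH: "\<And>A'. A' \<subset> A \<Longrightarrow>
          A' \<noteq> {} \<Longrightarrow> (\<exists>c\<in>C. \<forall>a\<in>A'. adj a c) \<or> (\<exists>c\<in>C. \<forall>b\<in>B. adj b c)"
      and h: "A \<noteq> {}" "B \<noteq> {}" "\<And>a b. a \<in> A \<Longrightarrow>
          b \<in> B \<Longrightarrow> adj a b" for A B
  proof (rule ccontr)
    assume "\<not> ?thesis"
    then have big: "\<not> A \<subseteq> {a, a'}" if "a \<in> A" "a' \<in> A" for a a' using that by blast
    obtain a1 where a1: "a1 \<in> A" using h(1) by blast
    obtain a2 where a2: "a2 \<in> A" "a2 \<noteq> a1" using big[OF a1 a1] by blast
    obtain a3 where a3: "a3 \<in> A" "a3 \<noteq> a1" "a3 \<noteq> a2" using big[OF a1 a2(1)] by blast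
    have miss: "\<exists>c\<in>C. \<not> adj c a \<and> (\<forall>x\<in>A - {a}. adj c x)"
        if "a \<in> A" for a
    proof -
      have "A - {a} \<noteq> {}" "A - {a} \<subset> A" using big[OF that that] that by blast+
      then have "\<exists>c\<in>C. \<forall>x\<in>A - {a}. adj x c" using IH[of "A - {a}"] no(2) by simp
      then obtain c where c: "c \<in> C" "\<forall>x\<in>A - {a}. adj x c" ..
      have "\<not> adj a c"
      proof
        assume "adj a c"
        then have "adj x c" if "x \<in> A" for x using c(2) that by (cases "x = a") simp_all
        then show False using no(1) c(1) by blast
      qed
      then show ?thesis using c adj_sym by blast
    qed
    obtain b where "b \<in> B" using h(2) by blast
    then have b: "adj b a1" "adj b a2" "adj b a3" using h(3) a1 a2 a3 adj_sym by blast+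
    obtain c1 where c1: "\<not> adj c1 a1" "adj c1 a2" "adj c1 a3" using miss[OF a1] a2 a3 by blast
    obtain c2 where c2: "\<not> adj c2 a2" "adj c2 a1" "adj c2 a3" using miss[OF a2(1)] a1 a2 a3 by blast
    obtain c3 where c3: "\<not> adj c3 a3" "adj c3 a1" "adj c3 a2" using miss[OF a3(1)] a1 a2 a3 by blast
    show False
      by (rule cube_free[OF b c1(2,3) c2(2,3) c3(2,3) c1(1) c2(1) c3(1)])
  qed
  show ?case
  proof (rule ccontr)
    assume no: "\<not> ?thesis"
    have "\<exists>a a'. A = {a, a'}"
    proof (rule small[of A B])
      fix A' assume A': "A' \<subset> A" "A' \<noteq> {}"
      then have "card A' < card A" using fin psubset_card_mono by blast
      then show "(\<exists>c\<in>C. \<forall>a\<in>A'. adj a c) \<or> (\<exists>c\<in>C. \<forall>b\<in>B. adj b c)"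
        by (intro less.hyps) (use A' fin ne off adj finite_subset[of A' A] in auto)
    qed (use no ne adj in blast)+
    then obtain a a' where A: "A = {a, a'}" by blast
    have "\<exists>b b'. B = {b, b'}"
    proof (rule small[of B A])
      fix B' assume B': "B' \<subset> B" "B' \<noteq> {}"
      then have "card B' < card B" using fin psubset_card_mono by blast
      then have "(\<exists>c\<in>C. \<forall>a\<in>A. adj a c) \<or> (\<exists>c\<in>C. \<forall>b\<in>B'. adj b c)"
        by (intro less.hyps) (use B' fin ne off adj finite_subset[of B' B] in auto)
      then show "(\<exists>c\<in>C. \<forall>b\<in>B'. adj b c) \<or> (\<exists>c\<in>C. \<forall>a\<in>A. adj a c)" by blast
    qed (use no ne adj adj_sym in blast)+
    then obtain b b' where B: "B = {b, b'}" by blast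
    have sq: "adj a b" "adj a b'" "adj a' b" "adj a' b'" using adj A B by blast+
    have dom': "\<exists>c\<in>C. adj v c" if "v \<in> {a, a', b, b'}" for v
    proof (rule dom)
      show "v \<in> V" using that sq adj_in adj_in2 by auto
      show "v \<notin> C" using that off A B by auto
    qed
    have da: "\<not> adj a' c" if "c \<in> C" "adj a c" for c using no A that by auto
    have db: "\<not> adj b' c" if "c \<in> C" "adj b c" for c using no B that by auto
    show False
      by (rule no_square_off_ring[OF C sq dom' dom' dom' dom' da db]) simp_all
  qed
qed

text \<open>On a ring avoiding \<open>A\<close>, the Helly property yields a vertex \<open>y\<close>
  in \<open>S\<close>, because \<open>A\<close> and \<open>S\<close> are each other's common
  neighbours. Around \<open>y\<close> the ring then conflicts with the maximality of the trace
  \<open>B\<close>.\<close>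

lemma ring_meets_closed_biclique:
  assumes conn and C: "ring C"
    and A: "A = {v. \<forall>s\<in>S. adj v s}" "A \<noteq> {}" and S: "S = {s. \<forall>a\<in>A. adj a s}" "S \<noteq> {}"
    and B: "B \<subseteq> S" "B = {} \<or> (\<exists>x. x \<notin> A \<and> B = {s \<in> S. adj x s})"
    and max: "\<And>x. x \<in> V \<Longrightarrow>
        x \<notin> A \<Longrightarrow> card {s \<in> S. adj x s} \<le> card B"
  shows "C \<inter> (A \<union> B) \<noteq> {}"
proof
  assume "C \<inter> (A \<union> B) = {}"
  then have offA: "c \<notin> A" and offB: "c \<notin> B" if "c \<in> C" for c using that by auto
  have AS: "adj a s" if "a \<in> A" "s \<in> S" for a s using A(1) that by blast
  have CV: "C \<subseteq> V" using C by (simp add: ring_def)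
  have sub: "A \<subseteq> V" "S \<subseteq> V" using A(2) S(2) AS adj_in adj_in2 by blast+
  have fin: "finite A" "finite S" using sub finite_subset[OF _ finite_V] by simp_all
  obtain a where a: "a \<in> A" using A(2) by blast
  \<comment> \<open>Each of \<open>x1\<close>, \<open>x2\<close> misses something in
    \<open>B\<close>, since otherwise its trace would contain \<open>insert y B\<close>. If together
    they covered \<open>B\<close>, the centre \<open>a\<close>, its neighbours \<open>b\<close>,
    \<open>b'\<close>, \<open>y\<close> and the vertices \<open>x1\<close>, \<open>x2\<close>,
    \<open>x0\<close>, each missing one of these, would form the cube minus a vertex;
    \<open>x0\<close> is a vertex with trace \<open>B\<close>.\<close>
  have good: False
    if y: "y \<in> C" "y \<in> S" and x: "x1 \<in> C" "x2 \<in> C" "adj y x1" "adj y x2"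
      and cover: "\<And>b. b \<in> B \<Longrightarrow> adj b x1 \<or> adj b x2" for y x1 x2
  proof -
    have miss: "\<exists>b\<in>B. \<not> adj x b" if "x \<in> C" "adj y x" for x
    proof (rule ccontr)
      assume "\<not> ?thesis"
      then have "insert y B \<subseteq> {s \<in> S. adj x s}" using B(1) y(2) adj_sym[OF that(2)] by auto
      then have "card (insert y B) \<le> card {s \<in> S. adj x s}" using fin(2) by (intro card_mono) auto
      also have "\<dots> \<le> card B" using that offA CV by (intro max) auto
      finally show False using offB[OF y(1)] finite_subset[OF B(1) fin(2)] by simp
    qed
    obtain b where b: "b \<in> B" "\<not> adj x1 b" using miss[OF x(1,3)] by blast
    obtain b' where b': "b' \<in> B" "\<not> adj x2 b'" using miss[OF x(2,4)] by blast
    obtain x0 where x0: "B = {s \<in> S. adj x0 s}" using B(2) b(1) by blast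
    have 1: "adj a b" "adj a b'" "adj a y" using AS[OF a] B(1) b b' y by blast+
    have 2: "adj x1 b'" "adj x1 y" "adj x2 b" "adj x2 y" using cover b b' x adj_sym by blast+
    have 3: "adj x0 b" "adj x0 b'" "\<not> adj x0 y" using x0 b b' y offB by blast+
    show False by (rule cube_free[OF 1 2 3(1,2) b(2) b'(2) 3(3)])
  qed
  \<comment> \<open>Now the ring vertex \<open>y1\<close> is in \<open>S\<close> too. As
    \<open>b\<close> sees \<open>z1\<close> but not \<open>x1\<close>, a vertex \<open>b'\<close> of
    \<open>B\<close> missing both would be the pendant at \<open>a\<close> of a stirrer; so
    \<open>x1\<close>, \<open>z1\<close> cover \<open>B\<close> and \<open>good\<close> applies at
    \<open>y1\<close>.\<close>
  have shift: False
    if y: "y \<in> C" "y \<in> S" and y1: "y1 \<in> C" "y1 \<in> S" "y1 \<noteq> y" and x1: "x1 \<in> C" "adj y x1" "adj x1 y1"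
      and z1: "z1 \<in> C" "adj y1 z1" "\<not> adj y z1" and b: "b \<in> B" "\<not> adj b x1" "adj b z1" for y y1 x1 z1 b
  proof (rule good[OF y1(1,2) x1(1) z1(1) adj_sym[OF x1(3)] z1(2)], rule ccontr)
    fix b' assume b': "b' \<in> B" "\<not> (adj b' x1 \<or> adj b' z1)"
    have "adj a y" "adj a y1" "adj a b" "adj a b'" using AS[OF a] y y1 b b' B(1) by blast+
    then show False
      by - (rule stirrer_free[of y a b x1 y1 z1 b'];
          use y y1 x1 z1 b b' in \<open>simp add: adj_commute\<close>)
  qed
  obtain y where y: "y \<in> C" "y \<in> S"
  proof (cases "S \<inter> C = {}")
    case True
    have dom: "\<exists>c\<in>C. adj v c" if "v \<in> V" "v \<notin> C" for v
      using ring_dominating[OF assms(1) C] that by blast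
    have "(\<exists>c\<in>C. \<forall>a\<in>A. adj a c) \<or> (\<exists>c\<in>C. \<forall>s\<in>S. adj s c)"
      by (rule helly_on_ring[OF C dom fin A(2) S(2) _ True AS]) (use offA in auto)
    then show thesis
    proof
      assume "\<exists>c\<in>C. \<forall>a\<in>A. adj a c"
      then show thesis using that S(1) by blast
    next
      assume "\<exists>c\<in>C. \<forall>s\<in>S. adj s c"
      then have "\<exists>c\<in>C. c \<in> A" using A(1) adj_sym by blast
      then show thesis using offA by blast
    qed
  qed (use that in blast)
  obtain x1 x2 where x: "x1 \<in> C" "x2 \<in> C" "adj y x1" "adj y x2" "x2 \<noteq> x1"
    and yx: "\<And>w. w \<in> C \<Longrightarrow> adj y w \<Longrightarrow> w = x1 \<or> w = x2"
    by (rule ring_two_neighbours[OF C y(1)]) (rule that)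
  obtain b where b: "b \<in> B" "\<not> adj b x1" "\<not> adj b x2" using good[OF y x(1-4)] by blast
  obtain y1 where y1: "y1 \<in> C" "adj x1 y1" "y1 \<noteq> y"
    and x1y: "\<And>w. w \<in> C \<Longrightarrow> adj x1 w \<Longrightarrow> w = y \<or> w = y1"
    by (rule ring_neighbours[OF C x(1) y(1) adj_sym[OF x(3)]]) (rule that)
  obtain y2 where y2: "y2 \<in> C" "adj x2 y2" "y2 \<noteq> y"
    and x2y: "\<And>w. w \<in> C \<Longrightarrow> adj x2 w \<Longrightarrow> w = y \<or> w = y2"
    by (rule ring_neighbours[OF C x(2) y(1) adj_sym[OF x(4)]]) (rule that)
  have "y1 \<noteq> y2"
    using ring_square[OF C x(1,2) y(1) y1(1) not_sym[OF x(5)]] x y1 y2 adj_sym by blast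
  obtain z1 where z1: "z1 \<in> C" "adj y1 z1" "z1 \<noteq> x1"
    and y1z: "\<And>w. w \<in> C \<Longrightarrow> adj y1 w \<Longrightarrow> w = x1 \<or> w = z1"
    by (rule ring_neighbours[OF C y1(1) x(1) adj_sym[OF y1(2)]]) (rule that)
  obtain z2 where z2: "z2 \<in> C" "adj y2 z2" "z2 \<noteq> x2"
    and y2z: "\<And>w. w \<in> C \<Longrightarrow> adj y2 w \<Longrightarrow> w = x2 \<or> w = z2"
    by (rule ring_neighbours[OF C y2(1) x(2) adj_sym[OF y2(2)]]) (rule that)
  have yz: "\<not> adj y z1" "\<not> adj y z2"

        using yx[OF z1(1)] yx[OF z2(1)] x2y[OF y1(1)] x1y[OF y2(1)] z1 z2 y1 y2 \<open>y1 \<noteq> y2\<close> adj_sym by metis+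
  have b': "adj a' b" if "a' \<in> A" for a' using AS[OF that] B(1) b(1) by blast
  \<comment> \<open>Each vertex of \<open>A\<close> goes to exactly one side of \<open>y\<close>. If
    both sides occur, a cube minus a vertex or a stirrer appears; if all go the same way, the ring
    vertex there lies in \<open>S\<close> and \<open>shift\<close> applies.\<close>
  have walk: "adj a' y1 \<and> \<not> adj a' y2 \<and> adj b z1 \<or> adj a' y2 \<and> \<not> adj a' y1 \<and> adj b z2"
      if "a' \<in> A" for a'
    using ring_walk[OF C y(1) x(1,2) y1(1) y2(1) x(3,4) not_sym[OF x(5)] y1(2,3) y2(2,3)
        AS[OF that y(2)] b'[OF that] b(2,3)] z1 z2 adj_sym by blast
  show False
  proof (cases "\<exists>a1\<in>A. \<exists>a2\<in>A. adj a1 y1 \<and> adj a2 y2")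
    case True
    then obtain a1 a2 where a: "a1 \<in> A" "a2 \<in> A" "adj a1 y1" "adj a2 y2" by blast
    then have n: "\<not> adj a1 y2" "\<not> adj a2 y1" "adj b z1" "adj b z2" using walk by blast+
    have ay: "adj a1 y" "adj a2 y" "adj a1 b" "adj a2 b" using AS y b' a by blast+
    show False
    \<comment> \<open>Equality means that the ring closes up after six vertices.\<close>
    proof (cases "z1 = z2")
      case True
      show False
        by (rule cube_free[of b a1 a2 z1 y2 y1 y];
            use True n a ay z1 z2 yz in \<open>simp add: adj_commute\<close>)
    next
      case False
      have "\<not> adj y1 z2"
        using y1z[OF z2(1)] False x1y[OF y2(1)] z2 y2 \<open>y1 \<noteq> y2\<close> adj_sym by metis
      then show False
        by - (rule stirrer_free[of z1 b a2 y1 a1 y z2];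
            use n a ay z1 z2 yz in \<open>simp add: adj_commute\<close>)
    qed
  next
    case False
    then consider "\<forall>a\<in>A. adj a y1 \<and>
        adj b z1" | "\<forall>a\<in>A. adj a y2 \<and> adj b z2" using walk by blast
    then show False
    proof cases
      case 1
      then have "y1 \<in> S" "adj b z1" using S(1) a by blast+
      then show False using shift[OF y y1(1) _ y1(3) x(1,3) y1(2) z1(1,2) yz(1) b(1,2)] by blast
    next
      case 2
      then have "y2 \<in> S" "adj b z2" using S(1) a by blast+
      then show False using shift[OF y y2(1) _ y2(3) x(2,4) y2(2) z2(1,2) yz(2) b(1,3)] by blast
    qed
  qed
qed

text \<open>More than \<open>d\<close> common neighbours force \<open>card A \<le> d\<close>. A
  vertex outside \<open>A\<close> with more than \<open>d\<close> neighbours among them would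
  enlarge \<open>A\<close>; this bounds all traces by \<open>d\<close> and also shows that
  \<open>A\<close> is closed.\<close>

lemma ring_hitting_set:
  assumes conn "ring C0" and free: "biclique_free d adj"
  shows "\<exists>S\<subseteq>V. card S \<le> 2 * d \<and>
      (\<forall>C. ring C \<longrightarrow> C \<inter> S \<noteq> {})"
proof -
  have hit: ?thesis
    if A: "A = {v. \<forall>s\<in>S. adj v s}" "A \<noteq> {}" and S: "S = {s. \<forall>a\<in>A. adj a s}" "S \<noteq> {}"
      and d: "card A \<le> d" "\<And>x. x \<in> V \<Longrightarrow>
          x \<notin> A \<Longrightarrow> card {s \<in> S. adj x s} \<le> d" for A S
  proof -
    have AS: "adj a s" if "a \<in> A" "s \<in> S" for a s using A(1) that by blast
    have sub: "A \<subseteq> V" "S \<subseteq> V" using A(2) S(2) AS adj_in adj_in2 by blast+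
    have "\<exists>B\<subseteq>S. (B = {} \<or> (\<exists>x. x \<notin> A \<and>
        B = {s \<in> S. adj x s})) \<and> card B \<le> d \<and>
      (\<forall>x\<in>V. x \<notin> A \<longrightarrow> card {s \<in> S. adj x s} \<le> card B)"
    proof (cases "V \<subseteq> A")
      case True then show ?thesis by (intro exI[of _ "{}"]) auto
    next
      case False
      let ?N = "\<lambda>x. card {s \<in> S. adj x s}"
      have "finite (?N ` (V - A))" "?N ` (V - A) \<noteq> {}" using finite_V False by auto
      from Max_in[OF this] obtain x where x: "x \<in> V - A" "Max (?N ` (V - A)) = ?N x" by auto
      have "?N z \<le> ?N x" if "z \<in> V - A" for z
        using Max_ge[OF \<open>finite (?N ` (V - A))\<close>, of "?N z"] that x by auto
      then show ?thesis using x d(2)[of x] by (intro exI[of _ "{s \<in> S. adj x s}"]) auto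
    qed
    then obtain B where B: "B \<subseteq> S" "B = {} \<or> (\<exists>x. x \<notin> A \<and>
        B = {s \<in> S. adj x s})" "card B \<le> d"
      "\<And>x. x \<in> V \<Longrightarrow> x \<notin> A \<Longrightarrow>
          card {s \<in> S. adj x s} \<le> card B" by blast
    have "C \<inter> (A \<union> B) \<noteq> {}" if "ring C" for C
      by (rule ring_meets_closed_biclique[OF assms(1) that A S B(1,2,4)])
    moreover have "card (A \<union> B) \<le> 2 * d" using card_Un_le[of A B] d(1) B(3) by linarith
    moreover have "A \<union> B \<subseteq> V" using sub B(1) by blast
    ultimately show ?thesis by blast
  qed
  define common where "common A = {s. \<forall>a\<in>A. adj a s}" for A
  have fin: "finite {s. adj v s}" for v
    by (rule finite_subset[OF _ finite_V]) (use adj_in2 in auto)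
  have finc: "finite (common A)" if ne: "A \<noteq> {}" for A
  proof -
    obtain a where "a \<in> A" using ne by blast
    then have "common A \<subseteq> {s. adj a s}" by (auto simp: common_def)
    then show ?thesis using fin finite_subset by blast
  qed
  show ?thesis
  proof (cases "\<exists>v\<in>V. card {s. adj v s} > d")
    case True
    then obtain v where v: "v \<in> V" "card {s. adj v s} > d" by blast
    define P where "P A \<longleftrightarrow> A \<subseteq> V \<and>
        A \<noteq> {} \<and> card (common A) > d" for A
    have P: "P {v}" using v by (auto simp: P_def common_def)
    have "\<forall>A. P A \<longrightarrow> card A < Suc (card V)" by (simp add: P_def card_mono[OF finite_V] less_Suc_eq_le)
    from ex_has_greatest_nat[of P, OF P this]
    obtain A where A: "P A" and A_max: "\<And>A'. P A' \<Longrightarrow> card A' \<le> card A" by auto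
    have sub: "A \<subseteq> V" and ne: "A \<noteq> {}" and big: "card (common A) > d"
        using A by (auto simp: P_def)
    have finA: "finite A" using sub finite_V by (rule finite_subset)
    have extend: "x \<in> A" if x: "x \<in> V" "card {s \<in> common A. adj x s} > d" for x
    proof (rule ccontr)
      assume "x \<notin> A"
      moreover have "common (insert x A) = {s \<in> common A. adj x s}" by (auto simp: common_def)
      then have "P (insert x A)" using x sub by (simp add: P_def)
      ultimately show False using A_max[of "insert x A"] finA by simp
    qed
    have closed: "A = {v. \<forall>s\<in>common A. adj v s}"
    proof
      show "{v. \<forall>s\<in>common A. adj v s} \<subseteq> A"
      proof
        fix x assume "x \<in> {v. \<forall>s\<in>common A. adj v s}"
        then have x: "adj x s" if "s \<in> common A" for s using that by blast
        have "common A \<noteq> {}" using big by auto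
        then have "x \<in> V" using x adj_in by blast
        moreover have "{s \<in> common A. adj x s} = common A" using x by blast
        ultimately show "x \<in> A" using extend[of x] big by simp
      qed
    qed (auto simp: common_def)
    have "card A \<le> d"
      using biclique_freeD[OF free finA finc[OF ne]] big by (force simp: common_def)
    then show ?thesis
      using hit[OF closed ne common_def _ _] big extend by (metis card.empty not_less0 not_le)
  next
    case False
    have deg: "card {s. adj v s} \<le> d" for v
    proof (cases "v \<in> V")
      case True then show ?thesis using False by auto
    next
      case False
      then have "{s. adj v s} = {}" using adj_in by blast
      then show ?thesis by simp
    qed
    obtain v s where vs: "adj v s" using assms(2) unfolding ring_def by blast
    define S where "S = {s. adj v s}"
    define A where "A = {v. \<forall>s\<in>S. adj v s}"
    have "v \<in> A" "s \<in> S" using vs by (auto simp: A_def S_def)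
    moreover have "S = {s. \<forall>a\<in>A. adj a s}"
        using \<open>v \<in> A\<close> by (auto simp: A_def S_def)
    moreover have "card A \<le> d"
    proof -
      have "A \<subseteq> {a. adj s a}" using \<open>s \<in> S\<close> adj_sym by (auto simp: A_def)
      then show ?thesis using card_mono[OF fin] deg[of s] le_trans by blast
    qed
    moreover have "card {s \<in> S. adj x s} \<le> d" for x
    proof -
      have "card {s \<in> S. adj x s} \<le> card {s. adj x s}" using fin by (intro card_mono) auto
      then show ?thesis using deg[of x] by linarith
    qed
    ultimately show ?thesis using hit[OF A_def] by blast
  qed
qed

lemma interval_model_if_cube_free:
  assumes conn and free: "biclique_free d adj" and d: "d \<ge> 1"
  shows "interval_model V adj (4 * d)"
proof (cases "\<exists>C. ring C")
  case False
  then show ?thesis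
    using interval_model_if_no_ring[OF _ free d] interval_model_mono[of V adj "2 * d" "4 * d"] by simp
next
  case True
  then obtain C0 where "ring C0" by blast
  from ring_hitting_set[OF assms(1) this free]
  obtain S where S: "S \<subseteq> V" "card S \<le> 2 * d" "\<And>C. ring C \<Longrightarrow>
      C \<inter> S \<noteq> {}" by auto
  interpret W: ats_free "V - S" "induced adj (V - S)" col by (rule ats_free_induced) blast
  have "interval_model (V - S) (induced adj (V - S)) (2 * d)"
  proof (rule W.interval_model_if_no_ring[OF _ biclique_free_induced[OF free] d])
    fix C show "\<not> W.ring C" using ring_induced[of "V - S" C] S(3)[of C] by blast
  qed
  then have "interval_model V adj (2 * d + 2 * d)"
    by (rule interval_model_add_set[OF finite_V S(1) _ S(2)]) (use adj_in adj_in2 in blast)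
  then show ?thesis by simp
qed

end

section \<open>Vertex covers from a chain graph\<close>

context ats_free
begin

text \<open>Vertices of \<open>X \<inter> K\<close> are split at degree \<open>d\<close> inside
  \<open>K\<close>. Those of high degree, \<open>R\<close>, are complete to the smallest of their
  nested neighbourhoods, and so is \<open>X - K\<close>; as that neighbourhood exceeds
  \<open>d\<close>, \<open>R\<close> and \<open>X - K\<close> together have at most \<open>d\<close>
  vertices. The neighbourhoods of low degree are nested inside one set \<open>M\<close> of size at
  most \<open>d\<close>, and \<open>Y - K\<close> is the third summand.\<close>

lemma chain_vertex_cover:
  assumes X: "X = {x \<in> V. col x = b}" and Y: "Y = {y \<in> V. col y \<noteq> b}"
    and complete: "\<And>x y. x \<in> X \<Longrightarrow>
        y \<in> Y \<Longrightarrow> x \<in> K \<longleftrightarrow> y \<notin> K \<Longrightarrow> adj x y"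
    and chain: "\<And>x y x' y'. \<lbrakk>x \<in> X \<inter> K; x' \<in> X \<inter> K; y \<in> Y \<inter> K; y' \<in> Y \<inter> K; adj x y; adj x' y';
      \<not> adj x y'; \<not> adj x' y\<rbrakk> \<Longrightarrow> False"
    and free: "biclique_free d adj" and rest: "card (X - K) \<le> d" "card (Y - K) \<le> d"
  shows "\<exists>S\<subseteq>V. card S \<le> 3 * d \<and>
      (\<forall>u v. adj u v \<longrightarrow> u \<in> S \<or> v \<in> S)"
proof -
  define N where "N x = {y \<in> Y \<inter> K. adj x y}" for x
  define R where "R = {x \<in> X \<inter> K. d < card (N x)}"
  define Q where "Q = {x \<in> X \<inter> K. card (N x) \<le> d}"
  have finXY: "finite X" "finite Y" using finite_V by (auto simp: X Y)
  have finN: "finite (N x)" for x using finXY by (simp add: N_def)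
  have nested: "N x \<subseteq> N x'"
      if "x \<in> X \<inter> K" "x' \<in> X \<inter> K" "card (N x) \<le> card (N x')" for x x'
  proof (rule ccontr)
    assume "\<not> N x \<subseteq> N x'"
    then obtain y where y: "y \<in> N x" "y \<notin> N x'" by blast
    have "\<not> N x' \<subseteq> N x"
      using y card_seteq[OF finN[of x], of "N x'"] that(3) by blast
    then obtain y' where "y' \<in> N x'" "y' \<notin> N x" by blast
    then show False using chain[OF that(1,2), of y y'] y by (auto simp: N_def)
  qed
  have R: "card (R \<union> (X - K)) \<le> d"
  proof (cases "R = {}")
    case True then show ?thesis using rest by simp
  next
    case False
    then obtain r0 where "r0 \<in> R" by blast
    from ex_has_least_nat[of "\<lambda>x. x \<in> R", OF this, of "\<lambda>x. card (N x)"]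
    obtain r where r: "r \<in> R" "\<And>x. x \<in> R \<Longrightarrow> card (N r) \<le> card (N x)" by blast
    have "card (R \<union> (X - K)) \<le> d \<or> card (N r) \<le> d"
    proof (rule biclique_freeD[OF free])
      show "finite (R \<union> (X - K))" using finXY by (simp add: R_def)
      fix a b assume a: "a \<in> R \<union> (X - K)" and b: "b \<in> N r"
      show "adj a b"
      proof (cases "a \<in> K")
        case True
        then have "a \<in> R" using a by blast
        then have "N r \<subseteq> N a" using nested[of r a] r by (auto simp: R_def)
        then show ?thesis using b by (auto simp: N_def)
      next
        case False
        then show ?thesis using complete[of a b] a b by (auto simp: N_def R_def)
      qed
    qed (rule finN)
    then show ?thesis using r(1) by (auto simp: R_def)
  qed
  obtain M where M: "card M \<le> d" "M \<subseteq> Y" "\<And>x. x \<in> Q \<Longrightarrow>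
      N x \<subseteq> M"
  proof (cases "Q = {}")
    case True then show thesis using that[of "{}"] by simp
  next
    case False
    then have "finite ((\<lambda>x. card (N x)) ` Q)" "(\<lambda>x. card (N x)) ` Q \<noteq> {}"
      using finXY by (auto simp: Q_def)
    from Max_in[OF this] obtain x where x: "x \<in> Q" "Max ((\<lambda>x. card (N x)) ` Q) = card (N x)" by auto
    have "card (N z) \<le> card (N x)" if "z \<in> Q" for z
      using Max_ge[OF \<open>finite ((\<lambda>x. card (N x)) ` Q)\<close>, of "card (N z)"] that x by auto
    then have "N z \<subseteq> N x" if "z \<in> Q" for z using nested[of z x] x(1) that by (auto simp: Q_def)
    then show thesis using that[of "N x"] x(1) by (auto simp: Q_def N_def)
  qed
  let ?S = "(R \<union> (X - K)) \<union> (Y - K) \<union> M"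
  have "card ?S \<le> card (R \<union> (X - K)) + card (Y - K) + card M"
    by (meson add_le_mono card_Un_le le_trans order_refl)
  then have "card ?S \<le> 3 * d" using R rest(2) M(1) by linarith
  moreover have "?S \<subseteq> V" using M(2) by (auto simp: R_def X Y)
  moreover have cover: "x \<in> ?S \<or> y \<in> ?S" if "adj x y" "x \<in> X" "y \<in> Y" for x y
  proof (cases "x \<in> Q \<and> y \<in> K")
    case True
    then have "y \<in> N x" using that by (simp add: N_def)
    then show ?thesis using M(3) True by blast
  next
    case False
    then show ?thesis using that(2,3) by (auto simp: Q_def R_def)
  qed
  have "u \<in> ?S \<or> v \<in> ?S" if uv: "adj u v" for u v
  proof (cases "col u = b")
    case True
    then have "u \<in> X" "v \<in> Y" using uv adj_in adj_in2 adj_col[OF uv] by (auto simp: X Y)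
    then show ?thesis using cover uv by blast
  next
    case False
    then have "v \<in> X" "u \<in> Y" using uv adj_in adj_in2 adj_col[OF uv] by (auto simp: X Y)
    then show ?thesis using cover adj_sym[OF uv] by blast
  qed
  ultimately show ?thesis by blast
qed

end

section \<open>The cube minus a vertex\<close>

text \<open>
  The cube minus a vertex: the 6-cycle of the \<open>p i\<close> and \<open>q i\<close> together with the vertex \<open>v\<close>
  adjacent to all \<open>q i\<close>. In the bipartite complement the pairs \<open>p i, q i\<close> are edges of three
  different components, each of which spans a chain graph.
\<close>

locale ats_cube = ats_free +
  fixes v :: 'a and p q :: "nat \<Rightarrow> 'a"
  assumes connected: conn
    and vq: "i < 3 \<Longrightarrow> adj v (q i)"
    and pq: "i < 3 \<Longrightarrow> j < 3 \<Longrightarrow>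
        adj (p i) (q j) \<longleftrightarrow> i \<noteq> j"
begin

lemma third:
  fixes i j :: nat
  assumes "i < 3" "j < 3"
  obtains k where "k < 3" "k \<noteq> i" "k \<noteq> j"
proof -
  have "(0 \<noteq> i \<and> 0 \<noteq> j) \<or> (1 \<noteq> i \<and>
      1 \<noteq> j) \<or> (2 \<noteq> i \<and> 2 \<noteq> j)" by linarith
  then show thesis using that[of 0] that[of 1] that[of 2] by auto
qed

lemma third_unique: "i < 3 \<Longrightarrow> j < 3 \<Longrightarrow>
    k < 3 \<Longrightarrow> l < 3 \<Longrightarrow> i \<noteq> j \<Longrightarrow> k \<noteq> i \<Longrightarrow> k \<noteq> j \<Longrightarrow> l \<noteq> i \<Longrightarrow> l \<noteq> j \<Longrightarrow> k = (l::nat)"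
  by linarith

lemma qp: "i < 3 \<Longrightarrow> j < 3 \<Longrightarrow> adj (q i) (p j) \<longleftrightarrow> i \<noteq> j"
  using pq adj_commute by metis

lemma col_q: "i < 3 \<Longrightarrow> col (q i) \<noteq> col v"
  using adj_col[OF vq] by blast

lemma col_p: "i < 3 \<Longrightarrow> col (p i) = col v"
proof -
  assume i: "i < 3"
  obtain k where k: "k < 3" "k \<noteq> i" using third[OF i i] by blast
  then have "adj (p i) (q k)" using pq i by blast
  then show ?thesis using adj_col col_q[OF k(1)] by blast
qed

lemma p_in: "i < 3 \<Longrightarrow> p i \<in> V"
  using third[of i i] pq adj_in by metis

lemma q_in: "i < 3 \<Longrightarrow> q i \<in> V"
  using vq adj_in2 by blast

text \<open>Needed because, as a ring, this hexagon dominates the graph.\<close>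

lemma ring_pq: "ring (p ` {..<3} \<union> q ` {..<3})"
proof -
  let ?C = "p ` {..<3} \<union> q ` {..<3}"
  have np: "\<not> adj (p i) (p j)" "\<not> adj (q i) (q j)" if "i < 3" "j < 3" for i j
    using not_adj_same col_p col_q that by metis+
  have deg: "\<exists>a b. a \<noteq> b \<and> {w \<in> ?C. adj u w} = {a, b}" if u: "u \<in> ?C" for u
  proof -
    obtain i where i: "i < 3" "u = p i \<or> u = q i" using u by blast
    obtain j where j: "j < 3" "j \<noteq> i" using third[OF i(1) i(1)] by blast
    obtain k where k: "k < 3" "k \<noteq> i" "k \<noteq> j" using third[OF i(1) j(1)] by blast
    have idx: "l = i \<or> l = j \<or> l = k"
        if "l < 3" for l using third_unique[OF i(1) j(1) that k(1)] j k by blast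
    have ne: "p j \<noteq> p k" "q j \<noteq> q k"
        using pq[OF j(1) j(1)] pq[OF k(1) j(1)] pq[OF k(1) k(1)] k(3) by metis+
    from i(2) show ?thesis
    proof
      assume u: "u = p i"
      have "{w \<in> ?C. adj u w} = {q j, q k}"
      proof (intro equalityI subsetI)
        fix w assume "w \<in> {w \<in> ?C. adj u w}"
        then obtain l where "l < 3" "w = q l" "l \<noteq> i" using np pq i(1) u by auto
        then show "w \<in> {q j, q k}" using idx by blast
      qed (use u i j k pq in auto)
      then show ?thesis using ne by blast
    next
      assume u: "u = q i"
      have "{w \<in> ?C. adj u w} = {p j, p k}"
      proof (intro equalityI subsetI)
        fix w assume "w \<in> {w \<in> ?C. adj u w}"
        then obtain l where "l < 3" "w = p l" "l \<noteq> i" using np qp i(1) u by auto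
        then show "w \<in> {p j, p k}" using idx by blast
      qed (use u i j k qp in auto)
      then show ?thesis using ne by blast
    qed
  qed
  have "a = b" if h: "x \<in> ?C" "y \<in> ?C" "a \<in> ?C" "b \<in> ?C" "x \<noteq> y" "adj x a" "adj x b" "adj y a" "adj y b"
    for x y a b
  proof -
    obtain i where i: "i < 3" "x = p i \<or> x = q i" using h(1) by blast
    obtain j where j: "j < 3" "y = p j \<or> y = q j" using h(2) by blast
    obtain k where k: "k < 3" "a = p k \<or> a = q k" using h(3) by blast
    obtain l where l: "l < 3" "b = p l \<or> b = q l" using h(4) by blast
    consider "x = p i" "y = p j" "a = q k" "b = q l" | "x = q i" "y = q j" "a = p k" "b = p l"
      using i j k l h(6-9) np by blast
    then show ?thesis
    proof cases
      case 1
      then have "i \<noteq> j" "k \<noteq> i" "k \<noteq> j" "l \<noteq> i" "l \<noteq> j"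
          using h(5-9) pq i(1) j(1) k(1) l(1) by auto
      then show ?thesis using third_unique[OF i(1) j(1) k(1) l(1)] 1 by blast
    next
      case 2
      then have "i \<noteq> j" "k \<noteq> i" "k \<noteq> j" "l \<noteq> i" "l \<noteq> j"
          using h(5-9) qp i(1) j(1) k(1) l(1) by auto
      then show ?thesis using third_unique[OF i(1) j(1) k(1) l(1)] 2 by blast
    qed
  qed
  then have "square_free ?C" by (rule square_freeI)
  moreover have "?C \<subseteq> V" using p_in q_in by auto
  moreover have "p 0 \<in> ?C" by simp
  ultimately show ?thesis unfolding ring_def using deg by blast
qed

text \<open>By domination, a vertex missing two of the \<open>q\<close> sees the third,
  \<open>q k\<close>. It is then the pendant at \<open>q k\<close> of the grid with rows
  \<open>p j, q k, p i\<close> and \<open>q i, v, q j\<close>, a stirrer.\<close>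

lemma miss_q:
  assumes x: "x \<in> V" "col x = col v" and ij: "i < 3" "j < 3" "\<not> adj x (q i)" "\<not> adj x (q j)"
  shows "i = j"
proof (rule ccontr)
  assume ne: "i \<noteq> j"
  obtain k where k: "k < 3" "k \<noteq> i" "k \<noteq> j" using third[OF ij(1,2)] by blast
  have "adj x (q k)"
  proof (cases "x \<in> p ` {..<3} \<union> q ` {..<3}")
    case True
    then obtain m where "m < 3" "x = p m" using x(2) col_q by auto
    then show ?thesis using pq ij k ne by auto
  next
    case False
    then obtain c where c: "c \<in> p ` {..<3} \<union> q ` {..<3}" "adj x c"
      using ring_dominating[OF connected ring_pq x(1)] by blast
    then obtain m where m: "m < 3" "c = q m" using x(2) col_p adj_col[OF c(2)] by auto
    then have "m \<noteq> i" "m \<noteq> j" using c ij by blast+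
    then have "m = k" using third_unique[OF ij(1,2) m(1) k(1) ne] k by blast
    then show ?thesis using c m by blast
  qed
  then show False
    by - (rule stirrer_free[of "p j" "q k" "p i" "q i" v "q j" x];
        use ij k ne vq pq in \<open>simp add: adj_commute[of "q _"] adj_commute[of _ x]\<close>)
qed

text \<open>Again domination makes \<open>y\<close> see \<open>p k\<close>. If \<open>y\<close> sees
  \<open>v\<close>, it is the pendant at \<open>v\<close> of the same grid; if not, the square
  \<open>q i, p k, q j, v\<close> with pendants \<open>p j\<close>, \<open>y\<close>,
  \<open>p i\<close> is an armchair.\<close>

lemma miss_p:
  assumes y: "y \<in> V" "col y \<noteq> col v" and ij: "i < 3" "j < 3" "\<not> adj y (p i)" "\<not> adj y (p j)"
  shows "i = j"
proof (rule ccontr)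
  assume ne: "i \<noteq> j"
  obtain k where k: "k < 3" "k \<noteq> i" "k \<noteq> j" using third[OF ij(1,2)] by blast
  have yk: "adj y (p k)"
  proof (cases "y \<in> p ` {..<3} \<union> q ` {..<3}")
    case True
    then obtain m where "m < 3" "y = q m" using y(2) col_p by auto
    then show ?thesis using qp ij k ne by auto
  next
    case False
    then obtain c where c: "c \<in> p ` {..<3} \<union> q ` {..<3}" "adj y c"
      using ring_dominating[OF connected ring_pq y(1)] by blast
    then obtain m where m: "m < 3" "c = p m" using y(2) col_q adj_col[OF c(2)] by auto
    then have "m \<noteq> i" "m \<noteq> j" using c ij by blast+
    then have "m = k" using third_unique[OF ij(1,2) m(1) k(1) ne] k by blast
    then show ?thesis using c m by blast
  qed
  note s = vq[OF ij(1)] vq[OF ij(2)] vq[OF k(1)] qp pq vq[OF ij(1), THEN adj_sym]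
    vq[OF ij(2), THEN adj_sym] vq[OF k(1), THEN adj_sym]
  show False
  proof (cases "adj y v")
    case True
    then show False
      by - (rule stirrer_free[of "q i" v "q j" "p j" "q k" "p i" y];
        use ij k ne s yk adj_sym[OF True] in \<open>simp\<close>)
  next
    case False
    then show False
      by - (rule armchair_free[of "q i" "p k" "q j" v "p j" y "p i"];
        use ij k ne s yk adj_sym[OF yk] in \<open>simp\<close>)
  qed
qed

text \<open>In the bipartite complement, \<open>w\<close> is joined to the vertex of opposite colour
  among \<open>p i\<close>, \<open>q i\<close>; in particular \<open>p i\<close> and
  \<open>q i\<close> themselves satisfy this.\<close>

definition missing :: "nat \<Rightarrow> 'a \<Rightarrow> bool" where
  "missing i w \<longleftrightarrow> w \<in> V \<and> \<not> adj w (if col w = col v then q i else p i)"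

lemma missing_unique: "missing i w \<Longrightarrow>
    missing j w \<Longrightarrow> i < 3 \<Longrightarrow> j < 3 \<Longrightarrow> i = j"
  unfolding missing_def using miss_p[of w i j] miss_q[of w i j] by (auto split: if_splits)

text \<open>\<open>P i\<close> and \<open>Q i\<close> are \<open>p i\<close> and \<open>q i\<close> in the order that starts with the colour of \<open>w\<close>.\<close>

lemma oriented:
  obtains P Q where "\<And>i. i < 3 \<Longrightarrow> P i \<in> V \<and> Q i \<in> V"
    "\<And>i j. i < 3 \<Longrightarrow> j < 3 \<Longrightarrow>
        adj (P i) (Q j) \<longleftrightarrow> i \<noteq> j" "\<And>i j. i < 3 \<Longrightarrow> j < 3 \<Longrightarrow> adj (Q i) (P j) \<longleftrightarrow> i \<noteq> j"
    "\<And>i z. col z = col w \<Longrightarrow> z \<in> V \<Longrightarrow>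
        i < 3 \<Longrightarrow> missing i z \<longleftrightarrow> \<not> adj z (Q i)"
    "\<And>i z. col z \<noteq> col w \<Longrightarrow>
        z \<in> V \<Longrightarrow> i < 3 \<Longrightarrow> missing i z \<longleftrightarrow> \<not> adj z (P i)"
proof (cases "col w = col v")
  case True
  show thesis
    by (rule that[of p q]) (use True p_in q_in pq qp in \<open>auto simp: missing_def\<close>)
next
  case False
  show thesis
    by (rule that[of q p]) (use False p_in q_in pq qp in \<open>auto simp: missing_def\<close>)
qed

text \<open>A nonedge \<open>x y\<close> would link pair \<open>i\<close> to pair \<open>j\<close>
  in the bipartite complement, along \<open>q i\<close>, \<open>x\<close>, \<open>y\<close>,
  \<open>p j\<close>.\<close>

lemma missing_adj:
  assumes x: "missing i x" "col x = col v" and y: "missing j y" "col y \<noteq> col v"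
    and ij: "i < 3" "j < 3" "i \<noteq> j"
  shows "adj x y"
proof (rule ccontr)
  assume n: "\<not> adj x y"
  obtain k where k: "k < 3" "k \<noteq> i" "k \<noteq> j" using third[OF ij(1,2)] by blast
  have nx: "\<not> adj x (q i)" "\<not> adj y (p j)" using x y by (auto simp: missing_def)
  have V: "x \<in> V" "y \<in> V" using x y by (auto simp: missing_def)
  have xq: "adj x (q j)" "adj x (q k)" and yp: "adj y (p i)" "adj y (p k)"
    using miss_q[OF V(1) x(2)] miss_p[OF V(2) y(2)] nx ij k by metis+
  note s = vq[OF ij(1)] vq[OF ij(2)] vq[OF k(1)] qp pq vq[OF ij(1), THEN adj_sym]
    vq[OF ij(2), THEN adj_sym] vq[OF k(1), THEN adj_sym]
    xq yp xq[THEN adj_sym] yp[THEN adj_sym] nx n adj_commute[of y x] adj_commute[of "q _" x]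
  show False
  proof (cases "adj y v")
    case True
    then show False
      by - (rule stirrer_free[of "q i" v "q j" "p j" "q k" x y];
        use ij k s adj_sym[OF True] in \<open>simp\<close>)
  next
    case False
    then show False
      by - (rule armchair_free[of "q j" "p k" "q i" v x y "p j"];
        use ij k s in \<open>simp\<close>)
  qed
qed

text \<open>Keeps two pairs from being linked in the bipartite complement through a vertex
  \<open>x\<close> that misses none of the pairs.\<close>

lemma missing_adj_free:
  assumes "missing i y" "missing j y'" "col y = col y'" "col x \<noteq> col y" "x \<in> V"
    and "\<And>k. k < 3 \<Longrightarrow> \<not> missing k x" "\<not> adj x y" "\<not> adj x y'" and ij: "i < 3" "j < 3"
  shows "i = j"
proof (rule ccontr)
  assume ne: "i \<noteq> j"
  obtain k where k: "k < 3" "k \<noteq> i" "k \<noteq> j" using third[OF ij] by blast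
  obtain P Q where PQ: "\<And>i. i < 3 \<Longrightarrow> P i \<in> V \<and> Q i \<in> V"
    "\<And>i j. i < 3 \<Longrightarrow> j < 3 \<Longrightarrow>
        adj (P i) (Q j) \<longleftrightarrow> i \<noteq> j" "\<And>i j. i < 3 \<Longrightarrow> j < 3 \<Longrightarrow> adj (Q i) (P j) \<longleftrightarrow> i \<noteq> j"
    and m: "\<And>i z. col z = col x \<Longrightarrow>
        z \<in> V \<Longrightarrow> i < 3 \<Longrightarrow> missing i z \<longleftrightarrow> \<not> adj z (Q i)"
    "\<And>i z. col z \<noteq> col x \<Longrightarrow>
        z \<in> V \<Longrightarrow> i < 3 \<Longrightarrow> missing i z \<longleftrightarrow> \<not> adj z (P i)"
    by (rule oriented[of x]) (rule that)
  have V: "y \<in> V" "y' \<in> V" using assms(1,2) by (auto simp: missing_def)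
  have a: "adj x (Q i)" "adj x (Q j)" "adj x (Q k)" using m(1)[OF refl assms(5)] assms(6) ij k by blast+
  have b: "\<not> adj y (P i)" "adj y (P k)" "adj y' (P i)" "adj y' (P k)"
    using m(2)[OF _ V(1)] m(2)[OF _ V(2)] assms(1-4) missing_unique ij k ne by metis+
  note s = PQ(2,3) a a[THEN adj_sym] b b(2-4)[THEN adj_sym] assms(7,8) adj_commute[of y x] adj_commute[of y' x]
  show False
    by (rule stirrer_free[of "Q i" "P k" y' x "Q j" "P i" y]; use s ij k ne in \<open>simp\<close>)
qed

text \<open>Bounds the depth of a component: nonedges lead from pair \<open>i\<close> to a missing
  vertex \<open>x\<close>, then to a vertex \<open>y\<close> missing no pair, but not on to another
  such vertex \<open>x'\<close>.\<close>

lemma missing_adj_free_free: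
  assumes "missing i x" "i < 3" "x' \<in> V" "y \<in> V" "col x = col x'" "col y \<noteq> col x"
    and "\<And>k. k < 3 \<Longrightarrow> \<not> missing k x'" "\<And>k. k < 3 \<Longrightarrow>
        \<not> missing k y" "\<not> adj x y"
  shows "adj x' y"
proof (rule ccontr)
  assume n: "\<not> adj x' y"
  obtain j where j: "j < 3" "j \<noteq> i" using third[OF assms(2,2)] by blast
  obtain k where k: "k < 3" "k \<noteq> i" "k \<noteq> j" using third[OF assms(2) j(1)] by blast
  obtain P Q where PQ: "\<And>i. i < 3 \<Longrightarrow> P i \<in> V \<and> Q i \<in> V"
    "\<And>i j. i < 3 \<Longrightarrow> j < 3 \<Longrightarrow>
        adj (P i) (Q j) \<longleftrightarrow> i \<noteq> j" "\<And>i j. i < 3 \<Longrightarrow> j < 3 \<Longrightarrow> adj (Q i) (P j) \<longleftrightarrow> i \<noteq> j"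
    and m: "\<And>i z. col z = col x \<Longrightarrow>
        z \<in> V \<Longrightarrow> i < 3 \<Longrightarrow> missing i z \<longleftrightarrow> \<not> adj z (Q i)"
    "\<And>i z. col z \<noteq> col x \<Longrightarrow>
        z \<in> V \<Longrightarrow> i < 3 \<Longrightarrow> missing i z \<longleftrightarrow> \<not> adj z (P i)"
    by (rule oriented[of x]) (rule that)
  have V: "x \<in> V" using assms(1) by (auto simp: missing_def)
  have a: "\<not> adj x (Q i)" "adj x (Q k)" using m(1)[OF refl V] assms(1,2) missing_unique k by metis+
  have b: "adj x' (Q i)" "adj x' (Q k)" using m(1)[OF assms(5)[symmetric] assms(3)] assms(2,7) k by blast+
  have c: "adj y (P i)" "adj y (P j)" using m(2)[OF assms(6,4)] assms(2,8) j by blast+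
  note s = PQ(2,3) a b c a(2)[THEN adj_sym] b[THEN adj_sym] c[THEN adj_sym] n assms(9)
    adj_commute[of y x] adj_commute[of y x']
  show False
    by (rule stirrer_free[of "P i" "Q k" x' y "P j" "Q i" x]; use s assms(2) j k in \<open>simp\<close>)
qed

text \<open>
  The sets \<open>hclosed\<close> are the unions of components of the bipartite complement; \<open>part i\<close> contains
  the component of \<open>p i\<close> and \<open>q i\<close>.
\<close>

definition hclosed :: "'a set \<Rightarrow> bool" where
  "hclosed K \<longleftrightarrow> K \<subseteq> V \<and>
      (\<forall>u\<in>K. \<forall>w\<in>V. col u \<noteq> col w \<longrightarrow> \<not> adj u w \<longrightarrow> w \<in> K)"

definition part :: "nat \<Rightarrow> 'a set" where
  "part i = {w \<in> V. missing i w \<or>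
    (\<forall>k<3. \<not> missing k w) \<and>
        (\<exists>z. missing i z \<and> col z \<noteq> col w \<and> \<not> adj w z)}"

lemma hclosedI:
  assumes "K \<subseteq> V" "\<And>u w. u \<in> K \<Longrightarrow>
      w \<in> V \<Longrightarrow> col u \<noteq> col w \<Longrightarrow> \<not> adj u w \<Longrightarrow> w \<in> K"
  shows "hclosed K"
  using assms unfolding hclosed_def by auto

lemma hclosedD:
  assumes "hclosed K" "u \<in> K" "w \<in> V" "w \<notin> K" "col u \<noteq> col w"
  shows "adj u w" "adj w u"
  using assms adj_commute unfolding hclosed_def by blast+

lemma hclosed_diff:
  assumes "hclosed K" "hclosed K'"
  shows "hclosed (K - K')"
proof (rule hclosedI)
  show "K - K' \<subseteq> V" using assms(1) by (auto simp: hclosed_def)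
  fix u w assume h: "u \<in> K - K'" "w \<in> V" "col u \<noteq> col w" "\<not> adj u w"
  then have "w \<in> K" using hclosedD(1)[OF assms(1), of u w] by blast
  moreover have "w \<notin> K'"
  proof
    assume "w \<in> K'"
    moreover have "u \<in> V" using h(1) assms(1) by (auto simp: hclosed_def)
    ultimately show False using hclosedD(2)[OF assms(2), of w u] h by auto
  qed
  ultimately show "w \<in> K - K'" by blast
qed

lemma hclosed_inter: "hclosed K \<Longrightarrow> hclosed K' \<Longrightarrow> hclosed (K \<inter> K')"
  unfolding hclosed_def by blast

text \<open>Call a vertex free if it misses no pair. A nonedge cannot leave \<open>part i\<close>
  between two missing vertices by \<open>missing_adj\<close>, from a free to a missing one by
  \<open>missing_adj_free\<close>, or between free ones by \<open>missing_adj_free_free\<close>;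
  from a missing to a free vertex it stays inside by definition.\<close>

lemma hclosed_part:
  assumes i: "i < 3"
  shows "hclosed (part i)"
proof (rule hclosedI)
  show "part i \<subseteq> V" by (auto simp: part_def)
  fix u w assume u: "u \<in> part i" and w: "w \<in> V" "col u \<noteq> col w" "\<not> adj u w"
  have uV: "u \<in> V" using u by (simp add: part_def)
  have wu: "\<not> adj w u" using w adj_sym by blast
  have mm: "k = j" if m: "missing k x" "missing j y" "col x \<noteq> col y" "\<not> adj x y" "k < 3" "j < 3" for k j x y
  proof (rule ccontr)
    assume "k \<noteq> j"
    then show False
      using missing_adj[OF m(1) _ m(2)] missing_adj[OF m(2) _ m(1)] m(3-6) adj_sym
      by (cases "col x = col v") auto
  qed
  show "w \<in> part i"
  proof (cases "missing i u")
    case True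
    show ?thesis
    proof (cases "\<exists>k<3. missing k w")
      case True
      then obtain k where "k < 3" "missing k w" by blast
      then have "missing i w" using mm[OF \<open>missing i u\<close> _ w(2,3) i] by blast
      then show ?thesis using w(1) by (simp add: part_def)
    next
      case False
      then show ?thesis using w(1,2) wu True by (auto simp: part_def)
    qed
  next
    case False
    then obtain z where free: "\<And>k. k < 3 \<Longrightarrow> \<not> missing k u"
      and z: "missing i z" "col z \<noteq> col u" "\<not> adj u z" using u by (auto simp: part_def)
    have zw: "col z = col w" using z(2) w(2) by blast
    have zV: "z \<in> V" using z(1) by (simp add: missing_def)
    show ?thesis
    proof (cases "\<exists>k<3. missing k w")
      case True
      then obtain k where k: "k < 3" "missing k w" by blast
      have "i = k"
        by (rule missing_adj_free[OF z(1) k(2) zw _ uV free z(3) w(3) i k(1)]) (use z(2) in auto)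
      then show ?thesis using k w(1) by (simp add: part_def)
    next
      case False
      have "adj w u"
        by (rule missing_adj_free_free[OF z(1) i w(1) uV zw _ _ free]) (use z False adj_sym in auto)
      then show ?thesis using wu by blast
    qed
  qed
qed

lemma part_unique:
  assumes w: "w \<in> part i" "w \<in> part j" and ij: "i < 3" "j < 3"
  shows "i = j"
proof (cases "\<exists>k<3. missing k w")
  case True
  then have "missing i w" "missing j w" using w by (auto simp: part_def)
  then show ?thesis using missing_unique ij by blast
next
  case False
  then obtain z z' where z: "missing i z" "col z \<noteq> col w" "\<not> adj w z"
    and z': "missing j z'" "col z' \<noteq> col w" "\<not> adj w z'"
    using w ij by (auto simp: part_def)
  have "w \<in> V" using w by (simp add: part_def)
  show ?thesis
    by (rule missing_adj_free[OF z(1) z'(1) _ _ \<open>w \<in> V\<close> _ z(3) z'(3) ij]) (use False z z' in auto)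
qed

lemma pq_in_part: "i < 3 \<Longrightarrow> p i \<in> part i \<and> q i \<in> part i"
  using p_in q_in pq[of i i] qp[of i i] col_p col_q by (auto simp: part_def missing_def)

text \<open>
  If the nonedges \<open>x1 y2\<close> and \<open>x2 y1\<close> lie in one component \<open>K\<close> of the bipartite complement, then
  \<open>K\<close> contains a path on five vertices; with \<open>s\<close> and \<open>t\<close> it is the complement of a stirrer.
\<close>

lemma component_chain:
  assumes K: "hclosed K" "\<And>K'. hclosed K' \<Longrightarrow>
      K' \<subseteq> K \<Longrightarrow> K' \<noteq> {} \<Longrightarrow> K' = K"
    and out: "s \<in> V" "t \<in> V" "s \<notin> K" "t \<notin> K" "adj s t"
    and x: "x1 \<in> K" "x2 \<in> K" "y1 \<in> K" "y2 \<in> K" "col x1 = col x2" "col y1 \<noteq> col x1" "col y2 \<noteq> col x1"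
    and adj: "adj x1 y1" "adj x2 y2" "\<not> adj x1 y2" "\<not> adj x2 y1"
  shows False
proof -
  define H where "H u w \<longleftrightarrow> u \<in> K \<and>
      w \<in> K \<and> col u \<noteq> col w \<and> \<not> adj u w" for u w
  \<comment> \<open>\<open>H\<close> is the bipartite complement inside \<open>K\<close>, and
    \<open>D\<close> is the nonedge \<open>x1 y2\<close> together with its neighbours in
    \<open>H\<close>.\<close>
  define D where "D = {w. w = x1 \<or> w = y2 \<or> H x1 w \<or> H y2 w}"
  have KV: "K \<subseteq> V" using K(1) by (simp add: hclosed_def)
  have H_sym: "H u w \<Longrightarrow> H w u" for u w using adj_sym by (auto simp: H_def)
  have DK: "D \<subseteq> K" using x by (auto simp: D_def H_def)
  have outside: "adj u w" "adj w u" if "w \<in> {s, t}" "u \<in> K" "col u \<noteq> col w" for u w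
    using hclosedD[OF K(1) that(2), of w] out that(1,3) by blast+
  \<comment> \<open>The middle vertex \<open>w1\<close> is the pendant at \<open>a\<close>, on the
    grid with rows \<open>e a z\<close> and \<open>w2 b w0\<close>; \<open>a\<close>,
    \<open>b\<close> are \<open>s\<close>, \<open>t\<close> in the order that the colours
    require.\<close>
  have path: False if h: "H e w0" "H w0 w1" "H w1 w2" "H w2 z" "\<not> H e w2" "\<not> H w0 z" for e w0 w1 w2 z
  proof -
    have inK: "e \<in> K" "w0 \<in> K" "w1 \<in> K" "w2 \<in> K" "z \<in> K" using h by (auto simp: H_def)
    have col: "col e = col w1" "col z = col w1" "col w0 \<noteq> col w1" "col w2 \<noteq> col w1"
      using h by (auto simp: H_def)
    have ew: "adj e w2" "adj z w0" "adj w0 z" "adj w2 e" using h inK col adj_sym by (auto simp: H_def)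
    have no: "\<not> adj e w0" "\<not> adj z w2" "\<not> adj w1 w2" "\<not> adj w1 w0"
      using h adj_sym by (auto simp: H_def)
    obtain a b where ab: "a \<in> {s, t}" "b \<in> {s, t}" "adj a b" "col a \<noteq> col w1" "col b = col w1"
      using out(5) adj_col[OF out(5)] adj_sym by blast
    have "adj e a" "adj a z" "adj w2 b" "adj b w0" "adj a w1"
      using outside ab inK col by blast+
    then show False
      by - (rule stirrer_free[of e a z w2 b w0 w1]; use ew no ab(3) in simp)
  qed
  \<comment> \<open>Two steps of \<open>H\<close> out of \<open>D\<close> would prolong the edge
    \<open>x1 y2\<close> to a path on five vertices. Hence \<open>D2\<close> is closed and equals
    \<open>K\<close>; yet \<open>x2\<close> and \<open>y1\<close> are joined in \<open>H\<close>
    outside \<open>D\<close>, which is just such an escape.\<close>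
  have escape: False if h: "w1 \<in> D" "w2 \<notin> D" "z \<notin> D" "H w1 w2" "H w2 z" for w1 w2 z
  proof -
    have "H x1 y2" "H y2 x1" using x adj H_sym by (auto simp: H_def)
    moreover have "H x1 w1 \<or> H y2 w1" using h by (auto simp: D_def)
    ultimately show False
      using path[of y2 x1 w1 w2 z] path[of x1 y2 w1 w2 z] h by (auto simp: D_def)
  qed
  define D2 where "D2 = D \<union> {w. \<exists>u\<in>D. H u w}"
  have "D2 = K"
  proof (rule K(2))
    show "hclosed D2"
    proof (rule hclosedI)
      show "D2 \<subseteq> V" using DK KV by (auto simp: D2_def H_def)
      fix u w assume u: "u \<in> D2" and w: "w \<in> V" "col u \<noteq> col w" "\<not> adj u w"
      have "u \<in> K" using u DK by (auto simp: D2_def H_def)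
      then have "w \<in> K" using K(1) w by (auto simp: hclosed_def)
      with \<open>u \<in> K\<close> w have "H u w" by (simp add: H_def)
      then show "w \<in> D2" using u escape[of _ u w] by (auto simp: D2_def)
    qed
    show "D2 \<subseteq> K" using DK by (auto simp: D2_def H_def)
    show "D2 \<noteq> {}" by (auto simp: D2_def D_def)
  qed
  have "x2 \<notin> D" "y1 \<notin> D" using x adj adj_sym by (auto simp: D_def H_def)
  moreover have "H x2 y1" using x adj by (auto simp: H_def)
  moreover obtain u where "u \<in> D" "H u x2"
    using \<open>D2 = K\<close> x(2) \<open>x2 \<notin> D\<close> by (auto simp: D2_def)
  ultimately show False using escape by blast
qed

text \<open>For large sides, a smallest closed \<open>K\<close> with more than \<open>d\<close>
  vertices in \<open>X\<close> is a single component and leaves at most \<open>d\<close> vertices of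
  each side outside. It meets at most one of the three parts, so the other two supply the edge
  outside \<open>K\<close> that \<open>component_chain\<close> needs.\<close>

lemma interval_model_4d:
  assumes free: "biclique_free d adj" and d: "d \<ge> 1"
  shows "interval_model V adj (4 * d)"
proof -
  define X where "X = {x \<in> V. col x = col v}"
  define Y where "Y = {y \<in> V. col y \<noteq> col v}"
  have finXY: "finite X" "finite Y" using finite_V by (auto simp: X_def Y_def)
  \<comment> \<open>A vertex cover costs one extra place in each bag, so it has to be strictly
    smaller than \<open>4 * d\<close>.\<close>
  have cover: ?thesis if S: "S \<subseteq> V" "card S < 4 * d" "\<And>u w. adj u w \<Longrightarrow>
      u \<in> S \<or> w \<in> S" for S
  proof -
    have "interval_model V adj ((4 * d - 1) + 1)"
      by (rule interval_model_vertex_cover[OF finite_V S(1)]) (use S adj_in adj_in2 in auto)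
    then show ?thesis using d by simp
  qed
  have XY: "u \<in> X \<or> w \<in> X" "u \<in> Y \<or> w \<in> Y" if "adj u w" for u w
    using adj_col[OF that] adj_in[OF that] adj_in2[OF that] by (auto simp: X_def Y_def)
  show ?thesis
  proof (cases "card X < 4 * d \<or> card Y < 4 * d")
    case True
    then show ?thesis using cover[of X] cover[of Y] XY by (auto simp: X_def Y_def)
  next
    case False
    then have big: "4 * d \<le> card X" "4 * d \<le> card Y" by auto
    let ?P = "\<lambda>K. hclosed K \<and> d < card (X \<inter> K)"
    have "hclosed V" by (rule hclosedI) auto
    moreover have "X \<inter> V = X" by (auto simp: X_def)
    ultimately have "?P V" using big d by simp
    from ex_has_least_nat[of ?P, OF this, of card]
    obtain K where K: "hclosed K" "d < card (X \<inter> K)"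
      and K_min: "\<And>K'. hclosed K' \<Longrightarrow>
          d < card (X \<inter> K') \<Longrightarrow> card K \<le> card K'" by auto
    have KV: "K \<subseteq> V" using K(1) by (simp add: hclosed_def)
    have finK: "finite K" using KV finite_V by (rule finite_subset)
    have complete: "adj x y" if "x \<in> X" "y \<in> Y" "x \<in> K \<longleftrightarrow> y \<notin> K" for x y

          using hclosedD[OF K(1), of x y] hclosedD[OF K(1), of y x] that by (cases "x \<in> K") (auto simp: X_def Y_def)
    have split: "card Z = card (Z \<inter> K) + card (Z - K)" if "finite Z" for Z
      using card_Un_disjoint[of "Z \<inter> K" "Z - K"] that by (simp add: Int_Diff_Un Int_Diff_disjoint)
    have "card (X \<inter> K) \<le> d \<or> card (Y - K) \<le> d"
      by (rule biclique_freeD[OF free]) (use finXY complete in auto)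
    then have restY: "card (Y - K) \<le> d" using K(2) by simp
    have "card (X - K) \<le> d \<or> card (Y \<inter> K) \<le> d"
      by (rule biclique_freeD[OF free]) (use finXY complete in auto)
    then have restX: "card (X - K) \<le> d" using split[OF finXY(2)] restY big d by linarith
    \<comment> \<open>If \<open>K\<close> split, minimality would leave each piece at most
      \<open>d\<close> vertices of \<open>X\<close>; with at most \<open>d\<close> outside
      \<open>K\<close>, this contradicts \<open>4 * d \<le> card X\<close>.\<close>
    have connK: "K' = K" if K': "hclosed K'" "K' \<subseteq> K" "K' \<noteq> {}" for K'
    proof (rule ccontr)
      assume "K' \<noteq> K"
      then have "card K' < card K" "card (K - K') < card K"
        using K' finK by (auto intro!: psubset_card_mono)
      then have "card (X \<inter> K') \<le> d" "card (X \<inter> (K - K')) \<le> d"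
        using K_min[OF K'(1)] K_min[OF hclosed_diff[OF K(1) K'(1)]] by linarith+
      moreover have "X \<inter> K = (X \<inter> K') \<union> (X \<inter> (K - K'))" using K'(2) by blast
      then have "card (X \<inter> K) \<le> card (X \<inter> K') + card (X \<inter> (K - K'))"
          using card_Un_le by metis
      ultimately show False using split[OF finXY(1)] restX big d by linarith
    qed
    have one: "i = j" if ij: "i < 3" "j < 3" "K \<inter> part i \<noteq> {}" "K \<inter> part j \<noteq> {}" for i j
    proof -
      have "K \<inter> part i = K" "K \<inter> part j = K"
        using connK[OF hclosed_inter[OF K(1) hclosed_part]] ij by auto
      then obtain w where "w \<in> part i" "w \<in> part j" using ij by blast
      then show ?thesis using part_unique ij by blast
    qed
    obtain j k where jk: "j < 3" "k < 3" "j \<noteq> k" "K \<inter> part j = {}" "K \<inter> part k = {}"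
    proof -
      have "\<exists>i<3. \<forall>j<3. j \<noteq> i \<longrightarrow> K \<inter> part j = {}"
      proof (cases "\<exists>i<3. K \<inter> part i \<noteq> {}")
        case True then show ?thesis using one by metis
      qed (auto intro: exI[of _ 0])
      then obtain i where i: "i < 3" "\<And>j. j < 3 \<Longrightarrow>
          j \<noteq> i \<Longrightarrow> K \<inter> part j = {}" by blast
      obtain j where j: "j < 3" "j \<noteq> i" using third[OF i(1) i(1)] by blast
      obtain k where k: "k < 3" "k \<noteq> i" "k \<noteq> j" using third[OF i(1) j(1)] by blast
      show thesis using that[OF j(1) k(1)] j k i(2) by blast
    qed
    have out: "p j \<in> V" "q k \<in> V" "p j \<notin> K" "q k \<notin> K" "adj (p j) (q k)"
      using p_in q_in pq pq_in_part jk by blast+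
    have "\<exists>S\<subseteq>V. card S \<le> 3 * d \<and>
        (\<forall>u w. adj u w \<longrightarrow> u \<in> S \<or> w \<in> S)"
    proof (rule chain_vertex_cover[OF X_def Y_def complete _ free restX restY])
      fix x y x' y' assume h: "x \<in> X \<inter> K" "x' \<in> X \<inter> K" "y \<in> Y \<inter> K" "y' \<in> Y \<inter> K"
        "adj x y" "adj x' y'" "\<not> adj x y'" "\<not> adj x' y"
      show False
        by (rule component_chain[OF K(1) connK out, of x x' y y']) (use h in \<open>auto simp: X_def Y_def\<close>)
    qed
    then obtain S where S: "S \<subseteq> V" "card S \<le> 3 * d" "\<And>u w. adj u w \<Longrightarrow>
        u \<in> S \<or> w \<in> S" by blast
    show ?thesis by (rule cover[OF S(1) _ S(3)]) (use S(2) d in simp)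
  qed
qed

end

section \<open>Combining the two connected cases\<close>

context ats_free
begin

theorem interval_model_if_biclique_free:
  assumes free: "biclique_free d adj" and d: "d \<ge> 1"
  shows "interval_model V adj (4 * d)"
proof (rule interval_model_if_components)
  fix W assume W: "W \<subseteq> V" and conn: "bip_graph.conn W (induced adj W)"
  interpret W: ats_free W "induced adj W" col using W by (rule ats_free_induced)
  note freeW = biclique_free_induced[OF free, of W]
  show "interval_model W (induced adj W) (4 * d)"
  proof (cases "ats_cube_free W (induced adj W) col")
    case True
    then show ?thesis using ats_cube_free.interval_model_if_cube_free[OF _ conn freeW d] by blast
  next
    case False
    then obtain v a1 a2 a3 c1 c2 c3 where h: "induced adj W v a1" "induced adj W v a2" "induced adj W v a3"
      "induced adj W c1 a2" "induced adj W c1 a3" "induced adj W c2 a1" "induced adj W c2 a3"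
      "induced adj W c3 a1" "induced adj W c3 a2"
      "\<not> induced adj W c1 a1" "\<not> induced adj W c2 a2" "\<not> induced adj W c3 a3"
      unfolding ats_cube_free_def ats_cube_free_axioms_def using W.ats_free_axioms by blast
    let ?q = "\<lambda>i::nat. if i = 0 then a1 else if i = 1 then a2 else a3"
    let ?p = "\<lambda>i::nat. if i = 0 then c1 else if i = 1 then c2 else c3"
    interpret W: ats_cube W "induced adj W" col v ?p ?q
    proof unfold_locales
      fix i j :: nat assume "i < 3" "j < 3"
      then have "i = 0 \<or> i = 1 \<or> i = 2" "j = 0 \<or> j = 1 \<or> j = 2" by linarith+
      then show "induced adj W (?p i) (?q j) \<longleftrightarrow>
          i \<noteq> j" using h by (elim disjE) simp_all
    qed (use conn h in auto)
    show ?thesis using W.interval_model_4d[OF freeW d] .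
  qed
qed

end

section \<open>Pathwidth\<close>

text \<open>Injectivity comes from \<open>no_twins\<close>: vertices with equal images have equal
  neighbourhoods in the pattern. This is what lets \<open>ats_free\<close> do without
  distinctness.\<close>

lemma contains_induced_graph_of_edges:
  assumes G: "pair_graph G" and H: "pair_graph (graph_of_edges es)" and es: "Field es = {..<n}"
    and no_twins: "\<forall>i<n. \<forall>j<n. (\<forall>k<n. (i, k) \<in> es \<union> es\<inverse> \<longleftrightarrow>
        (j, k) \<in> es \<union> es\<inverse>) \<longrightarrow> i = j"
    and vs: "length vs = n" "set vs \<subseteq> pverts G"
    and iff: "\<forall>i<n. \<forall>j<n. (i, j) \<in> es \<union> es\<inverse> \<longleftrightarrow>
        (vs ! i, vs ! j) \<in> parcs G"
  shows "contains_induced G (graph_of_edges es)"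
proof -
  have "inj_on ((!) vs) {..<n}"
  proof (rule inj_onI)
    fix i j assume "i \<in> {..<n}" "j \<in> {..<n}" "vs ! i = vs ! j"
    then show "i = j" using no_twins iff by simp
  qed
  moreover have "(!) vs ` {..<n} \<subseteq> pverts G" using vs by auto
  ultimately show ?thesis
    unfolding contains_induced_iff[OF G H]
        using es iff by (intro exI[of _ "(!) vs"]) (simp add: graph_of_edges_def)
qed

lemma all_less_7: "(\<forall>i<7. P i) \<longleftrightarrow>
    P 0 \<and> P 1 \<and> P 2 \<and> P 3 \<and> P 4 \<and> P 5 \<and> P (6::nat)"
  by (simp add: eval_nat_numeral All_less_Suc) blast

lemma lessThan_7: "{..<7} = {0, 1, 2, 3, 4, 5, 6::nat}"
  by auto

lemma ats_free_if_not_contains_induced: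
  assumes G: "pair_graph G" and XY: "pverts G = X \<union> Y" "X \<inter> Y = {}" "parcs G \<subseteq> X \<times> Y \<union> Y \<times> X"
    and no: "\<not> contains_induced G armchair" "\<not> contains_induced G stirrer" "\<not> contains_induced G tripod"
  shows "ats_free (pverts G) (\<lambda>u v. (u, v) \<in> parcs G) (\<lambda>v. v \<in> X)"
proof -
  interpret G: pair_graph G by fact
  let ?adj = "\<lambda>u v. (u, v) \<in> parcs G"
  have sym: "?adj v u" if "?adj u v" for u v
    using that by (rule G.arcs_symmetric)
  have col: "(u \<in> X) \<noteq> (v \<in> X)" if "?adj u v" for u v using XY that by blast
  have same: "\<not> ?adj u v" if "(u \<in> X) = (v \<in> X)" for u v using col that by blast
  have inV: "u \<in> pverts G" "v \<in> pverts G" if "?adj u v" for u v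
    using that G.in_arcsD1 G.in_arcsD2 by blast+
  show ?thesis
  proof unfold_locales
    show "finite (pverts G)" by (rule G.pair_finite_verts)
  next
    fix p a b c a' b' c'
    assume h: "?adj p a" "?adj p b" "?adj p c" "?adj a a'" "?adj b b'" "?adj c c'"
      "\<not> ?adj a b'" "\<not> ?adj a c'" "\<not> ?adj b a'" "\<not> ?adj b c'" "\<not> ?adj c a'" "\<not> ?adj c b'"
    note c = h(1-6)[THEN col]
    have n: "\<not> ?adj b' a" "\<not> ?adj c' a" "\<not> ?adj a' b" "\<not> ?adj c' b" "\<not> ?adj a' c" "\<not> ?adj b' c"
      using h sym by blast+
    have "contains_induced G tripod"
      unfolding tripod_def
    proof (rule contains_induced_graph_of_edges[OF G pair_graph_tripod[unfolded tripod_def]])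
      show "\<forall>i<7. \<forall>j<7. (i, j) \<in> {(0,1), (0,2), (0,3), (1,4), (2,5), (3,6)} \<union> {(0,1), (0,2), (0,3), (1,4), (2,5), (3,6)}\<inverse> \<longleftrightarrow> ?adj ([p, a, b, c, a', b', c'] ! i) ([p, a, b, c, a', b', c'] ! j)"
        using h n h(1-6)[THEN sym] c by (simp add: all_less_7 same)
    qed (use h inV in \<open>auto simp: Field_def lessThan_7 all_less_7\<close>)
    then show False using no by blast
  next
    fix a b c d a' b' c'
    assume h: "?adj a b" "?adj b c" "?adj c d" "?adj d a" "?adj a a'" "?adj b b'" "?adj c c'"
      "\<not> ?adj b' d" "\<not> ?adj b' a'" "\<not> ?adj b' c'" "\<not> ?adj a c'" "\<not> ?adj c a'"
    note c = h(1-7)[THEN col]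
    have n: "\<not> ?adj d b'" "\<not> ?adj a' b'" "\<not> ?adj c' b'" "\<not> ?adj c' a" "\<not> ?adj a' c"
      using h sym by blast+
    have "contains_induced G armchair"
      unfolding armchair_def
    proof (rule contains_induced_graph_of_edges[OF G pair_graph_armchair[unfolded armchair_def]])
      show "\<forall>i<7. \<forall>j<7. (i, j) \<in> {(0,1), (1,2), (2,3), (3,0), (0,4), (1,5), (2,6)} \<union> {(0,1), (1,2), (2,3), (3,0), (0,4), (1,5), (2,6)}\<inverse> \<longleftrightarrow> ?adj ([a, b, c, d, a', b', c'] ! i) ([a, b, c, d, a', b', c'] ! j)"
        using h n h(1-7)[THEN sym] c by (simp add: all_less_7 same)
    qed (use h inV in \<open>auto simp: Field_def lessThan_7 all_less_7\<close>)
    then show False using no by blast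
  next
    fix u0 u1 u2 u3 u4 u5 u6
    assume h: "?adj u0 u1" "?adj u1 u2" "?adj u3 u4" "?adj u4 u5" "?adj u0 u3" "?adj u1 u4" "?adj u2 u5" "?adj u1 u6"
      "\<not> ?adj u0 u5" "\<not> ?adj u2 u3" "\<not> ?adj u6 u3" "\<not> ?adj u6 u5"
    note c = h(1-8)[THEN col]
    have n: "\<not> ?adj u5 u0" "\<not> ?adj u3 u2" "\<not> ?adj u3 u6" "\<not> ?adj u5 u6"
      using h sym by blast+
    have "contains_induced G stirrer"
      unfolding stirrer_def
    proof (rule contains_induced_graph_of_edges[OF G pair_graph_stirrer[unfolded stirrer_def]])
      show "\<forall>i<7. \<forall>j<7. (i, j) \<in> {(0,1), (1,2), (3,4), (4,5), (0,3), (1,4), (2,5), (1,6)} \<union> {(0,1), (1,2), (3,4), (4,5), (0,3), (1,4), (2,5), (1,6)}\<inverse> \<longleftrightarrow> ?adj ([u0, u1, u2, u3, u4, u5, u6] ! i) ([u0, u1, u2, u3, u4, u5, u6] ! j)"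
        using h n h(1-8)[THEN sym] c by (simp add: all_less_7 same)
    qed (use h inV in \<open>auto simp: Field_def lessThan_7 all_less_7\<close>)
    then show False using no by blast
  qed (use sym inV col in blast)+
qed

text \<open>Each side of a biclique is complete to a vertex of the other, hence lies in one colour
  class; shrunk to \<open>d + 1\<close> vertices, the two sides therefore induce exactly the
  forbidden graph.\<close>

lemma biclique_free_if_no_complete_bipartite:
  assumes G: "pair_graph G" and XY: "pverts G = X \<union> Y" "X \<inter> Y = {}" "parcs G \<subseteq> X \<times> Y \<union> Y \<times> X"
    and no: "\<not> (\<exists>H. induced_subgraph H (with_proj G) \<and>
        complete_bipartite_digraph (d + 1) (d + 1) H)"
  shows "biclique_free d (\<lambda>u v. (u, v) \<in> parcs G)"
  unfolding biclique_free_def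
proof (intro allI impI, rule ccontr)
  interpret G: pair_graph G by fact
  fix A B :: "'a set"
  assume AB: "finite A \<and> finite B \<and>
      (\<forall>a\<in>A. \<forall>b\<in>B. (a, b) \<in> parcs G)" and "\<not> (card A \<le> d \<or> card B \<le> d)"
  then have "d + 1 \<le> card A" "d + 1 \<le> card B" by auto
  then obtain A' B' where A': "A' \<subseteq> A" "card A' = d + 1" and B': "B' \<subseteq> B" "card B' = d + 1"
    by (meson obtain_subset_with_card_n)
  have adj: "(a, b) \<in> parcs G" "(b, a) \<in> parcs G" if "a \<in> A'" "b \<in> B'" for a b
    using AB A' B' that G.arcs_symmetric by blast+
  have "A' \<noteq> {}" "B' \<noteq> {}" using A' B' by auto
  then obtain a0 b0 where ab0: "a0 \<in> A'" "b0 \<in> B'" by blast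
  have side: "(u, v) \<in> parcs G \<Longrightarrow>
      (u \<in> X) \<noteq> (v \<in> X)" for u v using XY by blast
  have A'X: "(a \<in> X) = (a0 \<in> X)" if "a \<in> A'" for a
    using side[OF adj(1)[OF that ab0(2)]] side[OF adj(1)[OF ab0]] by blast
  have B'X: "(b \<in> X) = (a0 \<notin> X)" if "b \<in> B'" for b
    using side[OF adj(1)[OF ab0(1) that]] by blast
  let ?H = "\<lparr> pverts = A' \<union> B', parcs = A' \<times> B' \<union> B' \<times> A' \<rparr>"
  have arcs: "parcs ?H = {e \<in> parcs G. fst e \<in> A' \<union> B' \<and> snd e \<in> A' \<union> B'}"
  proof -
    have "(u, w) \<notin> parcs G"
        if "u \<in> A' \<and> w \<in> A' \<or> u \<in> B' \<and> w \<in> B'" for u w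
      using side[of u w] A'X B'X that by blast
    then show ?thesis using adj by auto
  qed
  have sub: "A' \<union> B' \<subseteq> pverts G" using adj ab0 G.in_arcsD1 by blast
  have disj: "A' \<inter> B' = {}" using A'X B'X by blast
  have fin: "finite A'" "finite B'" using A' B' AB finite_subset by blast+
  have "K\<^bsub>d + 1,d + 1\<^esub> (with_proj ?H)"
    unfolding complete_bipartite_digraph_pair_def using A'(2) B'(2) disj fin
    by (intro conjI exI[of _ A'] exI[of _ B']) simp_all
  moreover have "induced_subgraph (with_proj ?H) (with_proj G)"
  proof (rule induced_subgraphI)
    have "wf_digraph (with_proj ?H)" by unfold_locales auto
    then show "subgraph (with_proj ?H) (with_proj G)"
      using adj sub G.wf_digraph_axioms by (auto simp: subgraph_def compatible_def)
  qed (use arcs in simp)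
  ultimately show False using no by blast
qed

text \<open>The bags are the points of time up to the last right end; the intervals of two adjacent
  vertices meet at the larger of their left ends.\<close>

lemma pathwidth_le_if_interval_model:
  assumes G: "pair_graph G" and model: "interval_model (pverts G) (\<lambda>u v. (u, v) \<in> parcs G) k"
  shows "pathwidth G \<le> int k - 1"
proof -
  interpret G: pair_graph G by fact
  obtain l r :: "'a \<Rightarrow> nat" where lr: "\<And>v. v \<in> pverts G \<Longrightarrow> l v \<le> r v"
    "\<And>u v. (u, v) \<in> parcs G \<Longrightarrow> l u \<le> r v"
    "\<And>t. card {v \<in> pverts G. l v \<le> t \<and> t \<le> r v} \<le> k"
    using model unfolding interval_model_def by blast
  define B where "B t = {v \<in> pverts G. l v \<le> t \<and> t \<le> r v}" for t
  define N where "N = Max (insert 0 (r ` pverts G))"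
  have N: "r v \<le> N" if "v \<in> pverts G" for v
    unfolding N_def using that G.pair_finite_verts by (intro Max_ge) auto
  let ?Bs = "map B [0..<Suc N]"
  have set: "set ?Bs = B ` {..N}" by (auto simp: image_def simp del: upt_Suc)
  have "path_decomposition G ?Bs"
    unfolding path_decomposition_def
  proof (intro conjI ballI)
    fix v assume v: "v \<in> pverts G"
    then show "\<exists>B\<in>set ?Bs. v \<in> B"
      unfolding set using lr(1)[OF v] N[OF v] by (intro bexI[of _ "B (r v)"]) (auto simp: B_def)
    show "\<forall>i j k. i \<le> j \<and>
        j \<le> k \<and> k < length ?Bs \<and> v \<in> ?Bs ! i \<and> v \<in> ?Bs ! k \<longrightarrow> v \<in> ?Bs ! j"
      by (auto simp: B_def simp del: upt_Suc)
  next
    fix e assume "e \<in> parcs G"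
    then obtain u v where e: "e = (u, v)" "(u, v) \<in> parcs G" "(v, u) \<in> parcs G"
      using G.arcs_symmetric by (cases e) blast
    then have V: "u \<in> pverts G" "v \<in> pverts G" using G.in_arcsD1 by blast+
    have "{u, v} \<subseteq> B (max (l u) (l v))"
      using V lr(1)[OF V(1)] lr(1)[OF V(2)] lr(2)[OF e(2)] lr(2)[OF e(3)] by (auto simp: B_def)
    moreover have "max (l u) (l v) \<le> N"
      using V lr(1)[OF V(1)] lr(1)[OF V(2)] N[OF V(1)] N[OF V(2)] by auto
    ultimately show "case e of (u, v) \<Rightarrow> \<exists>B\<in>set ?Bs. {u, v} \<subseteq> B"
      unfolding set e by blast
  qed (auto simp: B_def)
  moreover have "width ?Bs \<le> int k - 1"
  proof -
    have "Max (card ` set ?Bs) \<le> k"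
      unfolding set using lr(3) by (subst Max_le_iff) (auto simp: B_def)
    then show ?thesis unfolding width_def by linarith
  qed
  ultimately show ?thesis unfolding pathwidth_le_iff[OF G] by blast
qed

theorem theorem21:
  fixes G :: "'a pair_pre_digraph" and d :: nat
  assumes "d \<ge> 1"
    and "pair_graph G"
    and "bipartite G"
    and "\<not> contains_induced G armchair"
    and "\<not> contains_induced G stirrer"
    and "\<not> contains_induced G tripod"
    and "\<not> (\<exists>H. induced_subgraph H (with_proj G) \<and>
        complete_bipartite_digraph (d + 1) (d + 1) H)"
  shows "pathwidth G \<le> 4 * int d - 1"
proof -
  obtain X Y where XY: "pverts G = X \<union> Y" "X \<inter> Y = {}" "parcs G \<subseteq> X \<times> Y \<union> Y \<times> X"
    using assms(3) unfolding bipartite_def by blast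
  interpret ats_free "pverts G" "\<lambda>u v. (u, v) \<in> parcs G" "\<lambda>v. v \<in> X"
    by (rule ats_free_if_not_contains_induced[OF assms(2) XY assms(4-6)])
  have "interval_model (pverts G) (\<lambda>u v. (u, v) \<in> parcs G) (4 * d)"
    by (rule interval_model_if_biclique_free[OF
          biclique_free_if_no_complete_bipartite[OF assms(2) XY assms(7)] assms(1)])
  from pathwidth_le_if_interval_model[OF assms(2) this] show ?thesis by simp
qed

end
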